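(* Assume that: (1) $M$ is an $m$-dimensional Riemannian manifold equipped with a $C^2$ retraction $R:TM\to M$; $\langle\cdot,\cdot\rangle_x$ denotes the Riemannian inner product on $T_xM$ and $\|\cdot\|_x$ the norm it induces on $T_xM$, for all $x\in M$. (2) $\Omega$ is a probability space with probability measure $\mu$. (3) $f:M\times\Omega\to\mathbb{R}$ is a random function on $M$ such that: (i) $f$ is first-order differentiable in the $M$-direction; (ii) $f$ and $\|\nabla_M f\|$ are locally bounded on $M$; (iii) $f$ has locally $R$-Lipschitz gradient in the $M$-direction. (4) $F:M\to\mathbb{R}$ is the expectation of $f(x,\omega)$ with respect to $\omega$ under the probability distribution $\mu$, that is, $F(x)=E_{\omega\sim\mu}(f(x,\omega))=\int_\Omega f(x,\omega)\,d\mu$ for all $x\in M$. (5) $\rho:M\to\mathbb{R}$ is a $C^2$ confinement of $f$, and $\rho_0\in\mathbb{R}$ is fixed such that $\langle\nabla\rho(x),\nabla_M f(x,\omega)\rangle_x\ge 0$ for every $\omega\in\Omega$ and every $x\in M$ with $\rho(x)\ge\rho_0$. (6) $\{\omega_t\}_{t=0}^\infty$ is a sequence of independent random variables taking values in $\Omega$ with identical probability distribution $\mu$. (7) $a,b,\Theta$ are fixed positive constants and $\{c_t\}_{t=0}^\infty$ is a fixed sequence of positive numbers with $\sum_{t=0}^\infty c_t=\infty$ and $\sum_{t=0}^\infty c_t^2<\infty$. Put $c=\max\{c_t : t\ge0\}$, $\sigma=\sum_{t=0}^\infty c_t^2$ and $\rho_1=\rho_0+ca+\frac{b^2\sigma}{2}$.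 (8) $x_0\in M$ is a fixed point with $\rho(x_0)\le\rho_0$. Define a sequence $\{x_t\}_{t=0}^\infty$ of random elements of $M$ (starting at $x_0$) and a sequence $\{\varphi_t\}_{t=0}^\infty$ of random positive numbers so that, for all $t\ge0$, $$x_{t+1}=R_{x_t}\Big(-\frac{c_t}{\varphi_t}\nabla_M f(x_t,\omega_t)\Big),\qquad \varphi_t\ge\max\Big\{A_t,B_t,\frac{c_t}{\Theta}\Big\},$$ where $$A_t=\frac1a\sup\big\{\max\{0,-\langle\nabla\rho(x_t),\nabla_M f(x_t,\omega)\rangle_{x_t}\} : \omega\in\Omega\big\},$$ $$B_t=\frac1b\sup\Big\{\sqrt{\max\{0,\ \mathrm{Hess}(\rho\circ R_{x_t})|_{\theta\nabla_M f(x_t,\omega)}(\nabla_M f(x_t,\omega),\nabla_M f(x_t,\omega))\}} : |\theta|\le\Theta,\ \omega\in\Omega\Big\}.$$ Then $\{x_t\}_{t=0}^\infty$ is contained in the compact subset $\{x\in M:\rho(x)\le\rho_1\}$ of $M$; in particular, it has convergent subsequences. Assume that $\{\varphi_t\}_{t=0}^\infty$ also satisfies: (a) each $\varphi_t$ is independent of $\{\omega_\tau\}_{\tau=t}^\infty$; (b) $\{\varphi_t\}_{t=0}^\infty$ is bounded above and below by positive numbers, that is, there are $\Phi_{\min},\Phi_{\max}>0$ such that $\Phi_{\min}\le\varphi_t\le\Phi_{\max}$ for all $t\ge0$. Then we further have that: - $\{F(x_t)\}_{t=0}^\infty$ converges almost surely to a finite number; - $\{\|\nabla F(x_t)\|_{x_t}\}_{t=0}^\infty$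 converges almost surely to $0$; - any limit point of $\{x_t\}_{t=0}^\infty$ is almost surely a stationary point of $F$.
   Context: A retraction on a differentiable manifold $M$ is a $C^1$ map $R:TM\to M$ such that for every $x\in M$ the restriction $R_x=R|_{T_xM}$ satisfies $R_x(\mathbf 0_x)=x$, where $\mathbf 0_x$ is the zero vector of $T_xM$, and $dR_x(\mathbf 0_x)=\mathrm{id}_{T_xM}$ (under the canonical identification $T_{\mathbf 0_x}T_xM\cong T_xM$). A random function on $M$ is a function $f:M\times\Omega\to\mathbb{R}$, with $\Omega$ a probability space. It is first-order differentiable in the $M$-direction if $f(\cdot,\omega)$ is first-order differentiable for every $\omega\in\Omega$; then $\nabla_M f(x,\omega)\in T_xM$ is the Riemannian gradient of $f(\cdot,\omega)$ at $x$. A function $h$ on $M\times\Omega$ is locally bounded on $M$ if for every compact $K\subset M$ there is $C_K>0$ with $|h(x,\omega)|\le C_K$ for all $x\in K$, $\omega\in\Omega$. For $x\in M$, $\omega\in\Omega$ put $f_{x,\omega}=f(R_x(\cdot),\omega):T_xM\to\mathbb{R}$, with gradient $\nabla f_{x,\omega}$ taken in the inner product space $T_xM$. The random function $f$ has locally $R$-Lipschitz gradient in the $M$-direction if for every compact $K\subset M$ and every $r>0$ there is $C_{K,r}>0$ with $\|\nabla f_{x,\omega}(\mathbf v)-\nabla f_{x,\omega}(\mathbf 0_x)\|_x\le C_{K,r}\|\mathbf v\|_x$ for all $x\in K$, all $\mathbf v\in T_xM$ with $\|\mathbf v\|_x\le r$ and all $\omega\in\Omega$. A confinement of $f$ on $M$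 is a first-order differentiable function $\rho:M\to\mathbb{R}$ such that (i) for every $\delta\in\mathbb{R}$ the set $\{x\in M:\rho(x)\le\delta\}$ is compact, and (ii) there is $\rho_0\in\mathbb{R}$ with $\langle\nabla\rho(x),\nabla_M f(x,\omega)\rangle_x\ge0$ for every $\omega\in\Omega$ and every $x\in M$ with $\rho(x)\ge\rho_0$. $\mathrm{Hess}(\rho\circ R_x)$ is the Hessian of the function $\rho\circ R_x:T_xM\to\mathbb{R}$, which is defined on the inner product space $T_xM$.
   Formalization: Condition (a) is strengthened: φ_t together with ω_0,…,ω_{t-1} and φ_0,…,φ_{t-1} is jointly independent of {ω_τ}_{τ≥t}; independence of φ_t alone makes the claim false (e.g. φ_t = h(ω_tω_0), fair signs). The dimension m is at least 1. *)

theory Defs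
  imports "HOL-Probability.Probability"
begin

text \<open>\<open>Ck_on k S f\<close> is meant for open \<open>S\<close> in a finite-dimensional space, where requiring every
  directional derivative \<open>x \<mapsto> Df(x)v\<close> to be of class \<open>C\<^sup>k\<close> says that \<open>Df\<close> is of class \<open>C\<^sup>k\<close>.\<close>

primrec Ck_on ::
  "nat \<Rightarrow> 'a::real_normed_vector set \<Rightarrow> ('a \<Rightarrow> 'b::real_normed_vector) \<Rightarrow> bool" where
  "Ck_on 0 S f \<longleftrightarrow> continuous_on S f"
| "Ck_on (Suc k) S f \<longleftrightarrow>
     (\<forall>x\<in>S. f differentiable (at x)) \<and> (\<forall>v. Ck_on k S (\<lambda>x. frechet_derivative f (at x) v))"

definition smooth_on ::
  "'a::real_normed_vector set \<Rightarrow> ('a \<Rightarrow> 'b::real_normed_vector) \<Rightarrow> bool" where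
  "smooth_on S f \<longleftrightarrow> (\<forall>k. Ck_on k S f)"

text \<open>The manifold is the whole type \<open>'a\<close> (Hausdorff and second countable), modelled on the
  Euclidean space \<open>'e\<close>; its dimension is \<open>DIM('e)\<close>. A chart is a pair \<open>(U, \<kappa>)\<close> of an open domain
  and a coordinate map. Values of \<open>\<kappa>\<close> outside \<open>U\<close> are irrelevant.\<close>

type_synonym ('a, 'e) chart = "'a set \<times> ('a \<Rightarrow> 'e)"

abbreviation chart_dom :: "('a, 'e) chart \<Rightarrow> 'a set" where "chart_dom c \<equiv> fst c"
abbreviation chart_map :: "('a, 'e) chart \<Rightarrow> 'a \<Rightarrow> 'e" where "chart_map c \<equiv> snd c"
abbreviation chart_img :: "('a, 'e) chart \<Rightarrow> 'e set" where "chart_img c \<equiv> snd c ` fst c"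

definition chart_inv :: "('a, 'e) chart \<Rightarrow> 'e \<Rightarrow> 'a" where
  "chart_inv c = inv_into (chart_dom c) (chart_map c)"

definition is_chart :: "('a::topological_space, 'e::euclidean_space) chart \<Rightarrow> bool" where
  "is_chart c \<longleftrightarrow> open (chart_dom c) \<and> open (chart_img c) \<and>
     homeomorphism (chart_dom c) (chart_img c) (chart_map c) (chart_inv c)"

definition transition :: "('a, 'e) chart \<Rightarrow> ('a, 'e) chart \<Rightarrow> 'e \<Rightarrow> 'e" where
  "transition c d = chart_map d \<circ> chart_inv c"

definition smooth_atlas ::
  "('a::{t2_space, second_countable_topology}, 'e::euclidean_space) chart set \<Rightarrow> bool" where
  "smooth_atlas \<A> \<longleftrightarrow> (\<forall>c\<in>\<A>. is_chart c) \<and> (\<Union>c\<in>\<A>. chart_dom c) = UNIV \<and>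
     (\<forall>c\<in>\<A>. \<forall>d\<in>\<A>. smooth_on (chart_map c ` (chart_dom c \<inter> chart_dom d)) (transition c d))"

text \<open>Every point \<open>x\<close> gets a preferred chart \<open>chart_at \<A> x\<close> around it, and a tangent vector at \<open>x\<close> is
  represented by its components in that chart. So every \<open>T\<^sub>xM\<close> is a copy of the vector space \<open>'e\<close>,
  and \<open>TM\<close> is the set of pairs \<open>(x, v) :: 'a \<times> 'e\<close>. The topology and the differentiable structure of
  \<open>TM\<close> are not those of the product: they come from the bundle charts
  \<open>(x, v) \<mapsto> (chart_map c x, to_chart \<A> c x v)\<close>, where \<open>to_chart \<A> c x v\<close> are the components of
  \<open>v\<close> in the chart \<open>c\<close>, and \<open>of_chart \<A> c x\<close> is the inverse of \<open>to_chart \<A> c x\<close>.\<close>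

definition chart_at :: "('a, 'e) chart set \<Rightarrow> 'a \<Rightarrow> ('a, 'e) chart" where
  "chart_at \<A> x = (SOME c. c \<in> \<A> \<and> x \<in> chart_dom c)"

definition to_chart ::
  "('a, 'e::euclidean_space) chart set \<Rightarrow> ('a, 'e) chart \<Rightarrow> 'a \<Rightarrow> 'e \<Rightarrow> 'e" where
  "to_chart \<A> c x =
     frechet_derivative (transition (chart_at \<A> x) c) (at (chart_map (chart_at \<A> x) x))"

definition of_chart ::
  "('a, 'e::euclidean_space) chart set \<Rightarrow> ('a, 'e) chart \<Rightarrow> 'a \<Rightarrow> 'e \<Rightarrow> 'e" where
  "of_chart \<A> c x = frechet_derivative (transition c (chart_at \<A> x)) (at (chart_map c x))"

definition local_rep :: "('a, 'e) chart set \<Rightarrow> ('a \<Rightarrow> real) \<Rightarrow> 'a \<Rightarrow> 'e \<Rightarrow> real" where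
  "local_rep \<A> h x = h \<circ> chart_inv (chart_at \<A> x)"

definition mdifferentiable_at ::
  "('a, 'e::euclidean_space) chart set \<Rightarrow> ('a \<Rightarrow> real) \<Rightarrow> 'a \<Rightarrow> bool" where
  "mdifferentiable_at \<A> h x \<longleftrightarrow> local_rep \<A> h x differentiable (at (chart_map (chart_at \<A> x) x))"

definition Ck_manifold ::
  "('a, 'e::euclidean_space) chart set \<Rightarrow> nat \<Rightarrow> ('a \<Rightarrow> real) \<Rightarrow> bool" where
  "Ck_manifold \<A> k h \<longleftrightarrow> (\<forall>c\<in>\<A>. Ck_on k (chart_img c) (h \<circ> chart_inv c))"

definition inner_product_on_model :: "('e::euclidean_space \<Rightarrow> 'e \<Rightarrow> real) \<Rightarrow> bool" where
  "inner_product_on_model B \<longleftrightarrow>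
     bilinear B \<and> (\<forall>u v. B u v = B v u) \<and> (\<forall>v. v \<noteq> 0 \<longrightarrow> B v v > 0)"

definition riemannian_metric ::
  "('a, 'e::euclidean_space) chart set \<Rightarrow> ('a \<Rightarrow> 'e \<Rightarrow> 'e \<Rightarrow> real) \<Rightarrow> bool" where
  "riemannian_metric \<A> g \<longleftrightarrow> (\<forall>x. inner_product_on_model (g x)) \<and>
     (\<forall>c\<in>\<A>. \<forall>u v. smooth_on (chart_img c)
        (\<lambda>p. g (chart_inv c p) (of_chart \<A> c (chart_inv c p) u) (of_chart \<A> c (chart_inv c p) v)))"

definition riemannian_manifold ::
  "('a::{t2_space, second_countable_topology}, 'e::euclidean_space) chart set \<Rightarrow>
   ('a \<Rightarrow> 'e \<Rightarrow> 'e \<Rightarrow> real) \<Rightarrow> bool" where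
  "riemannian_manifold \<A> g \<longleftrightarrow> smooth_atlas \<A> \<and> riemannian_metric \<A> g"

definition gnorm :: "('a \<Rightarrow> 'e \<Rightarrow> 'e \<Rightarrow> real) \<Rightarrow> 'a \<Rightarrow> 'e \<Rightarrow> real" where
  "gnorm g x v = sqrt (g x v v)"

text \<open>Gradient of \<open>h\<close> at \<open>p\<close> in the vector space \<open>'e\<close> with the inner product \<open>B\<close>.\<close>

definition gradient ::
  "('e::euclidean_space \<Rightarrow> 'e \<Rightarrow> real) \<Rightarrow> ('e \<Rightarrow> real) \<Rightarrow> 'e \<Rightarrow> 'e" where
  "gradient B h p = (THE w. \<forall>v. B w v = frechet_derivative h (at p) v)"

definition riem_grad ::
  "('a, 'e::euclidean_space) chart set \<Rightarrow> ('a \<Rightarrow> 'e \<Rightarrow> 'e \<Rightarrow> real) \<Rightarrow> ('a \<Rightarrow> real) \<Rightarrow> 'a \<Rightarrow> 'e" where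
  "riem_grad \<A> g h x = gradient (g x) (local_rep \<A> h x) (chart_map (chart_at \<A> x) x)"

definition stationary_point ::
  "('a, 'e::euclidean_space) chart set \<Rightarrow> ('a \<Rightarrow> 'e \<Rightarrow> 'e \<Rightarrow> real) \<Rightarrow> ('a \<Rightarrow> real) \<Rightarrow> 'a \<Rightarrow> bool" where
  "stationary_point \<A> g h x \<longleftrightarrow> mdifferentiable_at \<A> h x \<and> riem_grad \<A> g h x = 0"

text \<open>The Hessian as a bilinear form is the second derivative; in a vector space it does not depend
  on the (constant) inner product.\<close>

definition hessian :: "('e::euclidean_space \<Rightarrow> real) \<Rightarrow> 'e \<Rightarrow> 'e \<Rightarrow> 'e \<Rightarrow> real" where
  "hessian h p u v = frechet_derivative (\<lambda>q. frechet_derivative h (at q) u) (at p) v"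

text \<open>\<open>tb_dom \<A> R c d\<close> is the set of points of \<open>TM\<close> over the domain of \<open>c\<close> that \<open>R\<close> maps into the
  domain of \<open>d\<close>, and \<open>tb_rep \<A> R c d\<close> is \<open>R\<close>, both in the coordinates of the bundle chart of \<open>c\<close>
  (and of \<open>d\<close> on the target side). Openness of all these sets is part of continuity of \<open>R\<close>.\<close>

definition tb_dom ::
  "('a, 'e::euclidean_space) chart set \<Rightarrow> ('a \<Rightarrow> 'e \<Rightarrow> 'a) \<Rightarrow>
   ('a, 'e) chart \<Rightarrow> ('a, 'e) chart \<Rightarrow> ('e \<times> 'e) set" where
  "tb_dom \<A> R c d =
     {(p, w). p \<in> chart_img c \<and> R (chart_inv c p) (of_chart \<A> c (chart_inv c p) w) \<in> chart_dom d}"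

definition tb_rep ::
  "('a, 'e::euclidean_space) chart set \<Rightarrow> ('a \<Rightarrow> 'e \<Rightarrow> 'a) \<Rightarrow>
   ('a, 'e) chart \<Rightarrow> ('a, 'e) chart \<Rightarrow> 'e \<times> 'e \<Rightarrow> 'e" where
  "tb_rep \<A> R c d =
     (\<lambda>(p, w). chart_map d (R (chart_inv c p) (of_chart \<A> c (chart_inv c p) w)))"

definition Ck_tangent_bundle ::
  "('a, 'e::euclidean_space) chart set \<Rightarrow> nat \<Rightarrow> ('a \<Rightarrow> 'e \<Rightarrow> 'a) \<Rightarrow> bool" where
  "Ck_tangent_bundle \<A> k R \<longleftrightarrow>
     (\<forall>c\<in>\<A>. \<forall>d\<in>\<A>. open (tb_dom \<A> R c d) \<and> Ck_on k (tb_dom \<A> R c d) (tb_rep \<A> R c d))"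

text \<open>Vectors of both \<open>T\<^sub>xM\<close> (the domain of \<open>R x\<close>) and the tangent space at \<open>R x 0 = x\<close> (the target)
  are written in the preferred chart at \<open>x\<close>, so the condition on the differential is literally that
  it is the identity.\<close>

definition retraction_on ::
  "('a, 'e::euclidean_space) chart set \<Rightarrow> ('a \<Rightarrow> 'e \<Rightarrow> 'a) \<Rightarrow> bool" where
  "retraction_on \<A> R \<longleftrightarrow> Ck_tangent_bundle \<A> 1 R \<and>
     (\<forall>x. R x 0 = x \<and> ((chart_map (chart_at \<A> x) \<circ> R x) has_derivative id) (at 0))"

text \<open>\<open>\<Omega>\<close> is \<open>space \<mu>\<close>. Measurability in \<open>\<omega>\<close> is what makes the expectation of \<open>f x\<close> meaningful.\<close>

definition random_function :: "'w measure \<Rightarrow> ('a \<Rightarrow> 'w \<Rightarrow> real) \<Rightarrow> bool" where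
  "random_function \<mu> f \<longleftrightarrow> (\<forall>x. f x \<in> borel_measurable \<mu>)"

definition differentiable_in_M ::
  "('a, 'e::euclidean_space) chart set \<Rightarrow> 'w measure \<Rightarrow> ('a \<Rightarrow> 'w \<Rightarrow> real) \<Rightarrow> bool" where
  "differentiable_in_M \<A> \<mu> f \<longleftrightarrow> (\<forall>\<omega>\<in>space \<mu>. \<forall>x. mdifferentiable_at \<A> (\<lambda>y. f y \<omega>) x)"

definition grad_M ::
  "('a, 'e::euclidean_space) chart set \<Rightarrow> ('a \<Rightarrow> 'e \<Rightarrow> 'e \<Rightarrow> real) \<Rightarrow>
   ('a \<Rightarrow> 'w \<Rightarrow> real) \<Rightarrow> 'a \<Rightarrow> 'w \<Rightarrow> 'e" where
  "grad_M \<A> g f x \<omega> = riem_grad \<A> g (\<lambda>y. f y \<omega>) x"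

definition locally_bounded ::
  "'w measure \<Rightarrow> ('a::topological_space \<Rightarrow> 'w \<Rightarrow> real) \<Rightarrow> bool" where
  "locally_bounded \<mu> h \<longleftrightarrow>
     (\<forall>K. compact K \<longrightarrow> (\<exists>C>0. \<forall>x\<in>K. \<forall>\<omega>\<in>space \<mu>. \<bar>h x \<omega>\<bar> \<le> C))"

definition locally_R_Lipschitz_gradient ::
  "('a::topological_space \<Rightarrow> 'e::euclidean_space \<Rightarrow> 'e \<Rightarrow> real) \<Rightarrow> ('a \<Rightarrow> 'e \<Rightarrow> 'a) \<Rightarrow>
   'w measure \<Rightarrow> ('a \<Rightarrow> 'w \<Rightarrow> real) \<Rightarrow> bool" where
  "locally_R_Lipschitz_gradient g R \<mu> f \<longleftrightarrow>
     (\<forall>K r. compact K \<and> r > 0 \<longrightarrow>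
        (\<exists>C>0. \<forall>x\<in>K. \<forall>v. gnorm g x v \<le> r \<longrightarrow> (\<forall>\<omega>\<in>space \<mu>.
           gnorm g x (gradient (g x) (\<lambda>u. f (R x u) \<omega>) v - gradient (g x) (\<lambda>u. f (R x u) \<omega>) 0)
             \<le> C * gnorm g x v)))"

definition confinement_bound ::
  "('a, 'e::euclidean_space) chart set \<Rightarrow> ('a \<Rightarrow> 'e \<Rightarrow> 'e \<Rightarrow> real) \<Rightarrow>
   'w measure \<Rightarrow> ('a \<Rightarrow> 'w \<Rightarrow> real) \<Rightarrow> ('a \<Rightarrow> real) \<Rightarrow> real \<Rightarrow> bool" where
  "confinement_bound \<A> g \<mu> f \<rho> \<rho>0 \<longleftrightarrow>
     (\<forall>\<omega>\<in>space \<mu>. \<forall>x. \<rho> x \<ge> \<rho>0 \<longrightarrow> g x (riem_grad \<A> g \<rho> x) (grad_M \<A> g f x \<omega>) \<ge> 0)"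

definition confinement ::
  "('a::topological_space, 'e::euclidean_space) chart set \<Rightarrow> ('a \<Rightarrow> 'e \<Rightarrow> 'e \<Rightarrow> real) \<Rightarrow>
   'w measure \<Rightarrow> ('a \<Rightarrow> 'w \<Rightarrow> real) \<Rightarrow> ('a \<Rightarrow> real) \<Rightarrow> bool" where
  "confinement \<A> g \<mu> f \<rho> \<longleftrightarrow> (\<forall>x. mdifferentiable_at \<A> \<rho> x) \<and>
     (\<forall>\<delta>. compact {x. \<rho> x \<le> \<delta>}) \<and> (\<exists>\<rho>0. confinement_bound \<A> g \<mu> f \<rho> \<rho>0)"

definition A_bound ::
  "('a, 'e::euclidean_space) chart set \<Rightarrow> ('a \<Rightarrow> 'e \<Rightarrow> 'e \<Rightarrow> real) \<Rightarrow>
   'w measure \<Rightarrow> ('a \<Rightarrow> 'w \<Rightarrow> real) \<Rightarrow> ('a \<Rightarrow> real) \<Rightarrow> real \<Rightarrow> 'a \<Rightarrow> real" where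
  "A_bound \<A> g \<mu> f \<rho> a x =
     1 / a * (SUP \<omega>\<in>space \<mu>. max 0 (- g x (riem_grad \<A> g \<rho> x) (grad_M \<A> g f x \<omega>)))"

definition B_bound ::
  "('a, 'e::euclidean_space) chart set \<Rightarrow> ('a \<Rightarrow> 'e \<Rightarrow> 'e \<Rightarrow> real) \<Rightarrow> ('a \<Rightarrow> 'e \<Rightarrow> 'a) \<Rightarrow>
   'w measure \<Rightarrow> ('a \<Rightarrow> 'w \<Rightarrow> real) \<Rightarrow> ('a \<Rightarrow> real) \<Rightarrow> real \<Rightarrow> real \<Rightarrow> 'a \<Rightarrow> real" where
  "B_bound \<A> g R \<mu> f \<rho> b \<Theta> x =
     1 / b * (SUP (\<theta>, \<omega>)\<in>{\<theta>. \<bar>\<theta>\<bar> \<le> \<Theta>} \<times> space \<mu>.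
       sqrt (max 0 (hessian (\<rho> \<circ> R x) (\<theta> *\<^sub>R grad_M \<A> g f x \<omega>)
                      (grad_M \<A> g f x \<omega>) (grad_M \<A> g f x \<omega>))))"

text \<open>Independence of two random variables whose value spaces may have different types, which the
  library's \<open>indep_var\<close> does not allow.\<close>

definition indep_rv ::
  "'s measure \<Rightarrow> 'b measure \<Rightarrow> ('s \<Rightarrow> 'b) \<Rightarrow> 'c measure \<Rightarrow> ('s \<Rightarrow> 'c) \<Rightarrow> bool" where
  "indep_rv P N X L Y \<longleftrightarrow> X \<in> measurable P N \<and> Y \<in> measurable P L \<and>
     prob_space.indep_set P {X -` A \<inter> space P | A. A \<in> sets N} {Y -` A \<inter> space P | A. A \<in> sets L}"

text \<open>Independence of the choice of \<open>\<phi> t\<close> from the samples \<open>w t, w (t + 1), \<dots>\<close>. It is required jointly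
  with the history \<open>w 0, \<dots>, w (t - 1), \<phi> 0, \<dots>, \<phi> (t - 1)\<close> that determines the iterate at time \<open>t\<close>.
  Independence of the single variable \<open>\<phi> t\<close> alone would not exclude, for instance,
  \<open>\<phi> t = h ((B (w t) + B (w 0)) mod 2)\<close> (for \<open>t \<ge> 1\<close>) with \<open>B (w i)\<close> fair bits, for which the step at time \<open>t\<close> is
  biased conditionally on \<open>w 0\<close>.\<close>

definition nonanticipating ::
  "'s measure \<Rightarrow> 'w measure \<Rightarrow> (nat \<Rightarrow> 's \<Rightarrow> 'w) \<Rightarrow> (nat \<Rightarrow> 's \<Rightarrow> real) \<Rightarrow> nat \<Rightarrow> bool" where
  "nonanticipating P \<mu> w \<phi> t \<longleftrightarrow>
     indep_rv P
       (PiM {..<t} (\<lambda>_. \<mu>) \<Otimes>\<^sub>M PiM {..t} (\<lambda>_. borel)) (\<lambda>s. (\<lambda>i\<in>{..<t}. w i s, \<lambda>i\<in>{..t}. \<phi> i s))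
       (PiM {t..} (\<lambda>_. \<mu>)) (\<lambda>s. \<lambda>i\<in>{t..}. w i s)"

end

theory Submission
  imports Defs
begin

text \<open>Taylor expansion of \<open>\<rho> \<circ> R\<^bsub>x\<^esub>\<close> along a step shows that \<open>\<rho>\<close> grows by at most \<open>b\<^sup>2 c\<^sub>t\<^sup>2 / 2\<close> at a
  point with \<open>\<rho> \<ge> \<rho>\<^sub>0\<close>, and by at most \<open>c\<^sub>t a\<close> more elsewhere, so the iterates stay in
  \<open>{\<rho> \<le> \<rho>\<^sub>1}\<close>. On this compact set \<open>F (x\<^sub>t)\<close> decreases by \<open>(c\<^sub>t / \<phi>\<^sub>t) \<parallel>\<nabla>F\<parallel>\<^sup>2\<close> up to a summable error and
  a noise term. The noise terms are orthogonal increments bounded by a multiple of \<open>c\<^sub>t\<close>, so their sum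
  converges almost surely by Kolmogorov's maximal inequality. Hence \<open>F (x\<^sub>t)\<close> converges and
  \<open>\<Sum> c\<^sub>t \<parallel>\<nabla>F\<parallel>\<^sup>2 < \<infinity>\<close>. Since the moves are \<open>O(c\<^sub>t)\<close> in charts and \<open>\<parallel>\<nabla>F\<parallel>\<close> is continuous, the gradient
  norms tend to \<open>0\<close>.\<close>

section \<open>Functions of class \<open>C\<^sup>k\<close> and inner products\<close>

text \<open>Components of a tangent vector at \<open>x\<close> refer to
  \<open>chart_at \<A> x\<close>, an arbitrary choice that may vary with \<open>x\<close> neither
  continuously nor measurably. Whatever has to be continuous or measurable in the base point is
  therefore first moved by \<open>to_chart\<close> into one fixed chart, where the gradient is the
  inverse metric applied to the partial derivatives. The Lipschitz hypothesis compares derivatives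
  only after pulling back along \<open>R x\<close> from one base point. Being uniform in \<omega>,
  it yields equicontinuity of the chart derivatives at every point; from this come both the
  differentiability of \<open>F\<close> under the integral sign and the continuity of its gradient
  norm. The noise is orthogonal to the past because the joint law of the past and \<open>w t\<close>
  is a product, so that Fubini applies. This requires gradients that are jointly measurable in the
  point and in \<omega>, whereas \<open>f\<close> is given as measurable in \<omega> for each fixed
  point; continuity in the point and difference quotients bridge the gap.\<close>

lemma frechet_derivative_eqI:
  "(f has_derivative f') (at p) \<Longrightarrow> frechet_derivative f (at p) = f'"
  by (rule frechet_derivative_at[symmetric])

lemma has_frechet_derivative:
  "f differentiable F \<Longrightarrow> (f has_derivative frechet_derivative f F) F"
  by (simp add: frechet_derivative_works)

lemma frechet_derivative_cong_open:
  assumes "open S" "p \<in> S" "\<And>q. q \<in> S \<Longrightarrow> f q = h q"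
  shows "f differentiable (at p) \<longleftrightarrow> h differentiable (at p)"
    and "frechet_derivative f (at p) = frechet_derivative h (at p)"
proof -
  have "(f has_derivative D) (at p) \<longleftrightarrow> (h has_derivative D) (at p)" for D
    using has_derivative_transform_within_open[OF _ assms(1,2)] assms(3) by metis
  then show "f differentiable (at p) \<longleftrightarrow> h differentiable (at p)"
    and "frechet_derivative f (at p) = frechet_derivative h (at p)"
    by (simp_all add: differentiable_def frechet_derivative_def)
qed

lemma Ck_on_cong:
  assumes "open S" "\<And>q. q \<in> S \<Longrightarrow> f q = h q"
  shows "Ck_on k S f \<longleftrightarrow> Ck_on k S h"
  using assms(2)
proof (induction k arbitrary: f h)
  case 0
  then show ?case by (simp cong: continuous_on_cong)
next
  case (Suc k)
  have "Ck_on k S (\<lambda>x. frechet_derivative f (at x) v) = Ck_on k S (\<lambda>x. frechet_derivative h (at x) v)"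
    for v
    by (rule Suc.IH) (simp add: frechet_derivative_cong_open(2)[OF assms(1) _ Suc.prems])
  then show ?case
    using frechet_derivative_cong_open(1)[OF assms(1) _ Suc.prems] by simp
qed

text \<open>Gluing: a map on a whole tangent space, such as \<open>\<rho> \<circ> R x\<close>, is
  accessible only piecewise, near each vector through a chart around its image.\<close>

lemma Ck_on_local:
  assumes "\<And>p. p \<in> S \<Longrightarrow> \<exists>U. open U \<and> p \<in> U \<and> Ck_on k U f"
  shows "Ck_on k S f"
  using assms
proof (induction k arbitrary: f)
  case 0
  have "isCont f p" if p: "p \<in> S" for p
  proof -
    obtain U where "open U" "p \<in> U" "continuous_on U f" using 0 p by auto
    then show ?thesis by (simp add: continuous_on_eq_continuous_at)
  qed
  then show ?case by (simp add: continuous_at_imp_continuous_on)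
next
  case (Suc k)
  have "Ck_on k S (\<lambda>x. frechet_derivative f (at x) v)" for v
  proof (rule Suc.IH)
    fix p assume "p \<in> S"
    from Suc.prems[OF this] show "\<exists>U. open U \<and> p \<in> U \<and> Ck_on k U (\<lambda>x. frechet_derivative f (at x) v)"
      by auto
  qed
  moreover have "f differentiable (at p)" if "p \<in> S" for p
    using Suc.prems[OF that] by auto
  ultimately show ?case by simp
qed

lemma Ck_on_SucD: "open S \<Longrightarrow> Ck_on (Suc k) S f \<Longrightarrow> Ck_on k S f"
proof (induction k arbitrary: f)
  case 0
  then have "isCont f p" if "p \<in> S" for p
    using that by (intro differentiable_imp_continuous_within) simp
  then show ?case by (simp add: continuous_at_imp_continuous_on)
next
  case (Suc k)
  from iffD1[OF Ck_on.simps(2) Suc.prems(2)] Suc.IH[OF Suc.prems(1)]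
  show ?case unfolding Ck_on.simps(2)[where k=k and f=f] by blast
qed

lemma Ck_on_le: "open S \<Longrightarrow> Ck_on n S f \<Longrightarrow> k \<le> n \<Longrightarrow> Ck_on k S f"
proof (induction n)
  case (Suc n)
  then show ?case using Ck_on_SucD[OF Suc.prems(1,2)] by (cases "k = Suc n") auto
qed simp

lemma Ck_on_const: "open S \<Longrightarrow> Ck_on k S (\<lambda>_. c)"
  by (induction k arbitrary: c) (simp_all add: frechet_derivative_eqI[OF has_derivative_const])

lemma Ck_on_add:
  "open S \<Longrightarrow> Ck_on k S f \<Longrightarrow> Ck_on k S h \<Longrightarrow> Ck_on k S (\<lambda>x. f x + h x)"
proof (induction k arbitrary: f h)
  case 0
  then show ?case by (auto intro: continuous_intros)
next
  case (Suc k)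
  have eq: "frechet_derivative (\<lambda>x. f x + h x) (at x) v
    = frechet_derivative f (at x) v + frechet_derivative h (at x) v" if "x \<in> S" for x v
    using Suc.prems that
    by (intro fun_cong[OF frechet_derivative_eqI] has_derivative_add has_frechet_derivative) auto
  have "Ck_on k S (\<lambda>x. frechet_derivative (\<lambda>x. f x + h x) (at x) v)" for v
    by (subst Ck_on_cong[OF Suc.prems(1) eq]) (use Suc in auto)
  then show ?case using Suc.prems by auto
qed

lemma Ck_on_sum:
  assumes "open S" "\<And>i. i \<in> I \<Longrightarrow> Ck_on k S (f i)"
  shows "Ck_on k S (\<lambda>x. \<Sum>i\<in>I. f i x)"
  using assms(2)
  by (induction I rule: infinite_finite_induct)
    (auto intro: Ck_on_add Ck_on_const assms(1))

lemma Ck_on_scaleR: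
  "open S \<Longrightarrow> Ck_on k S f \<Longrightarrow> Ck_on k S h \<Longrightarrow> Ck_on k S (\<lambda>x. f x *\<^sub>R h x)"
proof (induction k arbitrary: f h)
  case 0
  then show ?case by (auto intro: continuous_intros)
next
  case (Suc k)
  have eq: "frechet_derivative (\<lambda>x. f x *\<^sub>R h x) (at x) v
    = f x *\<^sub>R frechet_derivative h (at x) v + frechet_derivative f (at x) v *\<^sub>R h x" if "x \<in> S" for x v
    using Suc.prems that
    by (intro fun_cong[OF frechet_derivative_eqI] has_derivative_scaleR has_frechet_derivative) auto
  have "Ck_on k S (\<lambda>x. frechet_derivative (\<lambda>x. f x *\<^sub>R h x) (at x) v)" for v
  proof -
    have "Ck_on k S f" "Ck_on k S h" using Ck_on_SucD Suc.prems by blast+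
    then have "Ck_on k S (\<lambda>x. f x *\<^sub>R frechet_derivative h (at x) v + frechet_derivative f (at x) v *\<^sub>R h x)"
      using Suc.prems by (intro Ck_on_add Suc.IH) auto
    then show ?thesis by (subst Ck_on_cong[OF Suc.prems(1) eq])
  qed
  then show ?case using Suc.prems by auto
qed

lemma Ck_on_bounded_linear:
  assumes "open S" "bounded_linear L"
  shows "Ck_on k S f \<Longrightarrow> Ck_on k S (\<lambda>x. L (f x))"
proof (induction k arbitrary: f)
  case 0
  then show ?case by (auto intro: bounded_linear.continuous_on[OF assms(2)])
next
  case (Suc k)
  have eq: "frechet_derivative (\<lambda>x. L (f x)) (at x) v = L (frechet_derivative f (at x) v)"
    if "x \<in> S" for x v
    using Suc.prems that
    by (intro fun_cong[OF frechet_derivative_eqI] bounded_linear.has_derivative[OF assms(2)]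
        has_frechet_derivative) auto
  have "Ck_on k S (\<lambda>x. frechet_derivative (\<lambda>x. L (f x)) (at x) v)" for v
    by (subst Ck_on_cong[OF assms(1) eq]) (use Suc in auto)
  moreover have "(\<lambda>x. L (f x)) differentiable (at x)" if "x \<in> S" for x
    using bounded_linear.has_derivative[OF assms(2) has_frechet_derivative, of f "at x"] Suc.prems that
    unfolding differentiable_def by (metis Ck_on.simps(2) differentiable_def)
  ultimately show ?case by simp
qed

lemma differentiable_comp:
  assumes "f differentiable (at (h p))" "h differentiable (at p)"
  shows "(f \<circ> h) differentiable (at p)"
    and "frechet_derivative (f \<circ> h) (at p) v = frechet_derivative f (at (h p)) (frechet_derivative h (at p) v)"
  using assms frechet_derivative_compose[OF assms(2,1)] by (auto intro: differentiable_chain_at)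

text \<open>\<open>Ck_on\<close> controls derivatives in directions that do not depend on the point.
  Expanding a moving direction in the basis reduces it to these.\<close>

lemma frechet_derivative_basis:
  fixes f :: "'b::euclidean_space \<Rightarrow> 'c::real_normed_vector"
  assumes "f differentiable F"
  shows "frechet_derivative f F u = (\<Sum>b\<in>Basis. (u \<bullet> b) *\<^sub>R frechet_derivative f F b)"
  using linear_sum[OF linear_frechet_derivative[OF assms], of "\<lambda>b. (u \<bullet> b) *\<^sub>R b" Basis]
    linear_scale[OF linear_frechet_derivative[OF assms]] by (simp add: euclidean_representation)

text \<open>In the chain rule the outer derivative is taken in a direction that moves with the
  point. In basis coordinates it becomes a finite sum of products: a coordinate of the derivative of
  \<open>h\<close> times a partial derivative of \<open>f\<close> composed with \<open>h\<close>.
  The induction hypothesis is applied to these partial derivatives, so \<open>f\<close> is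
  generalised while \<open>h\<close> stays fixed.\<close>

lemma Ck_on_compose:
  fixes f :: "'b::euclidean_space \<Rightarrow> 'c::real_normed_vector" and h :: "'a::real_normed_vector \<Rightarrow> 'b"
  assumes "open S" "open T"
  shows "Ck_on k T f \<Longrightarrow> Ck_on k S h \<Longrightarrow> h ` S \<subseteq> T \<Longrightarrow> Ck_on k S (f \<circ> h)"
proof (induction k arbitrary: f)
  case 0
  then show ?case using continuous_on_compose[OF _ continuous_on_subset] by simp
next
  case (Suc k)
  have fd: "f differentiable (at (h x))" and hd: "h differentiable (at x)" if "x \<in> S" for x
    using Suc.prems that by auto
  have eq: "frechet_derivative (f \<circ> h) (at x) v
    = (\<Sum>b\<in>Basis. (frechet_derivative h (at x) v \<bullet> b) *\<^sub>R ((\<lambda>y. frechet_derivative f (at y) b) \<circ> h) x)"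
    if "x \<in> S" for x v
    unfolding comp_def
    by (rule trans[OF differentiable_comp(2)[unfolded comp_def, OF fd[OF that] hd[OF that]]
          frechet_derivative_basis[OF fd[OF that]]])
  have "Ck_on k S (\<lambda>x. frechet_derivative (f \<circ> h) (at x) v)" for v
  proof -
    have "Ck_on k S h" by (rule Ck_on_SucD[OF assms(1) Suc.prems(2)])
    then have "Ck_on k S (\<lambda>x. \<Sum>b\<in>Basis. (frechet_derivative h (at x) v \<bullet> b) *\<^sub>R
        ((\<lambda>y. frechet_derivative f (at y) b) \<circ> h) x)"
      using Suc.prems
      by (intro Ck_on_sum Ck_on_scaleR Ck_on_bounded_linear[OF assms(1) bounded_linear_inner_left]
          Suc.IH assms(1)) auto
    then show ?thesis by (subst Ck_on_cong[OF assms(1) eq])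
  qed
  then show ?case unfolding Ck_on.simps(2) using differentiable_comp(1)[OF fd hd] by blast
qed

text \<open>In finite dimension, continuity in each basis direction gives continuity in operator
  norm, the form in which mean value estimates use it.\<close>

lemma Ck_on_1_continuous_derivative:
  fixes f :: "'a::euclidean_space \<Rightarrow> 'b::real_normed_vector"
  assumes "open S" "Ck_on 1 S f" "p \<in> S" "e > 0"
  obtains d where "d > 0" "ball p d \<subseteq> S"
    "\<And>q u. q \<in> ball p d \<Longrightarrow> norm (frechet_derivative f (at q) u - frechet_derivative f (at p) u) \<le> e * norm u"
proof -
  have df: "\<And>q. q \<in> S \<Longrightarrow> f differentiable (at q)"
    and cont: "\<And>v q. q \<in> S \<Longrightarrow> continuous (at q) (\<lambda>x. frechet_derivative f (at x) v)"
    using assms by (auto simp: continuous_on_eq_continuous_at)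
  \<comment> \<open>The \<open>DIM('a)\<close> basis directions contribute at most
    \<open>norm u * e'\<close> each.\<close>
  define e' where "e' = e / real DIM('a)"
  have e': "e' > 0" using assms(4) by (simp add: e'_def)
  have "\<forall>\<^sub>F q in at p. norm (frechet_derivative f (at q) b - frechet_derivative f (at p) b) < e'" for b
    using cont[OF assms(3), of b] e' by (auto simp: continuous_at tendsto_iff dist_norm)
  then have "\<forall>\<^sub>F q in at p. \<forall>b\<in>Basis. norm (frechet_derivative f (at q) b - frechet_derivative f (at p) b) < e'"
    by (intro eventually_ball_finite) auto
  then obtain d1 where d1: "d1 > 0" "\<And>q b. q \<noteq> p \<Longrightarrow> dist q p < d1 \<Longrightarrow> b \<in> Basis \<Longrightarrow>
      norm (frechet_derivative f (at q) b - frechet_derivative f (at p) b) < e'"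
    by (auto simp: eventually_at)
  obtain d2 where d2: "d2 > 0" "ball p d2 \<subseteq> S"
    using assms by (meson openE)
  have "norm (frechet_derivative f (at q) u - frechet_derivative f (at p) u) \<le> e * norm u"
    if q: "q \<in> ball p (min d1 d2)" for q u
  proof -
    have b: "norm (frechet_derivative f (at q) b - frechet_derivative f (at p) b) \<le> e'" if "b \<in> Basis" for b
    proof (cases "q = p")
      case False
      then show ?thesis using d1(2)[OF False _ that] q by (auto simp: dist_commute less_imp_le)
    qed (use e' in simp)
    have qS: "q \<in> S" using d2 q by auto
    have "frechet_derivative f (at q) u - frechet_derivative f (at p) u
      = (\<Sum>b\<in>Basis. (u \<bullet> b) *\<^sub>R (frechet_derivative f (at q) b - frechet_derivative f (at p) b))"
      unfolding frechet_derivative_basis[OF df[OF qS], of u] frechet_derivative_basis[OF df[OF assms(3)], of u]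
      by (simp add: sum_subtractf scaleR_diff_right)
    also have "norm \<dots> \<le> (\<Sum>b\<in>(Basis::'a set). norm u * e')"
      by (intro sum_norm_le) (auto intro!: mult_mono b Basis_le_norm)
    also have "\<dots> = e * norm u" by (simp add: e'_def)
    finally show ?thesis .
  qed
  then show ?thesis by (intro that[of "min d1 d2"]) (use d1(1) d2 in auto)
qed

lemma Ck_on_1_locally_Lipschitz:
  fixes f :: "'a::euclidean_space \<Rightarrow> 'b::real_normed_vector"
  assumes "open S" "Ck_on 1 S f" "p \<in> S"
  obtains d L where "d > 0" "L > 0" "ball p d \<subseteq> S"
    "\<And>q q'. q \<in> ball p d \<Longrightarrow> q' \<in> ball p d \<Longrightarrow> norm (f q - f q') \<le> L * norm (q - q')"
proof -
  obtain d where d: "d > 0" "ball p d \<subseteq> S"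
    "\<And>q u. q \<in> ball p d \<Longrightarrow> norm (frechet_derivative f (at q) u - frechet_derivative f (at p) u) \<le> 1 * norm u"
    using Ck_on_1_continuous_derivative[OF assms zero_less_one] by metis
  have df: "f differentiable (at q)" if "q \<in> S" for q using assms that by simp
  interpret Dp: bounded_linear "frechet_derivative f (at p)"
    using linear_conv_bounded_linear linear_frechet_derivative[OF df[OF assms(3)]] by blast
  obtain K where K: "K > 0" "\<And>u. norm (frechet_derivative f (at p) u) \<le> norm u * K"
    using Dp.pos_bounded by blast
  have bd: "norm (frechet_derivative f (at q) u) \<le> (K + 1) * norm u" if "q \<in> ball p d" for q u
    using norm_triangle_sub[of "frechet_derivative f (at q) u" "frechet_derivative f (at p) u"]
      d(3)[OF that, of u] K(2)[of u] by (simp add: algebra_simps)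
  \<comment> \<open>\<open>K\<close> bounds the derivative at \<open>p\<close> and 1 its oscillation
    on the ball, so the mean value inequality gives the Lipschitz constant
    \<open>K + 1\<close>.\<close>
  have "norm (f q - f q') \<le> (K + 1) * norm (q - q')" if "q \<in> ball p d" "q' \<in> ball p d" for q q'
  proof (rule differentiable_bound[OF convex_ball _ _ that])
    show "(f has_derivative frechet_derivative f (at x)) (at x within ball p d)" if "x \<in> ball p d" for x
      using df d(2) that by (meson frechet_derivative_works has_derivative_at_withinI subsetD)
    show "onorm (frechet_derivative f (at x)) \<le> K + 1" if "x \<in> ball p d" for x
      by (rule onorm_bound) (use K bd[OF that] in auto)
  qed
  then show ?thesis using that[of d "K + 1"] d K by auto
qed

section \<open>Inner products on the model space: norm comparison and Riesz representation\<close>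

lemma bilinear_basis_left:
  fixes B :: "'e::euclidean_space \<Rightarrow> 'e \<Rightarrow> real"
  assumes "bilinear B"
  shows "B u v = (\<Sum>b\<in>Basis. (u \<bullet> b) * B b v)"
proof -
  have "linear (\<lambda>u. B u v)" using assms by (simp add: bilinear_def)
  from linear_sum[OF this, of "\<lambda>b. (u \<bullet> b) *\<^sub>R b" Basis] linear_scale[OF this]
  show ?thesis by (simp add: euclidean_representation)
qed

lemma bilinear_basis:
  fixes B :: "'e::euclidean_space \<Rightarrow> 'e \<Rightarrow> real"
  assumes "bilinear B"
  shows "B u v = (\<Sum>b\<in>Basis. \<Sum>d\<in>Basis. (u \<bullet> b) * (v \<bullet> d) * B b d)"
proof -
  have "bilinear (\<lambda>v u. B u v)" using assms by (simp add: bilinear_def)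
  then have e: "B b v = (\<Sum>d\<in>Basis. (v \<bullet> d) * B b d)" for b
    by (rule bilinear_basis_left)
  have eq: "(u \<bullet> b) * B b v = (\<Sum>d\<in>Basis. (u \<bullet> b) * (v \<bullet> d) * B b d)" for b
    unfolding e[of b] sum_distrib_left by (simp only: mult.assoc)
  show ?thesis unfolding bilinear_basis_left[OF assms, of u v] by (simp only: eq)
qed

locale model_inner_product =
  fixes B :: "'e::euclidean_space \<Rightarrow> 'e \<Rightarrow> real"
  assumes inner_product: "inner_product_on_model B"
begin

lemma bilinear: "bilinear B" and sym: "B u v = B v u" and pos: "v \<noteq> 0 \<Longrightarrow> B v v > 0"
  using inner_product by (auto simp: inner_product_on_model_def)

lemma linear_right: "linear (B u)" and linear_left: "linear (\<lambda>u. B u v)"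
  using bilinear by (auto simp: bilinear_def)

lemmas simps = linear_add[OF linear_right] linear_add[OF linear_left]
  linear_diff[OF linear_right] linear_diff[OF linear_left]
  linear_scale[OF linear_right] linear_scale[OF linear_left]
  linear_neg[OF linear_right] linear_neg[OF linear_left]
  linear_0[OF linear_right] linear_0[OF linear_left]

lemma nonneg: "B v v \<ge> 0"
  using pos[of v] by (cases "v = 0") (auto simp: simps)

lemma eq_0_iff: "B v v = 0 \<longleftrightarrow> v = 0"
  using pos[of v] by (cases "v = 0") (auto simp: simps)

lemma nrm_nonneg: "sqrt (B v v) \<ge> 0"
  by (simp add: nonneg)

lemma cauchy_schwarz: "\<bar>B u v\<bar> \<le> sqrt (B u u) * sqrt (B v v)"
proof (cases "v = 0")
  case False
  define t where "t = B u v / B v v"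
  have "0 \<le> B (u - t *\<^sub>R v) (u - t *\<^sub>R v)" by (rule nonneg)
  also have "\<dots> = B u u - (B u v)\<^sup>2 / B v v"
    using pos[OF False] by (simp add: simps t_def sym[of v u] field_simps power2_eq_square)
  finally have "(B u v)\<^sup>2 \<le> B u u * B v v"
    using pos[OF False] by (simp add: field_simps)
  then have "sqrt ((B u v)\<^sup>2) \<le> sqrt (B u u * B v v)" by (rule real_sqrt_le_mono)
  then show ?thesis by (simp add: real_sqrt_mult)
qed (simp add: simps)

text \<open>\<open>T\<close> sends \<open>w\<close> to the coordinate vector of the functional
  \<open>B w\<close>. Positivity makes \<open>T\<close> injective, and in finite dimension it is
  then onto.\<close>

lemma riesz:
  assumes "linear l"
  shows "\<exists>!w. \<forall>v. B w v = l v"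
proof -
  define T where "T w = (\<Sum>b\<in>Basis. B w b *\<^sub>R b)" for w
  have T: "linear T"
    by (auto intro!: linearI simp: T_def simps scaleR_add_left sum.distrib scaleR_right.sum)
  have Tb: "T w \<bullet> b = B w b" if "b \<in> Basis" for w b
    using that by (simp add: T_def inner_sum_left inner_Basis if_distrib cong: if_cong)
  have eqB: "(\<forall>v. B w v = l v) \<longleftrightarrow> (\<forall>b\<in>Basis. B w b = l b)" for w
    using linear_eq_on[of "B w" l _ Basis] linear_right assms
    by (metis UNIV_I linear_eq_stdbasis)
  have inj: "inj T"
  proof (subst linear_injective_0[OF T], intro allI impI)
    fix w assume "T w = 0"
    then have "\<forall>b\<in>Basis. B w b = 0" using Tb[of _ w] by simp
    then have "B w w = 0"
      using linear_eq_stdbasis[OF linear_right linear_zero, of w] by auto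
    then show "w = 0" by (simp add: eq_0_iff)
  qed
  then obtain w where w: "T w = (\<Sum>b\<in>Basis. l b *\<^sub>R b)"
    using linear_injective_imp_surjective[OF T] by (metis surjD)
  have "B w b = l b" if "b \<in> Basis" for b
    using arg_cong[OF w, of "\<lambda>z. z \<bullet> b"] that Tb[OF that]
    by (simp add: inner_sum_left inner_Basis if_distrib cong: if_cong)
  then have ex: "\<forall>v. B w v = l v" using eqB by blast
  have "w' = w" if "\<forall>v. B w' v = l v" for w'
  proof -
    have "B (w' - w) (w' - w) = 0" using that ex by (simp add: simps)
    then show ?thesis by (simp add: eq_0_iff)
  qed
  with ex show ?thesis by blast
qed

lemma gradient:
  "h differentiable (at p) \<Longrightarrow> B (gradient B h p) v = frechet_derivative h (at p) v"
  using theI'[OF riesz[OF linear_frechet_derivative, of h "at p"]] by (simp add: gradient_def)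

end

lemma Ck_on_id: "open S \<Longrightarrow> Ck_on k S (\<lambda>x. x)"
proof (cases k)
  case (Suc n)
  assume "open S"
  then show ?thesis
    using Suc frechet_derivative_eqI[OF has_derivative_ident] by (simp add: Ck_on_const)
qed (simp add: continuous_on_id)

text \<open>Compactness of the unit sphere and homogeneity. The comparison is with the Euclidean
  norm of the model space, in which all calculus in charts is expressed.\<close>

lemma (in model_inner_product) norm_bounds:
  obtains l C where "l > 0" "C > 0" "\<And>u. l * (norm u)\<^sup>2 \<le> B u u" "\<And>u. B u u \<le> C * (norm u)\<^sup>2"
proof -
  have cont: "continuous_on UNIV (\<lambda>u. B u u)"
  proof -
    have "(\<lambda>u. B u u) = (\<lambda>u. \<Sum>b\<in>Basis. \<Sum>d\<in>Basis. (u \<bullet> b) * (u \<bullet> d) * B b d)"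
      by (rule ext) (rule bilinear_basis[OF bilinear])
    then show ?thesis by (simp only:) (intro continuous_intros)
  qed
  have S: "compact (sphere (0::'e) 1)" "sphere (0::'e) 1 \<noteq> {}"
    by simp_all
  obtain u1 where u1: "u1 \<in> sphere 0 1" "\<And>u. u \<in> sphere 0 1 \<Longrightarrow> B u1 u1 \<le> B u u"
    using continuous_attains_inf[OF S continuous_on_subset[OF cont]] by auto
  obtain u2 where u2: "u2 \<in> sphere 0 1" "\<And>u. u \<in> sphere 0 1 \<Longrightarrow> B u u \<le> B u2 u2"
    using continuous_attains_sup[OF S continuous_on_subset[OF cont]] by auto
  have *: "B u u = (norm u)\<^sup>2 * B (sgn u) (sgn u)" for u
  proof -
    have "norm u *\<^sub>R sgn u = u" by (cases "u = 0") (simp_all add: sgn_div_norm)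
    then have "B u u = B (norm u *\<^sub>R sgn u) (norm u *\<^sub>R sgn u)" by simp
    then show ?thesis by (simp only: simps power2_eq_square real_scaleR_def)
  qed
  have sgn: "sgn u \<in> sphere 0 1" if "u \<noteq> 0" for u :: 'e
    using that by (simp add: norm_sgn)
  have "u1 \<noteq> 0" "u2 \<noteq> 0" using u1(1) u2(1) by auto
  then have "B u1 u1 > 0" "B u2 u2 > 0" using pos by auto
  moreover have "B u1 u1 * (norm u)\<^sup>2 \<le> B u u" "B u u \<le> B u2 u2 * (norm u)\<^sup>2" for u
    using *[of u] u1(2)[OF sgn] u2(2)[OF sgn]
    by (cases "u = 0"; simp add: simps mult_left_mono mult.commute)+
  ultimately show ?thesis using that by metis
qed

locale continuous_inner_products =
  fixes U :: "'p::metric_space set" and B :: "'p \<Rightarrow> 'e::euclidean_space \<Rightarrow> 'e \<Rightarrow> real"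
  assumes open_U: "open U"
    and inner_product: "\<And>p. p \<in> U \<Longrightarrow> inner_product_on_model (B p)"
    and continuous: "\<And>u v. continuous_on U (\<lambda>p. B p u v)"
begin

text \<open>Halving the lower constant found at \<open>p0\<close> leaves room for the variation of
  \<open>B\<close>, so that one pair of constants serves a whole ball.\<close>

lemma local_bounds:
  assumes "p0 \<in> U"
  obtains d l C where "d > 0" "l > 0" "C > 0" "ball p0 d \<subseteq> U"
    "\<And>p u. p \<in> ball p0 d \<Longrightarrow> l * norm u \<le> sqrt (B p u u)"
    "\<And>p u. p \<in> ball p0 d \<Longrightarrow> sqrt (B p u u) \<le> C * norm u"
proof -
  interpret p0: model_inner_product "B p0" using inner_product[OF assms] by unfold_locales
  obtain l C where lC: "l > 0" "C > 0" "\<And>u. l * (norm u)\<^sup>2 \<le> B p0 u u" "\<And>u. B p0 u u \<le> C * (norm u)\<^sup>2"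
    using p0.norm_bounds by blast
  \<comment> \<open>A quadratic form whose \<open>DIM('e) * DIM('e)\<close> coefficients have
    absolute value at most \<open>e\<close> is bounded by
    \<open>l / 2 * (norm u)\<^sup>2\<close>.\<close>
  define e where "e = l / 2 / (real DIM('e) * real DIM('e))"
  have e: "e > 0" using lC by (simp add: e_def)
  have "isCont (\<lambda>p. B p b b') p0" for b b'
    using continuous open_U assms by (simp add: continuous_on_eq_continuous_at)
  then have "\<forall>\<^sub>F p in at p0. \<bar>B p b b' - B p0 b b'\<bar> < e" for b b'
    using e by (auto simp: continuous_at tendsto_iff dist_real_def)
  then have "\<forall>\<^sub>F p in at p0. \<forall>b\<in>Basis. \<forall>b'\<in>Basis. \<bar>B p b b' - B p0 b b'\<bar> < e"
    by (intro eventually_ball_finite ballI) auto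
  then obtain d1 where d1: "d1 > 0" "\<And>p b b'. p \<noteq> p0 \<Longrightarrow> dist p p0 < d1 \<Longrightarrow> b \<in> Basis \<Longrightarrow> b' \<in> Basis \<Longrightarrow>
      \<bar>B p b b' - B p0 b b'\<bar> < e"
    by (auto simp: eventually_at)
  obtain d2 where d2: "d2 > 0" "ball p0 d2 \<subseteq> U" using assms open_U by (meson openE)
  define d where "d = min d1 d2"
  have diff: "\<bar>B p u u - B p0 u u\<bar> \<le> l / 2 * (norm u)\<^sup>2" if p: "p \<in> ball p0 d" for p u
  proof -
    have "p \<in> U" using p d2 by (auto simp: d_def)
    interpret p: model_inner_product "B p" using inner_product[OF \<open>p \<in> U\<close>] by unfold_locales
    have le: "\<bar>B p b b' - B p0 b b'\<bar> \<le> e" if "b \<in> Basis" "b' \<in> Basis" for b b'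
    proof (cases "p = p0")
      case False
      then show ?thesis using d1(2)[OF False _ that] p by (auto simp: d_def dist_commute less_imp_le)
    qed (use e in simp)
    have "B p u u - B p0 u u = (\<Sum>b\<in>Basis. \<Sum>b'\<in>Basis. (u \<bullet> b) * (u \<bullet> b') * (B p b b' - B p0 b b'))"
      unfolding bilinear_basis[OF p.bilinear, of u u] bilinear_basis[OF p0.bilinear, of u u]
      by (simp add: sum_subtractf right_diff_distrib)
    also have "\<bar>\<dots>\<bar> \<le> (\<Sum>b\<in>(Basis::'e set). \<Sum>b'\<in>(Basis::'e set). norm u * norm u * e)"
      unfolding abs_mult
      by (intro order_trans[OF sum_abs] sum_mono order_trans[OF sum_abs])
         (auto simp: abs_mult intro!: mult_mono le Basis_le_norm)
    also have "\<dots> = l / 2 * (norm u)\<^sup>2" by (simp add: e_def power2_eq_square)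
    finally show ?thesis .
  qed
  have "sqrt (l / 2) * norm u \<le> sqrt (B p u u)" "sqrt (B p u u) \<le> sqrt (C + l / 2) * norm u"
    if "p \<in> ball p0 d" for p u
  proof -
    have "l / 2 * (norm u)\<^sup>2 \<le> B p u u" "B p u u \<le> (C + l / 2) * (norm u)\<^sup>2"
      using diff[OF that, of u, THEN abs_le_D1] diff[OF that, of u, THEN abs_le_D2] lC(3,4)[of u]
      by (simp_all add: algebra_simps)
    moreover have "sqrt r * norm u = sqrt (r * (norm u)\<^sup>2)" for r
      by (simp add: real_sqrt_mult)
    ultimately show "sqrt (l / 2) * norm u \<le> sqrt (B p u u)" "sqrt (B p u u) \<le> sqrt (C + l / 2) * norm u"
      by (simp_all only: real_sqrt_le_mono)
  qed
  moreover have "d > 0" "ball p0 d \<subseteq> U" using d1 d2 by (auto simp: d_def)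
  ultimately show ?thesis using that[of d "sqrt (l / 2)" "sqrt (C + l / 2)"] lC by auto
qed

definition riesz_rep :: "'p \<Rightarrow> 'e \<Rightarrow> 'e" where
  "riesz_rep p a = (THE w. \<forall>v. B p w v = a \<bullet> v)"

lemma riesz_rep: "p \<in> U \<Longrightarrow> B p (riesz_rep p a) v = a \<bullet> v"
proof -
  assume "p \<in> U"
  then interpret p: model_inner_product "B p" using inner_product by unfold_locales auto
  show ?thesis using theI'[OF p.riesz[of "\<lambda>v. a \<bullet> v"]]
    by (simp add: riesz_rep_def bounded_linear.linear[OF bounded_linear_inner_right])
qed

lemma riesz_rep_unique: "p \<in> U \<Longrightarrow> (\<And>v. B p w v = a \<bullet> v) \<Longrightarrow> riesz_rep p a = w"
proof -
  assume p: "p \<in> U" and w: "\<And>v. B p w v = a \<bullet> v"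
  interpret p: model_inner_product "B p" using inner_product p by unfold_locales auto
  have "B p (riesz_rep p a - w) (riesz_rep p a - w) = 0"
    by (simp add: p.simps w riesz_rep[OF p])
  then show ?thesis by (simp add: p.eq_0_iff)
qed

text \<open>For \<open>u = riesz_rep p a - w0\<close> the value \<open>B p u u\<close> equals
  \<open>(a - a0) \<bullet> u + (B p0 w0 u - B p w0 u)\<close>. Both summands are at most
  \<open>norm u\<close> times a quantity that vanishes as \<open>(p, a)\<close> tends to
  \<open>(p0, a0)\<close>, while \<open>B p u u\<close> is at least
  \<open>(l * norm u)\<^sup>2\<close>. Dividing by \<open>norm u\<close> gives the bound
  \<open>q\<close>.\<close>

lemma continuous_riesz_rep: "continuous_on (U \<times> UNIV) (\<lambda>(p, a). riesz_rep p a)"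
proof (rule continuous_at_imp_continuous_on, clarify)
  fix p0 a0 assume p0: "p0 \<in> U"
  define w0 where "w0 = riesz_rep p0 a0"
  obtain d l C where d: "d > 0" "l > 0" "ball p0 d \<subseteq> U"
    and l: "\<And>p u. p \<in> ball p0 d \<Longrightarrow> l * norm u \<le> sqrt (B p u u)"
    using local_bounds[OF p0] by metis
  define q where "q z = (norm (snd z - a0) + (\<Sum>b\<in>Basis. \<bar>B (fst z) w0 b - B p0 w0 b\<bar>)) / (l * l)" for z
  have bound: "norm (riesz_rep p a - w0) \<le> q (p, a)" if p: "p \<in> ball p0 d" for p a
  proof -
    have pU: "p \<in> U" using p d by auto
    interpret p: model_inner_product "B p" using inner_product pU by unfold_locales auto
    interpret p0: model_inner_product "B p0" using inner_product p0 by unfold_locales auto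
    define u where "u = riesz_rep p a - w0"
    have "(l * norm u)\<^sup>2 \<le> (sqrt (B p u u))\<^sup>2"
      using l[OF p, of u] d by (intro power_mono) auto
    also have "\<dots> = (a - a0) \<bullet> u + (B p0 w0 u - B p w0 u)"
      using p.nonneg[of u] riesz_rep[OF pU, of a u] riesz_rep[OF p0, of a0 u]
      by (simp add: u_def[symmetric] w0_def[symmetric] inner_diff_left) (simp add: u_def p.simps)
    also have "B p0 w0 u - B p w0 u = (\<Sum>b\<in>Basis. (u \<bullet> b) * (B p0 w0 b - B p w0 b))"
      using linear_sum[OF p0.linear_right, of w0 "\<lambda>b. (u \<bullet> b) *\<^sub>R b" Basis]
        linear_sum[OF p.linear_right, of w0 "\<lambda>b. (u \<bullet> b) *\<^sub>R b" Basis]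
      by (simp add: p.simps p0.simps euclidean_representation right_diff_distrib sum_subtractf)
    also have "\<dots> \<le> (\<Sum>b\<in>Basis. norm u * \<bar>B p w0 b - B p0 w0 b\<bar>)"
    proof (intro sum_mono)
      fix b :: 'e assume b: "b \<in> Basis"
      have "(u \<bullet> b) * (B p0 w0 b - B p w0 b) \<le> \<bar>u \<bullet> b\<bar> * \<bar>B p0 w0 b - B p w0 b\<bar>"
        by (metis abs_ge_self abs_mult)
      also have "\<dots> \<le> norm u * \<bar>B p0 w0 b - B p w0 b\<bar>"
        by (intro mult_right_mono Basis_le_norm b) auto
      finally show "(u \<bullet> b) * (B p0 w0 b - B p w0 b) \<le> norm u * \<bar>B p w0 b - B p0 w0 b\<bar>"
        by (simp add: abs_minus_commute)
    qed
    also have "(a - a0) \<bullet> u \<le> norm u * norm (a - a0)"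
      using norm_cauchy_schwarz[of "a - a0" u] by (simp add: mult.commute)
    finally have *: "(l * norm u)\<^sup>2 \<le> norm u * norm (a - a0) + (\<Sum>b\<in>Basis. norm u * \<bar>B p w0 b - B p0 w0 b\<bar>)"
      by simp
    have *: "l * l * norm u * norm u \<le> (q (p, a) * (l * l)) * norm u"
    proof -
      have "q (p, a) * (l * l) = norm (a - a0) + (\<Sum>b\<in>Basis. \<bar>B p w0 b - B p0 w0 b\<bar>)"
        using d by (simp add: q_def)
      then have "(q (p, a) * (l * l)) * norm u
          = norm u * norm (a - a0) + (\<Sum>b\<in>Basis. norm u * \<bar>B p w0 b - B p0 w0 b\<bar>)"
        by (simp add: distrib_left sum_distrib_left mult.commute)
      then show ?thesis using * by (simp add: power2_eq_square mult_ac)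
    qed
    have "norm u \<le> q (p, a)"
    proof (cases "u = 0")
      case True then show ?thesis using d by (auto simp: q_def intro!: divide_nonneg_pos add_nonneg_nonneg sum_nonneg)
    next
      case False
      then have "l * l * norm u \<le> q (p, a) * (l * l)" using * by (simp add: mult_right_le_imp_le)
      then show ?thesis using d by (simp add: mult.commute)
    qed
    then show ?thesis by (simp add: u_def)
  qed
  have Bc: "isCont (\<lambda>p. B p w0 b) p0" for b
    using continuous open_U p0 by (simp add: continuous_on_eq_continuous_at)
  have "(q \<longlongrightarrow> (norm (a0 - a0) + (\<Sum>b\<in>Basis. \<bar>B p0 w0 b - B p0 w0 b\<bar>)) / (l * l)) (at (p0, a0))"
    unfolding q_def using d
    by (intro tendsto_intros isCont_tendsto_compose[OF Bc] tendsto_fst[where a="(p0, a0)", simplified]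
        tendsto_snd[where a="(p0, a0)", simplified]) auto
  then have "(q \<longlongrightarrow> 0) (at (p0, a0))" by simp
  moreover have "\<forall>\<^sub>F z in at (p0, a0). norm ((\<lambda>(p, a). riesz_rep p a) z - w0) \<le> q z"
  proof -
    have "open (ball p0 d \<times> (UNIV :: 'e set))" by (intro open_Times) auto
    then have "\<forall>\<^sub>F z in at (p0, a0). z \<in> ball p0 d \<times> (UNIV :: 'e set)"
      using d by (intro eventually_at_topological[THEN iffD2]) auto
    then show ?thesis by eventually_elim (use bound in auto)
  qed
  ultimately have "((\<lambda>z. (\<lambda>(p, a). riesz_rep p a) z - w0) \<longlongrightarrow> 0) (at (p0, a0))"
    by (rule Lim_null_comparison[rotated])
  then show "isCont (\<lambda>(p, a). riesz_rep p a) (p0, a0)"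
    unfolding isCont_def by (simp add: LIM_zero_iff w0_def)
qed

end

section \<open>Atlases, Riemannian metrics and retractions\<close>

locale atlas =
  fixes \<A> :: "('a::{t2_space, second_countable_topology}, 'e::euclidean_space) chart set"
  assumes smooth_atlas: "smooth_atlas \<A>"
begin

lemma chart: "c \<in> \<A> \<Longrightarrow> is_chart c"
  using smooth_atlas by (simp add: smooth_atlas_def)

lemma open_chart_dom: "c \<in> \<A> \<Longrightarrow> open (chart_dom c)"
  and open_chart_img: "c \<in> \<A> \<Longrightarrow> open (chart_img c)"
  and continuous_chart_map: "c \<in> \<A> \<Longrightarrow> continuous_on (chart_dom c) (chart_map c)"
  and continuous_chart_inv: "c \<in> \<A> \<Longrightarrow> continuous_on (chart_img c) (chart_inv c)"
  and chart_inv_map: "c \<in> \<A> \<Longrightarrow> y \<in> chart_dom c \<Longrightarrow> chart_inv c (chart_map c y) = y"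
  and chart_map_inv: "c \<in> \<A> \<Longrightarrow> p \<in> chart_img c \<Longrightarrow> chart_map c (chart_inv c p) = p"
  and chart_inv_dom: "c \<in> \<A> \<Longrightarrow> p \<in> chart_img c \<Longrightarrow> chart_inv c p \<in> chart_dom c"
  using chart[of c] by (auto simp: is_chart_def homeomorphism_def)

lemma chart_at: "chart_at \<A> x \<in> \<A>" "x \<in> chart_dom (chart_at \<A> x)"
proof -
  have "\<exists>c. c \<in> \<A> \<and> x \<in> chart_dom c"
    using smooth_atlas unfolding smooth_atlas_def by blast
  from someI_ex[OF this] show "chart_at \<A> x \<in> \<A>" "x \<in> chart_dom (chart_at \<A> x)"
    by (simp_all add: chart_at_def)
qed

definition overlap :: "('a, 'e) chart \<Rightarrow> ('a, 'e) chart \<Rightarrow> 'e set" where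
  "overlap c d = chart_map c ` (chart_dom c \<inter> chart_dom d)"

lemma overlap_iff: "c \<in> \<A> \<Longrightarrow> p \<in> overlap c d \<longleftrightarrow> p \<in> chart_img c \<and> chart_inv c p \<in> chart_dom d"
  unfolding overlap_def using chart_inv_map chart_map_inv chart_inv_dom by (fastforce simp: image_iff)

lemma open_overlap:
  assumes "c \<in> \<A>" "d \<in> \<A>"
  shows "open (overlap c d)"
proof -
  have "overlap c d = chart_img c \<inter> chart_inv c -` chart_dom d"
    using overlap_iff[OF assms(1), of _ d] by auto
  then show ?thesis
    using continuous_open_preimage[OF continuous_chart_inv open_chart_img open_chart_dom] assms by simp
qed

lemma transition_differentiable:
  assumes "c \<in> \<A>" "d \<in> \<A>" "p \<in> overlap c d"
  shows "transition c d differentiable (at p)"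
proof -
  have "Ck_on (Suc 0) (overlap c d) (transition c d)"
    using smooth_atlas assms by (simp add: smooth_atlas_def smooth_on_def overlap_def del: Ck_on.simps)
  then show ?thesis using assms(3) by simp
qed

lemma transition_apply:
  assumes "c \<in> \<A>" "x \<in> chart_dom c"
  shows "transition c d (chart_map c x) = chart_map d x"
  using assms by (simp add: transition_def chart_inv_map)

lemma mem_overlap: "x \<in> chart_dom c \<Longrightarrow> x \<in> chart_dom d \<Longrightarrow> chart_map c x \<in> overlap c d"
  by (simp add: overlap_def)

text \<open>The values of \<open>k\<close> lie in a general normed space so that, besides real
  functions, \<open>k = chart_map c\<close> is covered. That case shows that the derivatives of
  opposite transitions are inverse to each other.\<close>

lemma change_of_chart:
  fixes k :: "'a \<Rightarrow> 'b::real_normed_vector"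
  assumes "c \<in> \<A>" "d \<in> \<A>" "x \<in> chart_dom c" "x \<in> chart_dom d"
    and k: "k \<circ> chart_inv d differentiable (at (chart_map d x))"
  shows "k \<circ> chart_inv c differentiable (at (chart_map c x))"
    and "frechet_derivative (k \<circ> chart_inv c) (at (chart_map c x)) u =
      frechet_derivative (k \<circ> chart_inv d) (at (chart_map d x))
        (frechet_derivative (transition c d) (at (chart_map c x)) u)"
proof -
  have eq: "(k \<circ> chart_inv c) p = ((k \<circ> chart_inv d) \<circ> transition c d) p" if "p \<in> overlap c d" for p
    using that assms chart_inv_map[OF assms(2)] by (auto simp: overlap_iff transition_def)
  note ov = open_overlap[OF assms(1,2)] mem_overlap[OF assms(3,4)]
  have k': "k \<circ> chart_inv d differentiable (at (transition c d (chart_map c x)))"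
    using k by (simp add: transition_apply assms)
  have c1: "k \<circ> chart_inv c differentiable (at (chart_map c x)) \<longleftrightarrow>
      (k \<circ> chart_inv d) \<circ> transition c d differentiable (at (chart_map c x))"
    by (rule frechet_derivative_cong_open(1)[OF ov eq])
  have c2: "frechet_derivative (k \<circ> chart_inv c) (at (chart_map c x)) =
      frechet_derivative ((k \<circ> chart_inv d) \<circ> transition c d) (at (chart_map c x))"
    by (rule frechet_derivative_cong_open(2)[OF ov eq])
  note T = transition_differentiable[OF assms(1,2) ov(2)]
  show "k \<circ> chart_inv c differentiable (at (chart_map c x))"
    unfolding c1 by (rule differentiable_comp(1)[OF k' T])
  show "frechet_derivative (k \<circ> chart_inv c) (at (chart_map c x)) u =
      frechet_derivative (k \<circ> chart_inv d) (at (chart_map d x))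
        (frechet_derivative (transition c d) (at (chart_map c x)) u)"
    unfolding c2 differentiable_comp(2)[OF k' T] by (simp add: transition_apply assms)
qed

lemma transition_self:
  assumes "c \<in> \<A>" "x \<in> chart_dom c"
  shows "frechet_derivative (transition c c) (at (chart_map c x)) = id"
proof -
  have "frechet_derivative (transition c c) (at (chart_map c x)) = frechet_derivative (\<lambda>p. p) (at (chart_map c x))"
    using assms by (intro frechet_derivative_cong_open[OF open_chart_img[OF assms(1)]])
      (auto simp: transition_def chart_map_inv)
  then show ?thesis using frechet_derivative_eqI[OF has_derivative_ident] by (auto simp: id_def)
qed

lemma transition_inverse:
  assumes "c \<in> \<A>" "d \<in> \<A>" "x \<in> chart_dom c" "x \<in> chart_dom d"
  shows "frechet_derivative (transition d c) (at (chart_map d x))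
      (frechet_derivative (transition c d) (at (chart_map c x)) u) = u"
  using change_of_chart(2)[OF assms, of "chart_map c" u] transition_self[OF assms(1,3)]
    transition_differentiable[OF assms(2,1) mem_overlap[OF assms(4,3)]]
  by (simp add: transition_def)

lemma to_of_chart: "c \<in> \<A> \<Longrightarrow> x \<in> chart_dom c \<Longrightarrow> to_chart \<A> c x (of_chart \<A> c x u) = u"
  and of_to_chart: "c \<in> \<A> \<Longrightarrow> x \<in> chart_dom c \<Longrightarrow> of_chart \<A> c x (to_chart \<A> c x u) = u"
  unfolding to_chart_def of_chart_def using transition_inverse chart_at by auto

lemma of_chart_at: "of_chart \<A> (chart_at \<A> x) x = id"
  unfolding of_chart_def using transition_self chart_at by auto

lemma linear_of_chart: "c \<in> \<A> \<Longrightarrow> x \<in> chart_dom c \<Longrightarrow> linear (of_chart \<A> c x)"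
  unfolding of_chart_def using chart_at
  by (intro linear_frechet_derivative transition_differentiable mem_overlap) auto

lemma mdifferentiable_chart:
  assumes "c \<in> \<A>" "x \<in> chart_dom c" "mdifferentiable_at \<A> h x"
  shows "(h \<circ> chart_inv c) differentiable (at (chart_map c x))"
    and "frechet_derivative (h \<circ> chart_inv c) (at (chart_map c x)) u =
      frechet_derivative (local_rep \<A> h x) (at (chart_map (chart_at \<A> x) x)) (of_chart \<A> c x u)"
  using change_of_chart[OF assms(1) chart_at(1) assms(2) chart_at(2), of h]
    assms(3) by (simp_all add: mdifferentiable_at_def local_rep_def of_chart_def)

end

section \<open>Riemannian gradients in a fixed chart\<close>

locale riemannian = atlas \<A>
  for \<A> :: "('a::{t2_space, second_countable_topology}, 'e::euclidean_space) chart set" +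
  fixes g :: "'a \<Rightarrow> 'e \<Rightarrow> 'e \<Rightarrow> real"
  assumes metric: "riemannian_metric \<A> g"
begin

sublocale g: model_inner_product "g x" for x
  using metric by unfold_locales (simp add: riemannian_metric_def)

definition chart_metric :: "('a, 'e) chart \<Rightarrow> 'e \<Rightarrow> 'e \<Rightarrow> 'e \<Rightarrow> real" where
  "chart_metric c p u v = g (chart_inv c p) (of_chart \<A> c (chart_inv c p) u) (of_chart \<A> c (chart_inv c p) v)"

lemma continuous_inner_products_chart_metric:
  assumes "c \<in> \<A>"
  shows "continuous_inner_products (chart_img c) (chart_metric c)"
proof
  show "open (chart_img c)" by (rule open_chart_img[OF assms])
  show "inner_product_on_model (chart_metric c p)" if p: "p \<in> chart_img c" for p
  proof -
    have L: "linear (of_chart \<A> c (chart_inv c p))"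
      by (rule linear_of_chart[OF assms chart_inv_dom[OF assms p]])
    have lin: "linear (chart_metric c p u)" "linear (\<lambda>u. chart_metric c p u v)" for u v
      unfolding chart_metric_def
      using linear_compose[OF L g.linear_right] linear_compose[OF L g.linear_left]
      by (auto simp: comp_def)
    have "of_chart \<A> c (chart_inv c p) v \<noteq> 0" if "v \<noteq> 0" for v
      using to_of_chart[OF assms chart_inv_dom[OF assms p], of v]
        to_of_chart[OF assms chart_inv_dom[OF assms p], of 0] that linear_0[OF L] by metis
    then show ?thesis
      unfolding inner_product_on_model_def bilinear_def using lin g.sym g.pos
      by (auto simp: chart_metric_def)
  qed
  show "continuous_on (chart_img c) (\<lambda>p. chart_metric c p u v)" for u v
  proof -
    have "Ck_on 0 (chart_img c) (\<lambda>p. chart_metric c p u v)"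
      unfolding chart_metric_def using metric assms by (simp add: riemannian_metric_def smooth_on_def del: Ck_on.simps)
    then show ?thesis by simp
  qed
qed

lemma chart_metric_apply:
  "c \<in> \<A> \<Longrightarrow> x \<in> chart_dom c \<Longrightarrow>
    chart_metric c (chart_map c x) u v = g x (of_chart \<A> c x u) (of_chart \<A> c x v)"
  by (simp add: chart_metric_def chart_inv_map)

lemma riem_grad:
  "mdifferentiable_at \<A> h x \<Longrightarrow> g x (riem_grad \<A> g h x) v =
    frechet_derivative (local_rep \<A> h x) (at (chart_map (chart_at \<A> x) x)) v"
  unfolding riem_grad_def mdifferentiable_at_def by (rule g.gradient)

lemma riem_grad_chart:
  assumes "c \<in> \<A>" "x \<in> chart_dom c" "mdifferentiable_at \<A> h x"
  shows "g x (riem_grad \<A> g h x) (of_chart \<A> c x u) =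
    frechet_derivative (h \<circ> chart_inv c) (at (chart_map c x)) u"
  by (simp add: riem_grad[OF assms(3)] mdifferentiable_chart(2)[OF assms])

text \<open>The differential of \<open>h\<close> in the chart, identified with a vector through the
  Euclidean inner product of the model space.\<close>

definition chart_covector :: "('a, 'e) chart \<Rightarrow> ('a \<Rightarrow> real) \<Rightarrow> 'e \<Rightarrow> 'e" where
  "chart_covector c h p = (\<Sum>b\<in>Basis. frechet_derivative (h \<circ> chart_inv c) (at p) b *\<^sub>R b)"

lemma chart_covector_inner:
  assumes "(h \<circ> chart_inv c) differentiable (at p)"
  shows "chart_covector c h p \<bullet> u = frechet_derivative (h \<circ> chart_inv c) (at p) u"
  unfolding frechet_derivative_basis[OF assms, of u]
  by (simp add: chart_covector_def inner_sum_right inner_commute[of _ u] mult.commute)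

text \<open>The coordinate formula for the gradient, inverse metric times partial derivatives. It
  separates two ingredients whose dependence on the base point is accessible: the partial
  derivatives of \<open>h\<close>, and \<open>riesz_rep\<close>, which is jointly
  continuous.\<close>

lemma to_chart_riem_grad:
  assumes "c \<in> \<A>" "x \<in> chart_dom c" "mdifferentiable_at \<A> h x"
  shows "to_chart \<A> c x (riem_grad \<A> g h x) =
    continuous_inner_products.riesz_rep (chart_metric c) (chart_map c x) (chart_covector c h (chart_map c x))"
proof -
  interpret c: continuous_inner_products "chart_img c" "chart_metric c"
    by (rule continuous_inner_products_chart_metric[OF assms(1)])
  show ?thesis
    by (rule c.riesz_rep_unique[symmetric])
      (use assms in \<open>simp_all add: chart_metric_apply of_to_chart riem_grad_chart
        chart_covector_inner mdifferentiable_chart\<close>)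
qed

lemma gnorm_nonneg: "gnorm g x v \<ge> 0"
  unfolding gnorm_def by (rule g.nrm_nonneg)

lemma gnorm_scaleR: "gnorm g x (r *\<^sub>R v) = \<bar>r\<bar> * gnorm g x v"
  by (simp add: gnorm_def g.simps real_sqrt_mult flip: mult.assoc)

lemma cauchy_schwarz: "\<bar>g x u v\<bar> \<le> gnorm g x u * gnorm g x v"
  unfolding gnorm_def by (rule g.cauchy_schwarz)

end

section \<open>Retractions in charts and pullbacks along them\<close>

locale riemannian_retraction = riemannian \<A> g
  for \<A> :: "('a::{t2_space, second_countable_topology}, 'e::euclidean_space) chart set"
    and g :: "'a \<Rightarrow> 'e \<Rightarrow> 'e \<Rightarrow> real" +
  fixes R :: "'a \<Rightarrow> 'e \<Rightarrow> 'a"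
  assumes retraction: "retraction_on \<A> R" and C2: "Ck_tangent_bundle \<A> 2 R"
begin

lemma R_zero: "R x 0 = x"
  and R_deriv: "((chart_map (chart_at \<A> x) \<circ> R x) has_derivative id) (at 0)"
  using retraction by (simp_all add: retraction_on_def)

definition R_dom :: "'a \<Rightarrow> ('a, 'e) chart \<Rightarrow> 'e set" where
  "R_dom x d = {v. R x v \<in> chart_dom d}"

text \<open>A fixed base point cuts a slice out of the bundle chart. With
  \<open>chart_at \<A> x\<close> as source chart, \<open>of_chart\<close> at \<open>x\<close> is the
  identity, so the slice is \<open>R x\<close> itself, without a change of components.\<close>

lemma R_chart:
  assumes "d \<in> \<A>"
  shows "open (R_dom x d)" "Ck_on 2 (R_dom x d) (chart_map d \<circ> R x)"
proof -
  let ?c = "chart_at \<A> x" and ?h = "\<lambda>v. (chart_map (chart_at \<A> x) x, v) :: 'e \<times> 'e"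
  have eq: "R (chart_inv ?c (chart_map ?c x)) (of_chart \<A> ?c (chart_inv ?c (chart_map ?c x)) v) = R x v" for v
    by (simp add: chart_inv_map chart_at of_chart_at)
  have dom: "R_dom x d = ?h -` tb_dom \<A> R ?c d"
    by (auto simp: R_dom_def tb_dom_def eq chart_at)
  have op: "open (tb_dom \<A> R ?c d)" and Ck: "Ck_on 2 (tb_dom \<A> R ?c d) (tb_rep \<A> R ?c d)"
    using C2 chart_at assms by (auto simp: Ck_tangent_bundle_def)
  have contR: "continuous_on UNIV ?h" by (intro continuous_intros)
  show o: "open (R_dom x d)" unfolding dom by (rule open_vimage[OF op contR])
  have "?h = (\<lambda>v. (chart_map ?c x, 0) + (0, v))" by auto
  moreover have "Ck_on 2 (R_dom x d) (\<lambda>v. (chart_map ?c x, 0) + (0::'e, v))"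
    by (intro Ck_on_add o Ck_on_const Ck_on_bounded_linear[where L="\<lambda>v. (0, v)"] Ck_on_id
        bounded_linear_Pair bounded_linear_zero bounded_linear_ident)
  ultimately have "Ck_on 2 (R_dom x d) ?h" by simp
  from Ck_on_compose[OF o op Ck this]
  have "Ck_on 2 (R_dom x d) (tb_rep \<A> R ?c d \<circ> ?h)" by (auto simp: dom)
  moreover have "tb_rep \<A> R ?c d \<circ> ?h = chart_map d \<circ> R x"
    by (auto simp: tb_rep_def eq)
  ultimately show "Ck_on 2 (R_dom x d) (chart_map d \<circ> R x)" by simp
qed

lemma R_chart_differentiable:
  "d \<in> \<A> \<Longrightarrow> v \<in> R_dom x d \<Longrightarrow> (chart_map d \<circ> R x) differentiable (at v)"
  using Ck_on_le[OF R_chart, of d "Suc 0" x] by simp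

lemma compose_R:
  assumes "d \<in> \<A>" "v \<in> R_dom x d" "(h \<circ> chart_inv d) differentiable (at (chart_map d (R x v)))"
  shows "(h \<circ> R x) differentiable (at v)"
    and "frechet_derivative (h \<circ> R x) (at v) u = frechet_derivative (h \<circ> chart_inv d) (at (chart_map d (R x v)))
      (frechet_derivative (chart_map d \<circ> R x) (at v) u)"
proof -
  have eq: "(h \<circ> R x) q = ((h \<circ> chart_inv d) \<circ> (chart_map d \<circ> R x)) q" if "q \<in> R_dom x d" for q
    using that assms(1) by (simp add: R_dom_def chart_inv_map)
  have c1: "(h \<circ> R x) differentiable (at v) \<longleftrightarrow>
      ((h \<circ> chart_inv d) \<circ> (chart_map d \<circ> R x)) differentiable (at v)"
    by (rule frechet_derivative_cong_open(1)[OF R_chart(1)[OF assms(1)] assms(2) eq])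
  have c2: "frechet_derivative (h \<circ> R x) (at v) =
      frechet_derivative ((h \<circ> chart_inv d) \<circ> (chart_map d \<circ> R x)) (at v)"
    by (rule frechet_derivative_cong_open(2)[OF R_chart(1)[OF assms(1)] assms(2) eq])
  have D: "(h \<circ> chart_inv d) differentiable (at ((chart_map d \<circ> R x) v))" using assms(3) by simp
  note d = differentiable_comp[OF D R_chart_differentiable[OF assms(1,2)]]
  show "(h \<circ> R x) differentiable (at v)" unfolding c1 by (rule d)
  show "frechet_derivative (h \<circ> R x) (at v) u = frechet_derivative (h \<circ> chart_inv d) (at (chart_map d (R x v)))
      (frechet_derivative (chart_map d \<circ> R x) (at v) u)"
    unfolding c2 d(2) by simp
qed

lemma compose_R_differentiable:
  assumes "\<And>y. mdifferentiable_at \<A> h y"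
  shows "(h \<circ> R x) differentiable (at v)"
  by (rule compose_R(1)[OF chart_at(1)[of "R x v"]])
    (use chart_at(2)[of "R x v"] in \<open>auto simp: R_dom_def intro!: mdifferentiable_chart assms chart_at\<close>)

text \<open>The differential of \<open>R x\<close> at 0 is the identity in the preferred chart at
  \<open>x\<close>, so pulling back along \<open>R x\<close> preserves first derivatives at the base
  point.\<close>

lemma compose_R_deriv_0:
  assumes "mdifferentiable_at \<A> h x"
  shows "frechet_derivative (h \<circ> R x) (at 0) = frechet_derivative (local_rep \<A> h x) (at (chart_map (chart_at \<A> x) x))"
proof
  fix u
  show "frechet_derivative (h \<circ> R x) (at 0) u = frechet_derivative (local_rep \<A> h x) (at (chart_map (chart_at \<A> x) x)) u"
    using compose_R(2)[OF chart_at(1)[of x], where x=x and v=0 and h=h and u=u] chart_at(2)[of x]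
      frechet_derivative_eqI[OF R_deriv[of x]] assms
    by (simp add: R_dom_def R_zero mdifferentiable_at_def local_rep_def)
qed

lemma C2_compose_R:
  assumes "Ck_manifold \<A> 2 h"
  shows "Ck_on 2 UNIV (h \<circ> R x)"
proof (rule Ck_on_local)
  fix v
  let ?d = "chart_at \<A> (R x v)"
  have d: "?d \<in> \<A>" "v \<in> R_dom x ?d" using chart_at by (auto simp: R_dom_def)
  have "Ck_on 2 (R_dom x ?d) ((h \<circ> chart_inv ?d) \<circ> (chart_map ?d \<circ> R x))"
    using assms d(1) by (intro Ck_on_compose[OF R_chart(1) open_chart_img _ R_chart(2)])
      (auto simp: Ck_manifold_def R_dom_def)
  then have "Ck_on 2 (R_dom x ?d) (h \<circ> R x)"
    by (subst Ck_on_cong[OF R_chart(1)[OF d(1)], of x _ "(h \<circ> chart_inv ?d) \<circ> (chart_map ?d \<circ> R x)"])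
      (auto simp: R_dom_def chart_inv_map d(1))
  then show "\<exists>U. open U \<and> v \<in> U \<and> Ck_on 2 U (h \<circ> R x)" using R_chart(1)[OF d(1)] d by blast
qed

text \<open>No single target chart has to contain all values. Continuity is local, so a target chart
  is chosen around each value, and there \<open>tb_rep\<close> is continuous on an open set.\<close>

lemma continuous_R_chart:
  assumes c: "c \<in> \<A>"
  shows "continuous_on (chart_img c \<times> UNIV) (\<lambda>(p, w). R (chart_inv c p) (of_chart \<A> c (chart_inv c p) w))"
    (is "continuous_on _ ?R")
proof -
  have "isCont ?R (p, w)" if "p \<in> chart_img c" for p w
  proof -
    let ?d = "chart_at \<A> (?R (p, w))"
    have d: "?d \<in> \<A>" "(p, w) \<in> tb_dom \<A> R c ?d"
      using chart_at[of "?R (p, w)"] that by (auto simp: tb_dom_def)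
    have op: "open (tb_dom \<A> R c ?d)" and Ck: "Ck_on 2 (tb_dom \<A> R c ?d) (tb_rep \<A> R c ?d)"
      using C2 c d(1) by (auto simp: Ck_tangent_bundle_def)
    have "continuous_on (tb_dom \<A> R c ?d) (tb_rep \<A> R c ?d)"
      using Ck_on_le[OF op Ck, of 0] by simp
    then have "continuous_on (tb_dom \<A> R c ?d) (chart_inv ?d \<circ> tb_rep \<A> R c ?d)"
      by (intro continuous_on_compose continuous_on_subset[OF continuous_chart_inv[OF d(1)]])
        (auto simp: tb_rep_def tb_dom_def)
    then have "continuous_on (tb_dom \<A> R c ?d) ?R"
      by (rule continuous_on_eq) (auto simp: tb_rep_def tb_dom_def chart_inv_map[OF chart_at(1)])
    then show ?thesis using continuous_on_eq_continuous_at[OF op] d(2) by blast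
  qed
  then show ?thesis by (intro continuous_at_imp_continuous_on) auto
qed

end

section \<open>Confinement of the iterates\<close>

lemma hessian_sum:
  fixes \<psi> :: "'e::euclidean_space \<Rightarrow> real"
  assumes "Ck_on 2 UNIV \<psi>"
  shows "hessian \<psi> q u v = (\<Sum>b\<in>Basis. \<Sum>d\<in>Basis. (u \<bullet> b) * (v \<bullet> d) * hessian \<psi> q b d)"
proof -
  have d: "\<psi> differentiable (at q)" "(\<lambda>q. frechet_derivative \<psi> (at q) u) differentiable (at q)" for q u
    using assms by (simp_all add: numeral_2_eq_2)
  have eq: "(\<lambda>q. frechet_derivative \<psi> (at q) u) = (\<lambda>q. \<Sum>b\<in>Basis. (u \<bullet> b) *\<^sub>R frechet_derivative \<psi> (at q) b)"
    by (rule ext) (rule frechet_derivative_basis[OF d(1)])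
  have "((\<lambda>q. \<Sum>b\<in>Basis. (u \<bullet> b) *\<^sub>R frechet_derivative \<psi> (at q) b) has_derivative
      (\<lambda>v. \<Sum>b\<in>Basis. (u \<bullet> b) *\<^sub>R hessian \<psi> q b v)) (at q)"
    unfolding hessian_def
    by (intro has_derivative_sum has_derivative_scaleR_right has_frechet_derivative d)
  then have "hessian \<psi> q u v = (\<Sum>b\<in>Basis. (u \<bullet> b) *\<^sub>R hessian \<psi> q b v)"
    unfolding hessian_def[of \<psi> q u] eq by (simp add: frechet_derivative_eqI)
  moreover have "hessian \<psi> q b v = (\<Sum>d\<in>Basis. (v \<bullet> d) *\<^sub>R hessian \<psi> q b d)" for b
    unfolding hessian_def by (rule frechet_derivative_basis[OF d(2)])
  ultimately show ?thesis by (simp add: sum_distrib_left mult.assoc)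
qed

text \<open>Provides the boundedness that the real supremum in \<open>B_bound\<close> requires in
  order to dominate its members. By bilinearity it suffices to bound the finitely many continuous
  functions \<open>hessian \<psi> q b d\<close> on a ball.\<close>

lemma hessian_bounded:
  fixes \<psi> :: "'e::euclidean_space \<Rightarrow> real"
  assumes "Ck_on 2 UNIV \<psi>"
  obtains C where "\<And>q u. norm q \<le> r \<Longrightarrow> norm u \<le> r \<Longrightarrow> \<bar>hessian \<psi> q u u\<bar> \<le> C"
proof -
  have "continuous_on UNIV (\<lambda>q. hessian \<psi> q b d)" for b d
    using assms by (simp add: numeral_2_eq_2 hessian_def)
  then have "bounded ((\<lambda>q. hessian \<psi> q b d) ` cball 0 r)" for b d
    by (meson compact_cball compact_continuous_image compact_imp_bounded continuous_on_subset subset_UNIV)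
  then have "\<exists>C. \<forall>q. norm q \<le> r \<longrightarrow> \<bar>hessian \<psi> q b d\<bar> \<le> C" for b d
    unfolding bounded_iff by (metis imageI mem_cball_0 real_norm_def)
  then have "\<forall>z. \<exists>C. \<forall>q. norm q \<le> r \<longrightarrow> \<bar>hessian \<psi> q (fst z) (snd z)\<bar> \<le> C" by blast
  from choice[OF this] obtain C'
    where C': "\<And>z q. norm q \<le> r \<Longrightarrow> \<bar>hessian \<psi> q (fst z) (snd z)\<bar> \<le> C' z"
    by blast
  define C where "C b d = C' (b, d)" for b d
  have C: "\<bar>hessian \<psi> q b d\<bar> \<le> C b d" if "norm q \<le> r" for b d q
    using C'[OF that, of "(b, d)"] by (simp add: C_def)
  have "\<bar>hessian \<psi> q u u\<bar> \<le> (\<Sum>b\<in>Basis. \<Sum>d\<in>Basis. r * r * C b d)" if "norm q \<le> r" "norm u \<le> r" for q u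
  proof -
    have "r \<ge> 0" using that norm_ge_zero order_trans by blast
    have "\<bar>(u \<bullet> b) * (u \<bullet> d) * hessian \<psi> q b d\<bar> \<le> r * r * C b d" if "b \<in> Basis" "d \<in> Basis" for b d
      unfolding abs_mult using C[OF \<open>norm q \<le> r\<close>, of b d] \<open>norm u \<le> r\<close> \<open>r \<ge> 0\<close>
        Basis_le_norm[OF that(1), of u] Basis_le_norm[OF that(2), of u]
      by (intro mult_mono) auto
    then show ?thesis
      unfolding hessian_sum[OF assms, of q u u]
      by (intro order_trans[OF sum_abs] sum_mono order_trans[OF sum_abs])
  qed
  then show ?thesis using that by blast
qed

locale random_objective = riemannian_retraction \<A> g R + prob_space \<mu>
  for \<A> :: "('a::{t2_space, second_countable_topology}, 'e::euclidean_space) chart set"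
    and g :: "'a \<Rightarrow> 'e \<Rightarrow> 'e \<Rightarrow> real" and R :: "'a \<Rightarrow> 'e \<Rightarrow> 'a" and \<mu> :: "'w measure" +
  fixes f :: "'a \<Rightarrow> 'w \<Rightarrow> real"
  assumes f_random: "random_function \<mu> f"
    and f_diff: "differentiable_in_M \<A> \<mu> f"
    and f_bounded: "locally_bounded \<mu> f"
    and grad_bounded: "locally_bounded \<mu> (\<lambda>y \<omega>. gnorm g y (grad_M \<A> g f y \<omega>))"
    and f_Lipschitz: "locally_R_Lipschitz_gradient g R \<mu> f"
begin

lemma f_mdifferentiable: "\<omega> \<in> space \<mu> \<Longrightarrow> mdifferentiable_at \<A> (\<lambda>y. f y \<omega>) x"
  using f_diff by (simp add: differentiable_in_M_def)

lemma grad_bound: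
  assumes "compact K"
  obtains C where "C > 0" "\<And>x \<omega>. x \<in> K \<Longrightarrow> \<omega> \<in> space \<mu> \<Longrightarrow> gnorm g x (grad_M \<A> g f x \<omega>) \<le> C"
proof -
  obtain C where "C > 0" "\<forall>x\<in>K. \<forall>\<omega>\<in>space \<mu>. \<bar>gnorm g x (grad_M \<A> g f x \<omega>)\<bar> \<le> C"
    using grad_bounded assms unfolding locally_bounded_def by blast
  then show ?thesis using that by (meson abs_le_D1)
qed

lemma grad_bound_at:
  obtains C where "C > 0" "\<And>\<omega>. \<omega> \<in> space \<mu> \<Longrightarrow> gnorm g x (grad_M \<A> g f x \<omega>) \<le> C"
  using grad_bound[of "{x}"] by (metis compact_sing singletonI)

lemma f_bound:
  assumes "compact K"
  obtains C where "C > 0" "\<And>x \<omega>. x \<in> K \<Longrightarrow> \<omega> \<in> space \<mu> \<Longrightarrow> \<bar>f x \<omega>\<bar> \<le> C"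
proof -
  obtain C where "C > 0" "\<forall>x\<in>K. \<forall>\<omega>\<in>space \<mu>. \<bar>f x \<omega>\<bar> \<le> C"
    using f_bounded assms unfolding locally_bounded_def by blast
  then show ?thesis using that by meson
qed

text \<open>A real \<open>SUP\<close> is sure to dominate its members only over a set bounded above.
  Cauchy-Schwarz and the local boundedness of the gradient, applied to the compact set
  \<open>{x}\<close>, provide the bound.\<close>

lemma A_bound_upper:
  assumes "\<omega> \<in> space \<mu>" "a > 0"
  shows "- g x (riem_grad \<A> g \<rho> x) (grad_M \<A> g f x \<omega>) \<le> a * A_bound \<A> g \<mu> f \<rho> a x"
proof -
  let ?h = "\<lambda>\<omega>. max 0 (- g x (riem_grad \<A> g \<rho> x) (grad_M \<A> g f x \<omega>))"
  obtain C where C: "\<And>\<omega>. \<omega> \<in> space \<mu> \<Longrightarrow> gnorm g x (grad_M \<A> g f x \<omega>) \<le> C"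
    using grad_bound_at[of x] by metis
  have "?h \<omega> \<le> gnorm g x (riem_grad \<A> g \<rho> x) * C" if "\<omega> \<in> space \<mu>" for \<omega>
    using cauchy_schwarz[of x "riem_grad \<A> g \<rho> x" "grad_M \<A> g f x \<omega>"]
      mult_left_mono[OF C[OF that] gnorm_nonneg, of x "riem_grad \<A> g \<rho> x"]
      mult_nonneg_nonneg[OF gnorm_nonneg gnorm_nonneg, of x "riem_grad \<A> g \<rho> x" x "grad_M \<A> g f x \<omega>"]
    by auto
  then have "bdd_above (?h ` space \<mu>)" by (rule bdd_aboveI2)
  from cSUP_upper[OF assms(1) this] show ?thesis using assms(2) by (simp add: A_bound_def)
qed

lemma B_bound_upper:
  assumes "\<omega> \<in> space \<mu>" "b > 0" "\<bar>\<theta>\<bar> \<le> \<Theta>" and C2: "Ck_on 2 UNIV (\<rho> \<circ> R x)"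
  shows "hessian (\<rho> \<circ> R x) (\<theta> *\<^sub>R grad_M \<A> g f x \<omega>) (grad_M \<A> g f x \<omega>) (grad_M \<A> g f x \<omega>)
    \<le> (b * B_bound \<A> g R \<mu> f \<rho> b \<Theta> x)\<^sup>2"
    and "0 \<le> b * B_bound \<A> g R \<mu> f \<rho> b \<Theta> x"
proof -
  let ?G = "grad_M \<A> g f x"
  let ?H = "\<lambda>\<theta> \<omega>. hessian (\<rho> \<circ> R x) (\<theta> *\<^sub>R ?G \<omega>) (?G \<omega>) (?G \<omega>)"
  let ?h = "\<lambda>(\<theta>, \<omega>). sqrt (max 0 (?H \<theta> \<omega>))"
  obtain C where C: "C > 0" "\<And>\<omega>. \<omega> \<in> space \<mu> \<Longrightarrow> gnorm g x (?G \<omega>) \<le> C"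
    using grad_bound_at[of x] by metis
  obtain l where l: "l > 0" "\<And>u. l * (norm u)\<^sup>2 \<le> g x u u"
    using g.norm_bounds[of x] by metis
  have G: "norm (?G \<omega>) \<le> C / sqrt l" if "\<omega> \<in> space \<mu>" for \<omega>
  proof -
    have "sqrt (l * (norm (?G \<omega>))\<^sup>2) \<le> gnorm g x (?G \<omega>)"
      unfolding gnorm_def by (intro real_sqrt_le_mono l)
    then have "sqrt l * norm (?G \<omega>) \<le> C" using C(2)[OF that] by (simp add: real_sqrt_mult)
    then show ?thesis using l(1) by (simp add: field_simps)
  qed
  \<comment> \<open>One radius for the direction \<open>?G \<omega>\<close> and for the point
    \<open>\<theta> *\<^sub>R ?G \<omega>\<close>, hence the larger of the factors 1 and
    \<Theta>.\<close>
  define r where "r = max 1 \<Theta> * (C / sqrt l)"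
  have r1: "norm (?G \<omega>) \<le> r" if "\<omega> \<in> space \<mu>" for \<omega>
    using G[OF that] mult_right_mono[of 1 "max 1 \<Theta>" "C / sqrt l"] C(1) l(1) by (simp add: r_def)
  have r2: "norm (\<theta> *\<^sub>R ?G \<omega>) \<le> r" if "\<omega> \<in> space \<mu>" "\<bar>\<theta>\<bar> \<le> \<Theta>" for \<omega> \<theta>
    using mult_mono[of "\<bar>\<theta>\<bar>" "max 1 \<Theta>" "norm (?G \<omega>)" "C / sqrt l"] G[OF that(1)] that(2)
    by (simp add: r_def)
  obtain D where D: "\<And>q u. norm q \<le> r \<Longrightarrow> norm u \<le> r \<Longrightarrow> \<bar>hessian (\<rho> \<circ> R x) q u u\<bar> \<le> D"
    using hessian_bounded[OF C2] by metis
  have "?h z \<le> sqrt \<bar>D\<bar>" if zS: "z \<in> {\<theta>. \<bar>\<theta>\<bar> \<le> \<Theta>} \<times> space \<mu>" for z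
  proof -
    obtain \<theta> \<omega> where z: "z = (\<theta>, \<omega>)" "\<bar>\<theta>\<bar> \<le> \<Theta>" "\<omega> \<in> space \<mu>" using zS by auto
    have "?H \<theta> \<omega> \<le> \<bar>D\<bar>" using D[OF r2[OF z(3,2)] r1[OF z(3)]] by linarith
    then show ?thesis by (simp add: z(1) real_sqrt_le_mono)
  qed
  then have "bdd_above (?h ` ({\<theta>. \<bar>\<theta>\<bar> \<le> \<Theta>} \<times> space \<mu>))" by (rule bdd_aboveI2)
  from cSUP_upper[OF _ this, of "(\<theta>, \<omega>)"] assms
  have le: "sqrt (max 0 (?H \<theta> \<omega>)) \<le> b * B_bound \<A> g R \<mu> f \<rho> b \<Theta> x" by (simp add: B_bound_def)
  then have "(sqrt (max 0 (?H \<theta> \<omega>)))\<^sup>2 \<le> (b * B_bound \<A> g R \<mu> f \<rho> b \<Theta> x)\<^sup>2"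
    by (intro power_mono) auto
  then show "?H \<theta> \<omega> \<le> (b * B_bound \<A> g R \<mu> f \<rho> b \<Theta> x)\<^sup>2" by simp
  have "0 \<le> sqrt (max 0 (?H \<theta> \<omega>))" by simp
  then show "0 \<le> b * B_bound \<A> g R \<mu> f \<rho> b \<Theta> x" using le by (rule order_trans)
qed

text \<open>As \<open>c / \<phi> \<le> \<Theta>\<close>, every Hessian along the step is covered by
  the supremum in \<open>B_bound\<close>. The factor \<open>c / \<phi>\<close> of the first-order
  term and its square in the second-order term turn the bounds \<open>a * \<phi>\<close> and
  \<open>(b * \<phi>)\<^sup>2\<close> into \<open>c * a\<close> and
  \<open>b\<^sup>2 * c\<^sup>2\<close>.\<close>

lemma confinement_step:
  assumes \<omega>: "\<omega> \<in> space \<mu>" and pos: "a > 0" "b > 0" "\<Theta> > 0" "c > 0" "\<phi> > 0"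
    and \<rho>: "\<And>y. mdifferentiable_at \<A> \<rho> y" "Ck_manifold \<A> 2 \<rho>"
    and bound: "confinement_bound \<A> g \<mu> f \<rho> \<rho>0"
    and \<phi>: "A_bound \<A> g \<mu> f \<rho> a x \<le> \<phi>" "B_bound \<A> g R \<mu> f \<rho> b \<Theta> x \<le> \<phi>" "c / \<Theta> \<le> \<phi>"
  shows "\<rho> (R x (- (c / \<phi>) *\<^sub>R grad_M \<A> g f x \<omega>)) \<le> \<rho> x + (if \<rho> x \<ge> \<rho>0 then 0 else c * a) + b\<^sup>2 * c\<^sup>2 / 2"
proof -
  define \<tau> where "\<tau> = c / \<phi>"
  define G where "G = grad_M \<A> g f x \<omega>"
  define \<psi> where "\<psi> = \<rho> \<circ> R x"
  have \<tau>: "\<tau> > 0" "\<tau> \<le> \<Theta>" using pos \<phi>(3) by (simp_all add: \<tau>_def field_simps)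
  have C2': "Ck_on 2 UNIV \<psi>" unfolding \<psi>_def by (rule C2_compose_R[OF \<rho>(2)])
  have d: "\<psi> differentiable (at q)" "(\<lambda>q. frechet_derivative \<psi> (at q) u) differentiable (at q)" for q u
    using C2' by (simp_all add: numeral_2_eq_2)
  \<comment> \<open>The derivatives of \<open>\<psi> (- s *\<^sub>R G)\<close> with respect to
    \<open>s\<close>, in the form that \<open>Maclaurin\<close> expects. Each differentiation brings
    a factor -1, so a sign remains for \<open>m = 1\<close> and cancels for
    \<open>m = 2\<close>.\<close>
  define diff where "diff m s = (if m = 0 then \<psi> (- s *\<^sub>R G) else if m = 1 then - frechet_derivative \<psi> (at (- s *\<^sub>R G)) G
    else hessian \<psi> (- s *\<^sub>R G) G G)" for m :: nat and s :: real
  have chain: "((\<lambda>s. k (- s *\<^sub>R G)) has_real_derivative - frechet_derivative k (at (- s *\<^sub>R G)) G) (at s)"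
    if "k differentiable (at (- s *\<^sub>R G))" for k :: "'e \<Rightarrow> real" and s
  proof -
    have "((\<lambda>s. - s *\<^sub>R G) has_derivative (\<lambda>h. - h *\<^sub>R G)) (at s)"
      by (auto intro!: derivative_eq_intros)
    from diff_chain_at[OF this has_frechet_derivative[OF that]]
    have "((\<lambda>s. k (- s *\<^sub>R G)) has_derivative (\<lambda>h. frechet_derivative k (at (- s *\<^sub>R G)) (- h *\<^sub>R G))) (at s)"
      by (simp add: comp_def)
    moreover have "(\<lambda>h. frechet_derivative k (at (- s *\<^sub>R G)) (- h *\<^sub>R G))
        = (*) (- frechet_derivative k (at (- s *\<^sub>R G)) G)"
      unfolding linear_scale[OF linear_frechet_derivative[OF that]] by (simp add: fun_eq_iff)
    ultimately show ?thesis unfolding has_field_derivative_def by simp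
  qed
  have "\<exists>t. 0 < t \<and> t < \<tau> \<and> diff 0 \<tau> = (\<Sum>m<2. diff m 0 / fact m * \<tau> ^ m) + diff 2 t / fact 2 * \<tau> ^ 2"
  proof (rule Maclaurin[OF \<tau>(1), of 2])
    show "\<forall>m t. m < 2 \<and> 0 \<le> t \<and> t \<le> \<tau> \<longrightarrow> (diff m has_real_derivative diff (Suc m) t) (at t)"
    proof (intro allI impI)
      fix m :: nat and t :: real assume "m < 2 \<and> 0 \<le> t \<and> t \<le> \<tau>"
      then consider "m = 0" | "m = 1" by linarith
      then show "(diff m has_real_derivative diff (Suc m) t) (at t)"
      proof cases
        case 1
        have "diff 0 = (\<lambda>s. \<psi> (- s *\<^sub>R G))" "diff (Suc 0) t = - frechet_derivative \<psi> (at (- t *\<^sub>R G)) G"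
          by (simp_all add: diff_def fun_eq_iff)
        with chain[OF d(1), of t] 1 show ?thesis by (simp only:)
      next
        case 2
        have "diff 1 = (\<lambda>s. - frechet_derivative \<psi> (at (- s *\<^sub>R G)) G)"
          "diff (Suc 1) t = - (- hessian \<psi> (- t *\<^sub>R G) G G)"
          by (simp_all add: diff_def fun_eq_iff)
        with DERIV_minus[OF chain[OF d(2)[of G], of t]] 2 show ?thesis
          by (simp only: hessian_def)
      qed
    qed
  qed auto
  then obtain t where t: "0 < t" "t < \<tau>"
    and eq: "diff 0 \<tau> = (\<Sum>m<2. diff m 0 / fact m * \<tau> ^ m) + diff 2 t / fact 2 * \<tau> ^ 2"
    by blast
  have lin: "frechet_derivative \<psi> (at 0) G = g x (riem_grad \<A> g \<rho> x) G"
    unfolding \<psi>_def compose_R_deriv_0[OF \<rho>(1)] riem_grad[OF \<rho>(1)] ..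
  have "\<rho> (R x (- \<tau> *\<^sub>R G)) = \<rho> x - \<tau> * g x (riem_grad \<A> g \<rho> x) G + hessian \<psi> (- t *\<^sub>R G) G G / 2 * \<tau>\<^sup>2"
    using eq by (simp add: diff_def lin numeral_2_eq_2) (simp add: \<psi>_def R_zero)
  moreover have "hessian \<psi> (- t *\<^sub>R G) G G / 2 * \<tau>\<^sup>2 \<le> b\<^sup>2 * c\<^sup>2 / 2"
  proof -
    have "hessian \<psi> (- t *\<^sub>R G) G G \<le> (b * B_bound \<A> g R \<mu> f \<rho> b \<Theta> x)\<^sup>2"
      unfolding \<psi>_def G_def using t \<tau> C2' pos by (intro B_bound_upper \<omega>) (auto simp: \<psi>_def)
    also have "\<dots> \<le> (b * \<phi>)\<^sup>2"
      using \<phi>(2) pos B_bound_upper(2)[OF \<omega> pos(2), of 0 \<Theta> \<rho> x] C2'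
      by (intro power_mono mult_left_mono) (auto simp: \<psi>_def)
    finally have "hessian \<psi> (- t *\<^sub>R G) G G / 2 * \<tau>\<^sup>2 \<le> (b * \<phi>)\<^sup>2 / 2 * \<tau>\<^sup>2"
      by (intro mult_right_mono divide_right_mono) auto
    also have "\<dots> = b\<^sup>2 * c\<^sup>2 / 2" using pos by (simp add: \<tau>_def power_mult_distrib power_divide)
    finally show ?thesis .
  qed
  moreover have "- \<tau> * g x (riem_grad \<A> g \<rho> x) G \<le> (if \<rho> x \<ge> \<rho>0 then 0 else c * a)"
  proof (cases "\<rho> x \<ge> \<rho>0")
    case True
    then have "g x (riem_grad \<A> g \<rho> x) G \<ge> 0"
      using bound \<omega> by (simp add: confinement_bound_def G_def)
    then show ?thesis using True \<tau> by (simp add: mult_nonneg_nonneg)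
  next
    case False
    have "- g x (riem_grad \<A> g \<rho> x) G \<le> a * A_bound \<A> g \<mu> f \<rho> a x"
      unfolding G_def by (rule A_bound_upper[OF \<omega> pos(1)])
    also have "\<dots> \<le> a * \<phi>" using \<phi>(1) pos by (intro mult_left_mono) auto
    finally have "\<tau> * - g x (riem_grad \<A> g \<rho> x) G \<le> \<tau> * (a * \<phi>)"
      using \<tau> by (intro mult_left_mono) auto
    also have "\<dots> = c * a" using pos by (simp add: \<tau>_def)
    finally show ?thesis using False by simp
  qed
  ultimately show ?thesis unfolding \<tau>_def G_def by simp
qed

text \<open>The extra terms \<open>c t * a\<close> do not accumulate: such a term arises only at a
  point below \<rho>0, and there the estimate restarts from \<rho>0 instead of from the induction
  hypothesis. Above \<rho>0 only the quadratic terms add up.\<close>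

lemma iterates_confined:
  assumes pos: "a > 0" "b > 0" "\<Theta> > 0" "\<And>t. c t > 0" "\<And>t. \<phi> t > 0"
    and \<rho>: "\<And>y. mdifferentiable_at \<A> \<rho> y" "Ck_manifold \<A> 2 \<rho>"
    and bound: "confinement_bound \<A> g \<mu> f \<rho> \<rho>0"
    and \<omega>: "\<And>t. \<omega> t \<in> space \<mu>"
    and X0: "\<rho> (X 0) \<le> \<rho>0"
    and step: "\<And>t. X (Suc t) = R (X t) (- (c t / \<phi> t) *\<^sub>R grad_M \<A> g f (X t) (\<omega> t))"
    and \<phi>: "\<And>t. \<phi> t \<ge> Max {A_bound \<A> g \<mu> f \<rho> a (X t), B_bound \<A> g R \<mu> f \<rho> b \<Theta> (X t), c t / \<Theta>}"
    and c: "\<And>t. c t \<le> cm"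
  shows "\<rho> (X t) \<le> \<rho>0 + cm * a + b\<^sup>2 / 2 * (\<Sum>i<t. (c i)\<^sup>2)"
proof (induction t)
  case 0
  have "0 \<le> cm * a" using pos(1) pos(4)[of 0] c[of 0] by simp
  then show ?case using X0 by simp
next
  case (Suc t)
  have st: "\<rho> (X (Suc t)) \<le> \<rho> (X t) + (if \<rho> (X t) \<ge> \<rho>0 then 0 else c t * a) + b\<^sup>2 * (c t)\<^sup>2 / 2"
    unfolding step using \<phi>[of t] by (intro confinement_step[where \<Theta>=\<Theta>] \<omega> pos \<rho> bound) auto
  show ?case
  proof (cases "\<rho> (X t) \<ge> \<rho>0")
    case True
    then show ?thesis using st Suc by (simp add: algebra_simps)
  next
    case False
    have "0 \<le> b\<^sup>2 / 2 * (\<Sum>i<t. (c i)\<^sup>2)" by (intro mult_nonneg_nonneg sum_nonneg) auto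
    moreover have "c t * a \<le> cm * a" using c pos by (intro mult_right_mono) auto
    ultimately show ?thesis using st False by (simp add: algebra_simps)
  qed
qed

end

section \<open>Uniform first-order estimates in charts\<close>

text \<open>A limit along a sequence, so that measurability in a parameter passes from a function to
  its derivative.\<close>

lemma difference_quotient_limit:
  fixes k :: "'e::real_normed_vector \<Rightarrow> real"
  assumes "k differentiable (at p)"
  shows "(\<lambda>n. (k (p + inverse (real (Suc n)) *\<^sub>R u) - k p) / inverse (real (Suc n))) \<longlonglongrightarrow> frechet_derivative k (at p) u"
proof -
  have "((\<lambda>s. p + s *\<^sub>R u) has_derivative (\<lambda>h. h *\<^sub>R u)) (at 0)"
    by (auto intro!: derivative_eq_intros)
  moreover have "(k has_derivative frechet_derivative k (at p)) (at (p + 0 *\<^sub>R u))"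
    using has_frechet_derivative[OF assms] by simp
  ultimately have "((k \<circ> (\<lambda>s. p + s *\<^sub>R u)) has_derivative (frechet_derivative k (at p) \<circ> (\<lambda>h. h *\<^sub>R u))) (at 0)"
    by (rule diff_chain_at)
  moreover have "frechet_derivative k (at p) \<circ> (\<lambda>h. h *\<^sub>R u) = (*) (frechet_derivative k (at p) u)"
    using linear_scale[OF linear_frechet_derivative[OF assms]] by (simp add: fun_eq_iff)
  ultimately have "((\<lambda>s. k (p + s *\<^sub>R u)) has_real_derivative frechet_derivative k (at p) u) (at 0)"
    by (simp add: has_field_derivative_def comp_def)
  then have "((\<lambda>s. (k (p + s *\<^sub>R u) - k p) / s) \<longlongrightarrow> frechet_derivative k (at p) u) (at 0)"
    by (simp add: DERIV_def)
  moreover have "filterlim (\<lambda>n. inverse (real (Suc n))) (at 0) sequentially"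
    by (rule filterlim_atI[OF LIMSEQ_inverse_real_of_nat]) auto
  ultimately show ?thesis by (rule filterlim_compose)
qed

text \<open>In bundle coordinates \<open>R\<close> is jointly Lipschitz near \<open>(l, 0)\<close>.
  Comparing a vector with 0 over the same point \<open>y\<close> gives the estimate, because
  \<open>R y 0 = y\<close>; the constants are the same for all \<open>y\<close> near
  \<open>l\<close>.\<close>

lemma (in riemannian_retraction) local_step:
  fixes l :: 'a
  defines "\<kappa> \<equiv> chart_at \<A> l"
  obtains r L where "r > 0" "L > 0" "ball (chart_map \<kappa> l) r \<subseteq> chart_img \<kappa>"
    "\<And>y v. y \<in> chart_dom \<kappa> \<Longrightarrow> chart_map \<kappa> y \<in> ball (chart_map \<kappa> l) r \<Longrightarrow> gnorm g y v < r \<Longrightarrow>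
      R y v \<in> chart_dom \<kappa> \<and> norm (chart_map \<kappa> (R y v) - chart_map \<kappa> y) \<le> L * gnorm g y v"
proof -
  have \<kappa>: "\<kappa> \<in> \<A>" "l \<in> chart_dom \<kappa>" using chart_at by (simp_all add: \<kappa>_def)
  have l_img: "chart_map \<kappa> l \<in> chart_img \<kappa>" using \<kappa> by simp
  interpret c: continuous_inner_products "chart_img \<kappa>" "chart_metric \<kappa>"
    by (rule continuous_inner_products_chart_metric[OF \<kappa>(1)])
  obtain d1 \<eta> where d1: "d1 > 0" "\<eta> > 0" "ball (chart_map \<kappa> l) d1 \<subseteq> chart_img \<kappa>"
    "\<And>p u. p \<in> ball (chart_map \<kappa> l) d1 \<Longrightarrow> \<eta> * norm u \<le> sqrt (chart_metric \<kappa> p u u)"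
    using c.local_bounds[OF l_img] by metis
  have op: "open (tb_dom \<A> R \<kappa> \<kappa>)" and Ck: "Ck_on 2 (tb_dom \<A> R \<kappa> \<kappa>) (tb_rep \<A> R \<kappa> \<kappa>)"
    using C2 \<kappa>(1) by (auto simp: Ck_tangent_bundle_def)
  have Ck1: "Ck_on 1 (tb_dom \<A> R \<kappa> \<kappa>) (tb_rep \<A> R \<kappa> \<kappa>)" by (rule Ck_on_le[OF op Ck]) simp
  have of0: "of_chart \<A> \<kappa> y 0 = 0" if "y \<in> chart_dom \<kappa>" for y
    by (rule linear_0[OF linear_of_chart[OF \<kappa>(1) that]])
  have "(chart_map \<kappa> l, 0) \<in> tb_dom \<A> R \<kappa> \<kappa>"
    using \<kappa> by (simp add: tb_dom_def chart_inv_map of0 R_zero)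
  from Ck_on_1_locally_Lipschitz[OF op Ck1 this]
  obtain d2 M where d2: "d2 > 0" "M > 0" "ball (chart_map \<kappa> l, 0) d2 \<subseteq> tb_dom \<A> R \<kappa> \<kappa>"
    "\<And>q q'. q \<in> ball (chart_map \<kappa> l, 0) d2 \<Longrightarrow> q' \<in> ball (chart_map \<kappa> l, 0) d2 \<Longrightarrow>
      norm (tb_rep \<A> R \<kappa> \<kappa> q - tb_rep \<A> R \<kappa> \<kappa> q') \<le> M * norm (q - q')"
    by metis
  \<comment> \<open>A pair of base point and vector lies in the ball of radius \<open>d2\<close> if
    both parts are within \<open>d2 / 2\<close>. For the vector this follows from
    \<open>gnorm g y v < \<eta> * (d2 / 2)\<close>, since \<eta> compares the Euclidean norm with
    \<open>gnorm\<close>.\<close>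
  define r where "r = min d1 (min (d2 / 2) (\<eta> * (d2 / 2)))"
  have "r > 0" using d1 d2 by (simp add: r_def)
  moreover have "ball (chart_map \<kappa> l) r \<subseteq> chart_img \<kappa>" using d1(3) by (auto simp: r_def)
  moreover have "R y v \<in> chart_dom \<kappa> \<and> norm (chart_map \<kappa> (R y v) - chart_map \<kappa> y) \<le> (M / \<eta>) * gnorm g y v"
    if y: "y \<in> chart_dom \<kappa>" "chart_map \<kappa> y \<in> ball (chart_map \<kappa> l) r" and v: "gnorm g y v < r" for y v
  proof -
    define w where "w = to_chart \<A> \<kappa> y v"
    have w: "of_chart \<A> \<kappa> y w = v" unfolding w_def by (rule of_to_chart[OF \<kappa>(1) y(1)])
    have "\<eta> * norm w \<le> sqrt (chart_metric \<kappa> (chart_map \<kappa> y) w w)"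
      using y(2) by (intro d1(4)) (auto simp: r_def)
    then have nw: "\<eta> * norm w \<le> gnorm g y v"
      by (simp add: chart_metric_apply[OF \<kappa>(1) y(1)] w gnorm_def)
    have "\<eta> * norm w < \<eta> * (d2 / 2)" using nw v by (simp add: r_def)
    then have w2: "norm w < d2 / 2" using d1(2) by simp
    have y2: "dist (chart_map \<kappa> l) (chart_map \<kappa> y) < d2 / 2" using y(2) by (simp add: r_def)
    have in1: "(chart_map \<kappa> y, w') \<in> ball (chart_map \<kappa> l, 0) d2" if "norm w' < d2 / 2" for w' :: 'e
    proof -
      have "dist (chart_map \<kappa> l, 0) (chart_map \<kappa> y, w') \<le> dist (chart_map \<kappa> l) (chart_map \<kappa> y) + dist 0 w'"
        unfolding dist_prod_def fst_conv snd_conv by (rule sqrt_sum_squares_le_sum) auto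
      then show ?thesis using y2 that by simp
    qed
    have "R y v \<in> chart_dom \<kappa>"
    proof -
      have "(chart_map \<kappa> y, w) \<in> tb_dom \<A> R \<kappa> \<kappa>" using d2(3) in1[OF w2] by blast
      then show ?thesis by (simp add: tb_dom_def chart_inv_map[OF \<kappa>(1) y(1)] w)
    qed
    moreover have "norm (chart_map \<kappa> (R y v) - chart_map \<kappa> y) \<le> M * norm ((chart_map \<kappa> y, w) - (chart_map \<kappa> y, 0))"
      using d2(4)[OF in1[OF w2] in1, of 0] d2(1)
      by (simp add: tb_rep_def chart_inv_map[OF \<kappa>(1) y(1)] w of0[OF y(1)] R_zero)
    moreover have "M * norm ((chart_map \<kappa> y, w) - (chart_map \<kappa> y, 0)) \<le> (M / \<eta>) * gnorm g y v"
      using nw d1(2) d2(2) by (simp add: norm_Pair field_simps)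
    ultimately show ?thesis by linarith
  qed
  ultimately show ?thesis using that[of r "M / \<eta>"] d1 d2 by simp
qed

context random_objective
begin

lemma f_R_differentiable: "\<omega> \<in> space \<mu> \<Longrightarrow> ((\<lambda>y. f y \<omega>) \<circ> R x) differentiable (at v)"
  by (rule compose_R_differentiable) (rule f_mdifferentiable)

text \<open>Cauchy-Schwarz turns the hypothesis on gradients into one on derivatives, to which the
  chain rule applies directly.\<close>

lemma R_deriv_Lipschitz:
  assumes "compact K" "r > 0"
  obtains C where "C > 0" "\<And>x v u \<omega>. x \<in> K \<Longrightarrow> \<omega> \<in> space \<mu> \<Longrightarrow> gnorm g x v \<le> r \<Longrightarrow>
    \<bar>frechet_derivative ((\<lambda>y. f y \<omega>) \<circ> R x) (at v) u - frechet_derivative ((\<lambda>y. f y \<omega>) \<circ> R x) (at 0) u\<bar>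
      \<le> C * gnorm g x v * gnorm g x u"
proof -
  have eq: "(\<lambda>u. f (R x u) \<omega>) = (\<lambda>y. f y \<omega>) \<circ> R x" for x \<omega> by auto
  obtain C where C: "C > 0" "\<forall>x\<in>K. \<forall>v. gnorm g x v \<le> r \<longrightarrow> (\<forall>\<omega>\<in>space \<mu>.
      gnorm g x (gradient (g x) ((\<lambda>y. f y \<omega>) \<circ> R x) v - gradient (g x) ((\<lambda>y. f y \<omega>) \<circ> R x) 0) \<le> C * gnorm g x v)"
    using f_Lipschitz assms unfolding locally_R_Lipschitz_gradient_def eq by meson
  have "\<bar>frechet_derivative ((\<lambda>y. f y \<omega>) \<circ> R x) (at v) u - frechet_derivative ((\<lambda>y. f y \<omega>) \<circ> R x) (at 0) u\<bar>
      \<le> C * gnorm g x v * gnorm g x u" if "x \<in> K" "\<omega> \<in> space \<mu>" "gnorm g x v \<le> r" for x v u \<omega>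
  proof -
    let ?k = "(\<lambda>y. f y \<omega>) \<circ> R x"
    have "frechet_derivative ?k (at v) u - frechet_derivative ?k (at 0) u
        = g x (gradient (g x) ?k v - gradient (g x) ?k 0) u"
      using g.gradient[OF f_R_differentiable[OF that(2)]] by (simp add: g.simps)
    also have "\<bar>\<dots>\<bar> \<le> gnorm g x (gradient (g x) ?k v - gradient (g x) ?k 0) * gnorm g x u"
      by (rule cauchy_schwarz)
    also have "\<dots> \<le> (C * gnorm g x v) * gnorm g x u"
      using C(2) that by (intro mult_right_mono gnorm_nonneg) blast
    finally show ?thesis .
  qed
  then show ?thesis using that C(1) by blast
qed

lemma grad_M_deriv:
  assumes "\<omega> \<in> space \<mu>"
  shows "frechet_derivative ((\<lambda>y. f y \<omega>) \<circ> R x) (at 0) v = g x (grad_M \<A> g f x \<omega>) v"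
  unfolding compose_R_deriv_0[OF f_mdifferentiable[OF assms]] grad_M_def
    riem_grad[OF f_mdifferentiable[OF assms]] ..

lemma grad_M_chart:
  assumes "c \<in> \<A>" "x \<in> chart_dom c" "\<omega> \<in> space \<mu>"
  shows "frechet_derivative ((\<lambda>y. f y \<omega>) \<circ> chart_inv c) (at (chart_map c x)) u
    = g x (grad_M \<A> g f x \<omega>) (of_chart \<A> c x u)"
  unfolding grad_M_def riem_grad_chart[OF assms(1,2) f_mdifferentiable[OF assms(3)]] ..

text \<open>By the mean value theorem the remainder is a difference of two derivatives of the
  pullback, applied to \<open>v\<close>. One factor \<open>gnorm g x v\<close> comes from the
  Lipschitz bound and the other from the direction.\<close>

lemma first_order_expansion:
  assumes "compact K" "r > 0"
  obtains C where "C > 0" "\<And>x v \<omega>. x \<in> K \<Longrightarrow> \<omega> \<in> space \<mu> \<Longrightarrow> gnorm g x v \<le> r \<Longrightarrow>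
    \<bar>f (R x v) \<omega> - f x \<omega> - g x (grad_M \<A> g f x \<omega>) v\<bar> \<le> C * (gnorm g x v)\<^sup>2"
proof -
  obtain C where C: "C > 0" "\<And>x v u \<omega>. x \<in> K \<Longrightarrow> \<omega> \<in> space \<mu> \<Longrightarrow> gnorm g x v \<le> r \<Longrightarrow>
    \<bar>frechet_derivative ((\<lambda>y. f y \<omega>) \<circ> R x) (at v) u - frechet_derivative ((\<lambda>y. f y \<omega>) \<circ> R x) (at 0) u\<bar>
      \<le> C * gnorm g x v * gnorm g x u"
    using R_deriv_Lipschitz[OF assms] by metis
  have "\<bar>f (R x v) \<omega> - f x \<omega> - g x (grad_M \<A> g f x \<omega>) v\<bar> \<le> C * (gnorm g x v)\<^sup>2"
    if x: "x \<in> K" "\<omega> \<in> space \<mu>" "gnorm g x v \<le> r" for x v \<omega>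
  proof -
    let ?k = "(\<lambda>y. f y \<omega>) \<circ> R x"
    have "((\<lambda>s. ?k (s *\<^sub>R v)) has_derivative (\<lambda>h. frechet_derivative ?k (at (s *\<^sub>R v)) (h *\<^sub>R v))) (at s within {0..1})" for s
    proof -
      have "((\<lambda>s. s *\<^sub>R v) has_derivative (\<lambda>h. h *\<^sub>R v)) (at s)"
        by (auto intro!: derivative_eq_intros)
      from diff_chain_at[OF this has_frechet_derivative[OF f_R_differentiable[OF x(2)]]]
      show ?thesis by (auto simp: comp_def intro: has_derivative_at_withinI)
    qed
    from mvt_simple[OF zero_less_one this, simplified]
    obtain s where s: "s \<in> {0<..<1}"
      and eq: "?k (1 *\<^sub>R v) - ?k (0 *\<^sub>R v) = frechet_derivative ?k (at (s *\<^sub>R v)) ((1 - 0) *\<^sub>R v)"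
      by auto
    have sv: "gnorm g x (s *\<^sub>R v) \<le> gnorm g x v"
      using s gnorm_nonneg[of x v] by (simp add: gnorm_scaleR mult_left_le_one_le)
    have "\<bar>f (R x v) \<omega> - f x \<omega> - g x (grad_M \<A> g f x \<omega>) v\<bar>
        = \<bar>frechet_derivative ?k (at (s *\<^sub>R v)) v - frechet_derivative ?k (at 0) v\<bar>"
      using eq grad_M_deriv[OF x(2), of x v] by (simp add: R_zero)
    also have "\<dots> \<le> C * gnorm g x (s *\<^sub>R v) * gnorm g x v"
      using C(2)[OF x(1,2), of "s *\<^sub>R v" v] sv x(3) by simp
    also have "\<dots> \<le> C * gnorm g x v * gnorm g x v"
      using sv C(1) gnorm_nonneg by (intro mult_right_mono mult_left_mono) auto
    finally show ?thesis by (simp add: power2_eq_square mult.assoc)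
  qed
  then show ?thesis using that C(1) by blast
qed

text \<open>Near \<open>l\<close> every point is \<open>R l v\<close> with small \<open>v\<close> (open mapping), and the differential of
  \<open>R l\<close> at \<open>v\<close> is close to the identity. So the Lipschitz condition on the pullbacks along
  \<open>R l\<close> makes the chart derivatives of \<open>f\<close> equicontinuous at \<open>l\<close>, uniformly in \<open>\<omega>\<close>.\<close>

lemma equicontinuous_derivative:
  fixes l :: 'a
  defines "\<kappa> \<equiv> chart_at \<A> l"
  assumes "e > 0"
  obtains d where "d > 0" "ball (chart_map \<kappa> l) d \<subseteq> chart_img \<kappa>"
    "\<And>p \<omega> u. p \<in> ball (chart_map \<kappa> l) d \<Longrightarrow> \<omega> \<in> space \<mu> \<Longrightarrow>
      \<bar>frechet_derivative ((\<lambda>y. f y \<omega>) \<circ> chart_inv \<kappa>) (at p) u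
        - frechet_derivative ((\<lambda>y. f y \<omega>) \<circ> chart_inv \<kappa>) (at (chart_map \<kappa> l)) u\<bar> \<le> e * norm u"
proof -
  have \<kappa>: "\<kappa> \<in> \<A>" "l \<in> chart_dom \<kappa>" using chart_at by (simp_all add: \<kappa>_def)
  let ?fo = "\<lambda>\<omega> y. f y \<omega>"
  let ?D = "\<lambda>\<omega> p. frechet_derivative (?fo \<omega> \<circ> chart_inv \<kappa>) (at p)"
  let ?\<psi> = "chart_map \<kappa> \<circ> R l"
  define p0 where "p0 = chart_map \<kappa> l"
  note S = R_chart[OF \<kappa>(1), of l]
  have C1: "Ck_on 1 (R_dom l \<kappa>) ?\<psi>" by (rule Ck_on_le[OF S]) simp
  have S0: "0 \<in> R_dom l \<kappa>" using \<kappa> by (simp add: R_dom_def R_zero)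
  have D0: "frechet_derivative ?\<psi> (at 0) = id"
    unfolding \<kappa>_def by (rule frechet_derivative_eqI[OF R_deriv])
  obtain m where m: "m > 0" "\<And>u. gnorm g l u \<le> m * norm u"
  proof -
    obtain C where C: "C > 0" "\<And>u. g l u u \<le> C * (norm u)\<^sup>2" using g.norm_bounds[of l] by metis
    have "gnorm g l u \<le> sqrt C * norm u" for u
      using real_sqrt_le_mono[OF C(2)[of u]] by (simp add: gnorm_def real_sqrt_mult)
    then show ?thesis using that[of "sqrt C"] C(1) by simp
  qed
  obtain N where N: "N > 0" "\<And>\<omega>. \<omega> \<in> space \<mu> \<Longrightarrow> gnorm g l (grad_M \<A> g f l \<omega>) \<le> N"
    using grad_bound_at[of l] by metis
  obtain C where C: "C > 0" "\<And>v u \<omega>. \<omega> \<in> space \<mu> \<Longrightarrow> gnorm g l v \<le> 1 \<Longrightarrow>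
    \<bar>frechet_derivative (?fo \<omega> \<circ> R l) (at v) u - frechet_derivative (?fo \<omega> \<circ> R l) (at 0) u\<bar>
      \<le> C * gnorm g l v * gnorm g l u"
    using R_deriv_Lipschitz[of "{l}" 1] by (metis compact_sing singletonI zero_less_one)
  \<comment> \<open>\<open>N * m\<close> bounds the derivative at \<open>p0\<close>, and
    \<open>2 * (N * m + 1)\<close> will be shown to bound \<open>onorm (?D \<omega> p)\<close>. The
    total error is then \<open>e' + 2 * (N * m + 1) * e'\<close> times \<open>norm u\<close>, which
    is \<open>e' * q * norm u\<close>.\<close>
  define q where "q = 2 * (N * m + 1) + 1"
  have q: "q > 0" using N(1) m(1) by (simp add: q_def add_pos_pos)
  define e' where "e' = min (1 / 2) (e / q)"
  have "e' * q \<le> e / q * q" using q by (intro mult_right_mono) (auto simp: e'_def)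
  then have e': "e' * (2 * (N * m + 1) + 1) \<le> e" using q by (simp add: q_def)
  have e'2: "e' > 0" "e' \<le> 1 / 2" using assms(2) q unfolding e'_def by (simp, intro min.cobounded1)
  note e' = e'2 e'
  obtain d1 where d1: "d1 > 0" "ball 0 d1 \<subseteq> R_dom l \<kappa>"
    "\<And>v u. v \<in> ball 0 d1 \<Longrightarrow> norm (frechet_derivative ?\<psi> (at v) u - u) \<le> e' * norm u"
    using Ck_on_1_continuous_derivative[OF S(1) C1 S0 e'(1)] D0 by (metis id_apply)
  \<comment> \<open>The three radii ensure, in turn, that the differential of \<open>?\<psi>\<close>
    at \<open>v\<close> is close to the identity, that \<open>gnorm g l v \<le> 1\<close> as
    required for \<open>C\<close>, and that the Lipschitz difference is at most
    \<open>e' * norm u\<close>.\<close>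
  define \<delta> where "\<delta> = min d1 (min (1 / m) (e' / (C * m * m)))"
  have \<delta>: "\<delta> > 0" using d1 m C e' by (simp add: \<delta>_def)
  have "?\<psi> 0 \<in> interior (?\<psi> ` ball 0 \<delta>)"
  proof (rule sussmann_open_mapping[OF S(1) _ S0, where g' = id])
    show "continuous_on (R_dom l \<kappa>) ?\<psi>" using Ck_on_le[OF S, of 0] by simp
    show "(?\<psi> has_derivative id) (at 0)" unfolding \<kappa>_def by (rule R_deriv)
    show "bounded_linear (id :: 'e \<Rightarrow> 'e)" by (simp add: id_def bounded_linear_ident)
    show "ball 0 \<delta> \<subseteq> R_dom l \<kappa>" using d1 by (auto simp: \<delta>_def)
  qed (use \<delta> in auto)
  then obtain d where d: "d > 0" "ball p0 d \<subseteq> ?\<psi> ` ball 0 \<delta>"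
    by (auto simp: mem_interior p0_def R_zero)
  have main: "p \<in> chart_img \<kappa> \<and> (\<forall>\<omega>\<in>space \<mu>. \<forall>u. \<bar>?D \<omega> p u - ?D \<omega> p0 u\<bar> \<le> e * norm u)"
    if pb: "p \<in> ball p0 d" for p
  proof -
    obtain v where v: "norm v < \<delta>" "p = chart_map \<kappa> (R l v)" using d(2) pb by auto
    have vS: "v \<in> R_dom l \<kappa>" "v \<in> ball 0 d1" using v d1 by (auto simp: \<delta>_def)
    then have vdom: "R l v \<in> chart_dom \<kappa>" by (simp add: R_dom_def)
    have "\<bar>?D \<omega> p u - ?D \<omega> p0 u\<bar> \<le> e * norm u" if \<omega>: "\<omega> \<in> space \<mu>" for \<omega> u
    proof -
      let ?k = "?fo \<omega> \<circ> R l"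
      have diffp: "(?fo \<omega> \<circ> chart_inv \<kappa>) differentiable (at p)"
        unfolding v(2) by (rule mdifferentiable_chart[OF \<kappa>(1) vdom f_mdifferentiable[OF \<omega>]])
      interpret Dp: bounded_linear "?D \<omega> p"
        using linear_conv_bounded_linear linear_frechet_derivative[OF diffp] by blast
      have L0: "?D \<omega> p0 u = frechet_derivative ?k (at 0) u" for u
        unfolding p0_def grad_M_chart[OF \<kappa> \<omega>] grad_M_deriv[OF \<omega>] by (simp add: \<kappa>_def of_chart_at)
      have Lv: "?D \<omega> p (frechet_derivative ?\<psi> (at v) u) = frechet_derivative ?k (at v) u" for u
        using compose_R(2)[OF \<kappa>(1) vS(1), of "?fo \<omega>" u] diffp by (simp add: v(2))
      have close: "\<bar>frechet_derivative ?k (at v) u - ?D \<omega> p0 u\<bar> \<le> e' * norm u" for u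
      proof -
        have gv: "gnorm g l v \<le> m * norm v" by (rule m)
        have "m * norm v \<le> m * (1 / m)" using v(1) m(1) by (intro mult_left_mono) (auto simp: \<delta>_def)
        then have "gnorm g l v \<le> 1" using gv m(1) by simp
        then have "\<bar>frechet_derivative ?k (at v) u - ?D \<omega> p0 u\<bar> \<le> C * gnorm g l v * gnorm g l u"
          unfolding L0 by (rule C(2)[OF \<omega>])
        also have "\<dots> \<le> C * (m * norm v) * (m * norm u)"
          using gv m(2)[of u] C(1) m(1) gnorm_nonneg by (intro mult_mono mult_left_mono) auto
        also have "\<dots> = (C * m * m) * norm v * norm u" by simp
        also have "\<dots> \<le> (C * m * m) * (e' / (C * m * m)) * norm u"
          using v(1) C(1) m(1) by (intro mult_right_mono mult_left_mono) (auto simp: \<delta>_def)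
        also have "\<dots> = e' * norm u" using C(1) m(1) by simp
        finally show ?thesis .
      qed
      have bd0: "\<bar>?D \<omega> p0 u\<bar> \<le> N * m * norm u" for u
      proof -
        have "\<bar>?D \<omega> p0 u\<bar> \<le> gnorm g l (grad_M \<A> g f l \<omega>) * gnorm g l u"
          unfolding L0 grad_M_deriv[OF \<omega>] by (rule cauchy_schwarz)
        also have "\<dots> \<le> N * (m * norm u)"
          using N m(2)[of u] \<omega> gnorm_nonneg by (intro mult_mono) auto
        finally show ?thesis by simp
      qed
      \<comment> \<open>The first term on the right is known from the pullback; the second is small
        because the differential of \<open>?\<psi>\<close> at \<open>v\<close> is close to the
        identity.\<close>
      have split: "?D \<omega> p u = frechet_derivative ?k (at v) u - ?D \<omega> p (frechet_derivative ?\<psi> (at v) u - u)" for u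
        using Lv[of u] by (simp add: Dp.diff)
      have on: "\<bar>?D \<omega> p (frechet_derivative ?\<psi> (at v) u - u)\<bar> \<le> onorm (?D \<omega> p) * (e' * norm u)" for u
        using order_trans[OF onorm[OF Dp.bounded_linear_axioms] mult_left_mono[OF d1(3)[OF vS(2), of u] onorm_pos_le[OF Dp.bounded_linear_axioms]]]
        by simp
      \<comment> \<open>The unknown operator norm occurs on both sides;
        \<open>e' \<le> 1 / 2\<close> allows it to be absorbed on the left.\<close>
      have "onorm (?D \<omega> p) \<le> N * m + 1 + onorm (?D \<omega> p) * (1 / 2)"
      proof (rule onorm_bound)
        show "0 \<le> N * m + 1 + onorm (?D \<omega> p) * (1 / 2)"
          using N m onorm_pos_le[OF Dp.bounded_linear_axioms] by simp
        fix u :: 'e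
        have "onorm (?D \<omega> p) * (e' * norm u) \<le> onorm (?D \<omega> p) * (1 / 2 * norm u)"
          using e'(2) onorm_pos_le[OF Dp.bounded_linear_axioms] by (intro mult_left_mono mult_right_mono) auto
        moreover have "e' * norm u \<le> 1 * norm u" using e'(2) by (intro mult_right_mono) auto
        ultimately show "norm (?D \<omega> p u) \<le> (N * m + 1 + onorm (?D \<omega> p) * (1 / 2)) * norm u"
          using split[of u] on[of u] close[of u] bd0[of u] by (simp add: algebra_simps)
      qed
      then have on2: "onorm (?D \<omega> p) \<le> 2 * (N * m + 1)" by simp
      have "\<bar>?D \<omega> p u - ?D \<omega> p0 u\<bar> \<le> e' * norm u + onorm (?D \<omega> p) * (e' * norm u)"
        using split[of u] on[of u] close[of u] by linarith
      also have "\<dots> \<le> e' * norm u + 2 * (N * m + 1) * (e' * norm u)"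
        using on2 e'(1) by (intro add_left_mono mult_right_mono) auto
      also have "\<dots> = (e' * (2 * (N * m + 1) + 1)) * norm u" by (simp add: algebra_simps)
      also have "\<dots> \<le> e * norm u" using e'(3) by (intro mult_right_mono) auto
      finally show ?thesis .
    qed
    then show ?thesis using vdom v(2) by blast
  qed
  have "ball p0 d \<subseteq> chart_img \<kappa>" using main by blast
  then show ?thesis using that[of d] d(1) main unfolding p0_def by blast
qed

end

section \<open>The expected objective\<close>

context random_objective
begin

lemma f_integrable: "integrable \<mu> (f x)"
proof -
  obtain C where "\<And>y \<omega>. y \<in> {x} \<Longrightarrow> \<omega> \<in> space \<mu> \<Longrightarrow> \<bar>f y \<omega>\<bar> \<le> C"
    using f_bound[OF compact_sing, of x] by metis
  then show ?thesis
    using f_random by (intro integrable_const_bound[where B=C]) (auto simp: random_function_def)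
qed

text \<open>For small \<open>n\<close> the shifted point may lie outside the chart image. There
  \<open>chart_inv c\<close> still returns some point, at which \<open>f\<close> is measurable in
  \<omega>, so every quotient is measurable; the limit depends only on large
  \<open>n\<close>.\<close>

lemma measurable_chart_derivative_at:
  assumes "c \<in> \<A>" "x \<in> chart_dom c"
  shows "(\<lambda>\<omega>. frechet_derivative ((\<lambda>y. f y \<omega>) \<circ> chart_inv c) (at (chart_map c x)) u) \<in> borel_measurable \<mu>"
proof (rule borel_measurable_LIMSEQ_real)
  fix \<omega> assume "\<omega> \<in> space \<mu>"
  from difference_quotient_limit[OF mdifferentiable_chart(1)[OF assms f_mdifferentiable[OF this]], of u]
  show "(\<lambda>n. (f (chart_inv c (chart_map c x + inverse (real (Suc n)) *\<^sub>R u)) \<omega> - f (chart_inv c (chart_map c x)) \<omega>)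
      / inverse (real (Suc n)))
    \<longlonglongrightarrow> frechet_derivative ((\<lambda>y. f y \<omega>) \<circ> chart_inv c) (at (chart_map c x)) u"
    by simp
next
  show "(\<lambda>\<omega>. (f (chart_inv c (chart_map c x + inverse (real (Suc n)) *\<^sub>R u)) \<omega> - f (chart_inv c (chart_map c x)) \<omega>)
      / inverse (real (Suc n))) \<in> borel_measurable \<mu>" for n
    using f_random unfolding random_function_def
    by (intro borel_measurable_divide borel_measurable_diff borel_measurable_const) auto
qed

lemma measurable_grad_inner:
  "(\<lambda>\<omega>. g x (grad_M \<A> g f x \<omega>) v) \<in> borel_measurable \<mu>"
  using measurable_chart_derivative_at[OF chart_at, of x v]
  by (subst measurable_cong[where g="\<lambda>\<omega>. frechet_derivative ((\<lambda>y. f y \<omega>) \<circ> chart_inv (chart_at \<A> x))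
      (at (chart_map (chart_at \<A> x) x)) v"])
    (simp_all add: grad_M_chart[OF chart_at] of_chart_at)

lemma integrable_grad_inner: "integrable \<mu> (\<lambda>\<omega>. g x (grad_M \<A> g f x \<omega>) v)"
proof -
  obtain N where N: "\<And>\<omega>. \<omega> \<in> space \<mu> \<Longrightarrow> gnorm g x (grad_M \<A> g f x \<omega>) \<le> N"
    using grad_bound_at[of x] by metis
  have "\<bar>g x (grad_M \<A> g f x \<omega>) v\<bar> \<le> N * gnorm g x v" if "\<omega> \<in> space \<mu>" for \<omega>
    using cauchy_schwarz[of x "grad_M \<A> g f x \<omega>" v]
      mult_right_mono[OF N[OF that] gnorm_nonneg[of x v]] by linarith
  then show ?thesis
    by (intro integrable_const_bound[where B="N * gnorm g x v"] measurable_grad_inner) auto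
qed

definition F :: "'a \<Rightarrow> real" where "F y = (\<integral>\<omega>. f y \<omega> \<partial>\<mu>)"

lemma abs_integral_le:
  assumes "integrable \<mu> h" "\<And>\<omega>. \<omega> \<in> space \<mu> \<Longrightarrow> \<bar>h \<omega>\<bar> \<le> B"
  shows "\<bar>\<integral>\<omega>. h \<omega> \<partial>\<mu>\<bar> \<le> (B::real)"
proof -
  have "\<bar>\<integral>\<omega>. h \<omega> \<partial>\<mu>\<bar> \<le> (\<integral>\<omega>. \<bar>h \<omega>\<bar> \<partial>\<mu>)" by (rule integral_abs_bound)
  also have "\<dots> \<le> (\<integral>\<omega>. B \<partial>\<mu>)" using assms by (intro integral_mono) auto
  also have "\<dots> = B" by (simp add: prob_space)
  finally show ?thesis .
qed

text \<open>Differentiation under the integral. Equicontinuity provides, for all \<omega> at once, a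
  radius within which the linearisation error is at most \<open>e\<close> times the distance, and
  this bound survives averaging over \<omega>.\<close>

lemma F_has_derivative:
  fixes l :: 'a
  defines "\<kappa> \<equiv> chart_at \<A> l"
  shows "((F \<circ> chart_inv \<kappa>) has_derivative (\<lambda>u. \<integral>\<omega>. g l (grad_M \<A> g f l \<omega>) u \<partial>\<mu>)) (at (chart_map \<kappa> l))"
proof -
  have \<kappa>: "\<kappa> \<in> \<A>" "l \<in> chart_dom \<kappa>" using chart_at by (simp_all add: \<kappa>_def)
  let ?p = "chart_map \<kappa> l"
  let ?D = "\<lambda>u. \<integral>\<omega>. g l (grad_M \<A> g f l \<omega>) u \<partial>\<mu>"
  have D: "linear ?D"
    by (intro linearI) (simp_all add: g.simps integrable_grad_inner)
  show ?thesis
    unfolding has_derivative_at_alt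
  proof (intro conjI allI impI)
    show "bounded_linear ?D" using D by (simp add: linear_conv_bounded_linear)
    fix e :: real assume e: "e > 0"
    obtain d where d: "d > 0" "ball ?p d \<subseteq> chart_img \<kappa>"
      "\<And>p \<omega> u. p \<in> ball ?p d \<Longrightarrow> \<omega> \<in> space \<mu> \<Longrightarrow>
        \<bar>frechet_derivative ((\<lambda>y. f y \<omega>) \<circ> chart_inv \<kappa>) (at p) u
        - frechet_derivative ((\<lambda>y. f y \<omega>) \<circ> chart_inv \<kappa>) (at ?p) u\<bar> \<le> e * norm u"
      using equicontinuous_derivative[OF e, of l] unfolding \<kappa>_def by metis
    have "norm ((F \<circ> chart_inv \<kappa>) q - (F \<circ> chart_inv \<kappa>) ?p - ?D (q - ?p)) \<le> e * norm (q - ?p)"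
      if q: "norm (q - ?p) < d" for q
    proof -
      have qb: "q \<in> ball ?p d" "?p \<in> ball ?p d" using q d(1) by (auto simp: dist_norm norm_minus_commute)
      have main: "\<bar>f (chart_inv \<kappa> q) \<omega> - f (chart_inv \<kappa> ?p) \<omega> - g l (grad_M \<A> g f l \<omega>) (q - ?p)\<bar> \<le> e * norm (q - ?p)"
        if \<omega>: "\<omega> \<in> space \<mu>" for \<omega>
      proof -
        let ?k = "(\<lambda>y. f y \<omega>) \<circ> chart_inv \<kappa>"
        have diff: "?k differentiable (at p)" if "p \<in> ball ?p d" for p
          using mdifferentiable_chart(1)[OF \<kappa>(1) chart_inv_dom[OF \<kappa>(1)] f_mdifferentiable[OF \<omega>], of p]
            chart_map_inv[OF \<kappa>(1), of p] that d(2) by auto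
        have "norm (?k q - ?k ?p - frechet_derivative ?k (at ?p) (q - ?p)) \<le> norm (q - ?p) * e"
        proof (rule differentiable_bound_linearization[where S="ball ?p d" and f'="\<lambda>p. frechet_derivative ?k (at p)" and ?x0.0="?p"])
          show "?p + t *\<^sub>R (q - ?p) \<in> ball ?p d" if "t \<in> {0..1}" for t
          proof -
            have "norm (t *\<^sub>R (q - ?p)) \<le> norm (q - ?p)" using that by (simp add: mult_left_le_one_le)
            then show ?thesis using q by (simp add: dist_norm)
          qed
          show "(?k has_derivative frechet_derivative ?k (at p)) (at p within ball ?p d)" if "p \<in> ball ?p d" for p
            by (rule has_derivative_at_withinI[OF has_frechet_derivative[OF diff[OF that]]])
          show "onorm (frechet_derivative ?k (at p) - frechet_derivative ?k (at ?p)) \<le> e" if "p \<in> ball ?p d" for p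
            by (rule onorm_bound) (use e d(3)[OF that \<omega>] in auto)
        qed (rule qb)
        moreover have "frechet_derivative ?k (at ?p) u = g l (grad_M \<A> g f l \<omega>) u" for u
          unfolding grad_M_chart[OF \<kappa> \<omega>] by (simp add: \<kappa>_def of_chart_at)
        ultimately show ?thesis by (simp add: mult.commute)
      qed
      have "(F \<circ> chart_inv \<kappa>) q - (F \<circ> chart_inv \<kappa>) ?p - ?D (q - ?p)
        = (\<integral>\<omega>. f (chart_inv \<kappa> q) \<omega> - f (chart_inv \<kappa> ?p) \<omega> - g l (grad_M \<A> g f l \<omega>) (q - ?p) \<partial>\<mu>)"
        by (simp add: F_def f_integrable integrable_grad_inner)
      also have "\<bar>\<dots>\<bar> \<le> e * norm (q - ?p)"
        by (intro abs_integral_le main Bochner_Integration.integrable_diff f_integrable integrable_grad_inner)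
      finally show ?thesis by simp
    qed
    then show "\<exists>d>0. \<forall>q. norm (q - ?p) < d \<longrightarrow>
        norm ((F \<circ> chart_inv \<kappa>) q - (F \<circ> chart_inv \<kappa>) ?p - ?D (q - ?p)) \<le> e * norm (q - ?p)"
      using d(1) by blast
  qed
qed

lemma F_mdifferentiable: "mdifferentiable_at \<A> F x"
  unfolding mdifferentiable_at_def local_rep_def differentiable_def using F_has_derivative by blast

lemma grad_F: "g x (riem_grad \<A> g F x) v = (\<integral>\<omega>. g x (grad_M \<A> g f x \<omega>) v \<partial>\<mu>)"
  unfolding riem_grad[OF F_mdifferentiable] local_rep_def
  using frechet_derivative_eqI[OF F_has_derivative] by simp

lemma F_chart_deriv:
  assumes "c \<in> \<A>" "x \<in> chart_dom c"
  shows "frechet_derivative (F \<circ> chart_inv c) (at (chart_map c x)) u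
    = (\<integral>\<omega>. frechet_derivative ((\<lambda>y. f y \<omega>) \<circ> chart_inv c) (at (chart_map c x)) u \<partial>\<mu>)"
  unfolding riem_grad_chart[OF assms F_mdifferentiable, symmetric] grad_F
  by (intro Bochner_Integration.integral_cong refl) (simp add: grad_M_chart[OF assms])

text \<open>The squared norm is the differential applied to the gradient, which in one fixed chart
  is \<open>chart_covector\<close> paired with its \<open>riesz_rep\<close>. This expression is
  continuous in coordinates, while the components of \<open>riem_grad\<close> jump with the
  preferred chart.\<close>

lemma isCont_norm_grad_F: "isCont (\<lambda>y. gnorm g y (riem_grad \<A> g F y)) l"
proof -
  let ?\<kappa> = "chart_at \<A> l"
  let ?p = "chart_map ?\<kappa> l"
  have \<kappa>: "?\<kappa> \<in> \<A>" "l \<in> chart_dom ?\<kappa>" using chart_at by simp_all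
  interpret c: continuous_inner_products "chart_img ?\<kappa>" "chart_metric ?\<kappa>"
    by (rule continuous_inner_products_chart_metric[OF \<kappa>(1)])
  have diff: "(F \<circ> chart_inv ?\<kappa>) differentiable (at p)" if "p \<in> chart_img ?\<kappa>" for p
    using mdifferentiable_chart(1)[OF \<kappa>(1) chart_inv_dom[OF \<kappa>(1) that] F_mdifferentiable]
      chart_map_inv[OF \<kappa>(1) that] by simp
  have deriv: "isCont (\<lambda>p. frechet_derivative (F \<circ> chart_inv ?\<kappa>) (at p) b) ?p" if "b \<in> Basis" for b
    unfolding continuous_at_eps_delta
  proof (intro allI impI)
    fix e :: real assume "e > 0"
    then have "e / 2 > 0" by simp
    obtain d where d: "d > 0" "ball ?p d \<subseteq> chart_img ?\<kappa>"
      "\<And>p \<omega> u. p \<in> ball ?p d \<Longrightarrow> \<omega> \<in> space \<mu> \<Longrightarrow>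
        \<bar>frechet_derivative ((\<lambda>y. f y \<omega>) \<circ> chart_inv ?\<kappa>) (at p) u
        - frechet_derivative ((\<lambda>y. f y \<omega>) \<circ> chart_inv ?\<kappa>) (at ?p) u\<bar> \<le> e / 2 * norm u"
      using equicontinuous_derivative[OF \<open>e / 2 > 0\<close>, of l] by metis
    have int: "integrable \<mu> (\<lambda>\<omega>. frechet_derivative ((\<lambda>y. f y \<omega>) \<circ> chart_inv ?\<kappa>) (at (chart_map ?\<kappa> y)) b)"
      if "y \<in> chart_dom ?\<kappa>" for y
      using integrable_grad_inner[of y "of_chart \<A> ?\<kappa> y b"]
      by (subst Bochner_Integration.integrable_cong[OF refl grad_M_chart[OF \<kappa>(1) that]])
    have "dist (frechet_derivative (F \<circ> chart_inv ?\<kappa>) (at p) b) (frechet_derivative (F \<circ> chart_inv ?\<kappa>) (at ?p) b) < e"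
      if "dist p ?p < d" for p
    proof -
      have p: "p \<in> ball ?p d" using that by (simp add: dist_commute)
      then obtain y where y: "y \<in> chart_dom ?\<kappa>" "p = chart_map ?\<kappa> y" using d(2) by auto
      have "\<bar>frechet_derivative (F \<circ> chart_inv ?\<kappa>) (at p) b - frechet_derivative (F \<circ> chart_inv ?\<kappa>) (at ?p) b\<bar>
        = \<bar>\<integral>\<omega>. frechet_derivative ((\<lambda>y. f y \<omega>) \<circ> chart_inv ?\<kappa>) (at p) b
          - frechet_derivative ((\<lambda>y. f y \<omega>) \<circ> chart_inv ?\<kappa>) (at ?p) b \<partial>\<mu>\<bar>"
        using int[OF y(1)] int[OF \<kappa>(2)]
        by (simp add: y(2) F_chart_deriv[OF \<kappa>(1) y(1)] F_chart_deriv[OF \<kappa>])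
      also have "\<dots> \<le> e / 2"
        using int[OF y(1)] int[OF \<kappa>(2)] d(3)[OF p, of _ b] that \<open>b \<in> Basis\<close>
        by (intro abs_integral_le Bochner_Integration.integrable_diff) (auto simp: y(2))
      finally show ?thesis using \<open>e > 0\<close> by (simp add: dist_real_def)
    qed
    then show "\<exists>d>0. \<forall>p. dist p ?p < d \<longrightarrow>
      dist (frechet_derivative (F \<circ> chart_inv ?\<kappa>) (at p) b) (frechet_derivative (F \<circ> chart_inv ?\<kappa>) (at ?p) b) < e"
      using d(1) by blast
  qed
  have cov: "isCont (chart_covector ?\<kappa> F) ?p"
    unfolding chart_covector_def by (intro continuous_intros deriv)
  have "isCont (\<lambda>(p, a). c.riesz_rep p a) (?p, chart_covector ?\<kappa> F ?p)"
  proof -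
    have "open (chart_img ?\<kappa> \<times> (UNIV :: 'e set))" by (intro open_Times open_chart_img \<kappa> open_UNIV)
    then show ?thesis
      using c.continuous_riesz_rep \<kappa>(2) by (subst (asm) continuous_on_eq_continuous_at) auto
  qed
  moreover have "isCont (\<lambda>p. (p, chart_covector ?\<kappa> F p)) ?p" using cov by (intro continuous_intros)
  ultimately have riesz: "isCont (\<lambda>p. c.riesz_rep p (chart_covector ?\<kappa> F p)) ?p"
    using isCont_o2[where f="\<lambda>p. (p, chart_covector ?\<kappa> F p)" and g="\<lambda>(p, a). c.riesz_rep p a"] by simp
  define n where "n p = sqrt (chart_covector ?\<kappa> F p \<bullet> c.riesz_rep p (chart_covector ?\<kappa> F p))" for p
  have "isCont n ?p" unfolding n_def by (intro continuous_intros cov riesz)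
  moreover have "isCont (chart_map ?\<kappa>) l"
    using continuous_chart_map[OF \<kappa>(1)] continuous_on_eq_continuous_at[OF open_chart_dom[OF \<kappa>(1)]] \<kappa>(2) by blast
  ultimately have "isCont (\<lambda>y. n (chart_map ?\<kappa> y)) l" by (rule isCont_o2[rotated])
  moreover have "\<forall>\<^sub>F y in nhds l. gnorm g y (riem_grad \<A> g F y) = n (chart_map ?\<kappa> y)"
  proof -
    have "\<forall>\<^sub>F y in nhds l. y \<in> chart_dom ?\<kappa>"
      using open_chart_dom[OF \<kappa>(1)] \<kappa>(2) by (rule eventually_nhds_in_open)
    then show ?thesis
    proof eventually_elim
      case (elim y)
      define w where "w = c.riesz_rep (chart_map ?\<kappa> y) (chart_covector ?\<kappa> F (chart_map ?\<kappa> y))"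
      have w: "of_chart \<A> ?\<kappa> y w = riem_grad \<A> g F y"
        unfolding w_def to_chart_riem_grad[OF \<kappa>(1) elim F_mdifferentiable, symmetric]
        by (rule of_to_chart[OF \<kappa>(1) elim])
      have "g y (riem_grad \<A> g F y) (riem_grad \<A> g F y) = chart_metric ?\<kappa> (chart_map ?\<kappa> y) w w"
        by (simp add: chart_metric_apply[OF \<kappa>(1) elim] w)
      also have "\<dots> = chart_covector ?\<kappa> F (chart_map ?\<kappa> y) \<bullet> w"
        using elim by (simp add: w_def c.riesz_rep)
      finally show ?case by (simp add: gnorm_def n_def w_def)
    qed
  qed
  ultimately show ?thesis by (subst isCont_cong)
qed

lemma F_expansion:
  assumes "compact K" "r > 0"
  obtains C where "C > 0" "\<And>x v. x \<in> K \<Longrightarrow> gnorm g x v \<le> r \<Longrightarrow>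
    F (R x v) \<le> F x + g x (riem_grad \<A> g F x) v + C * (gnorm g x v)\<^sup>2"
proof -
  obtain C where C: "C > 0" "\<And>x v \<omega>. x \<in> K \<Longrightarrow> \<omega> \<in> space \<mu> \<Longrightarrow> gnorm g x v \<le> r \<Longrightarrow>
    \<bar>f (R x v) \<omega> - f x \<omega> - g x (grad_M \<A> g f x \<omega>) v\<bar> \<le> C * (gnorm g x v)\<^sup>2"
    using first_order_expansion[OF assms] by metis
  have "F (R x v) \<le> F x + g x (riem_grad \<A> g F x) v + C * (gnorm g x v)\<^sup>2" if "x \<in> K" "gnorm g x v \<le> r" for x v
  proof -
    have "\<bar>\<integral>\<omega>. f (R x v) \<omega> - f x \<omega> - g x (grad_M \<A> g f x \<omega>) v \<partial>\<mu>\<bar> \<le> C * (gnorm g x v)\<^sup>2"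
      by (intro abs_integral_le Bochner_Integration.integrable_diff f_integrable integrable_grad_inner C(2) that)
    moreover have "(\<integral>\<omega>. f (R x v) \<omega> - f x \<omega> - g x (grad_M \<A> g f x \<omega>) v \<partial>\<mu>)
        = F (R x v) - F x - g x (riem_grad \<A> g F x) v"
      by (simp add: F_def grad_F f_integrable integrable_grad_inner)
    ultimately show ?thesis by linarith
  qed
  then show ?thesis using that C(1) by blast
qed

end

section \<open>Measurability in charts\<close>

text \<open>Round \<open>p\<close> to the first point of a countable dense sequence within distance
  \<open>1 / (n + 1)\<close>. The rounded function is a countable patchwork of functions measurable
  in \<omega>, hence jointly measurable, and by continuity in \<open>p\<close> it converges as
  \<open>n\<close> grows.\<close>

lemma Caratheodory_measurable:
  fixes h :: "'e::{metric_space, second_countable_topology} \<Rightarrow> 'w \<Rightarrow> real"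
  assumes U: "open U"
    and cont: "\<And>\<omega>. \<omega> \<in> space M \<Longrightarrow> continuous_on U (\<lambda>p. h p \<omega>)"
    and meas: "\<And>p. p \<in> U \<Longrightarrow> h p \<in> borel_measurable M"
  shows "(\<lambda>(p, \<omega>). if p \<in> U then h p \<omega> else 0) \<in> borel_measurable (borel \<Otimes>\<^sub>M M)"
proof (cases "U = {}")
  case False
  obtain T where T: "countable T" "T \<subseteq> U" "U \<subseteq> closure T" using separable by metis
  then have ne: "T \<noteq> {}" using False by auto
  define d where "d = from_nat_into T"
  have dU: "d i \<in> U" for i using from_nat_into[OF ne] T(2) by (auto simp: d_def)
  define idx where "idx n p = (LEAST i. dist p (d i) < inverse (real (Suc n)))" for n p
  have near: "dist p (d (idx n p)) < inverse (real (Suc n))" if "p \<in> U" for n p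
  proof -
    have "\<exists>y\<in>T. dist y p < inverse (real (Suc n))"
      using T(3) that closure_approachable[of p T] by auto
    then have "\<exists>i. dist p (d i) < inverse (real (Suc n))"
      unfolding d_def using from_nat_into_surj[OF T(1)] by (metis dist_commute)
    then show ?thesis unfolding idx_def by (rule LeastI_ex)
  qed
  have [measurable]: "idx n \<in> measurable borel (count_space UNIV)" for n
    unfolding idx_def by measurable
  have [measurable]: "U \<in> sets borel" using U by simp
  have [measurable]: "h (d i) \<in> borel_measurable M" for i by (rule meas[OF dU])
  show ?thesis
  proof (rule borel_measurable_LIMSEQ_real)
    show "(\<lambda>z. if fst z \<in> U then h (d (idx n (fst z))) (snd z) else 0) \<in> borel_measurable (borel \<Otimes>\<^sub>M M)" for n
    proof -
      have "(\<lambda>z. h (d (idx n (fst z))) (snd z)) \<in> borel_measurable (borel \<Otimes>\<^sub>M M)"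
        by (rule measurable_compose_countable[where g="\<lambda>z. idx n (fst z)"]) measurable
      then show ?thesis by measurable
    qed
    show "(\<lambda>n. if fst z \<in> U then h (d (idx n (fst z))) (snd z) else 0)
        \<longlonglongrightarrow> (case z of (p, \<omega>) \<Rightarrow> if p \<in> U then h p \<omega> else 0)" if z: "z \<in> space (borel \<Otimes>\<^sub>M M)" for z
    proof (cases "fst z \<in> U")
      case True
      have "(\<lambda>n. dist (d (idx n (fst z))) (fst z)) \<longlonglongrightarrow> 0"
        by (rule tendsto_sandwich[OF _ _ tendsto_const LIMSEQ_inverse_real_of_nat])
          (use near[OF True] in \<open>auto simp: dist_commute less_imp_le\<close>)
      then have "(\<lambda>n. d (idx n (fst z))) \<longlonglongrightarrow> fst z" by (rule tendsto_dist_iff[THEN iffD2])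
      moreover have "snd z \<in> space M" using z by (auto simp: space_pair_measure)
      ultimately have "(\<lambda>n. h (d (idx n (fst z))) (snd z)) \<longlonglongrightarrow> h (fst z) (snd z)"
        by (intro continuous_on_tendsto_compose[OF cont] True) (auto simp: dU)
      then show ?thesis using True by (cases z) (simp only: fst_conv snd_conv prod.case if_True)
    qed (cases z, simp)
  qed
qed simp

context atlas
begin

text \<open>Measurability can be checked piecewise over countably many pieces; second countability
  provides them through Lindelof's theorem.\<close>

lemma countable_chart_cover:
  obtains \<C> where "countable \<C>" "\<C> \<subseteq> \<A>" "(\<Union>c\<in>\<C>. chart_dom c) = UNIV"
proof -
  obtain \<F> where F: "\<F> \<subseteq> chart_dom ` \<A>" "countable \<F>" "\<Union>\<F> = \<Union>(chart_dom ` \<A>)"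
    by (rule Lindelof[of "chart_dom ` \<A>"]) (metis imageE open_chart_dom)
  obtain \<C> where "countable \<C>" "\<C> \<subseteq> \<A>" "\<F> = chart_dom ` \<C>"
    using countable_subset_image[THEN iffD1, OF conjI[OF F(2,1)]] by metis
  moreover have "\<Union>(chart_dom ` \<A>) = UNIV" using smooth_atlas unfolding smooth_atlas_def by simp
  ultimately show ?thesis using that F(3) by simp
qed

lemma chart_derivative_measurable:
  assumes c: "c \<in> \<A>"
    and diff: "\<And>\<omega> y. \<omega> \<in> space M \<Longrightarrow> mdifferentiable_at \<A> (\<lambda>y. h y \<omega>) y"
    and meas: "\<And>y. h y \<in> borel_measurable M"
  shows "(\<lambda>(p, \<omega>). if p \<in> chart_img c then frechet_derivative ((\<lambda>y. h y \<omega>) \<circ> chart_inv c) (at p) u else 0)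
    \<in> borel_measurable (borel \<Otimes>\<^sub>M M)"
proof -
  let ?U = "chart_img c"
  \<comment> \<open>Extended by 0, \<open>h'\<close> can be evaluated at shifted points outside the
    chart image. As the image is open, this affects only finitely many difference quotients at each
    of its points.\<close>
  define h' where "h' = (\<lambda>(p, \<omega>). if p \<in> ?U then h (chart_inv c p) \<omega> else 0)"
  have U: "open ?U" by (rule open_chart_img[OF c])
  have dU: "((\<lambda>y. h y \<omega>) \<circ> chart_inv c) differentiable (at p)" if "\<omega> \<in> space M" "p \<in> ?U" for \<omega> p
    using mdifferentiable_chart(1)[OF c chart_inv_dom[OF c that(2)] diff[OF that(1)]]
      chart_map_inv[OF c that(2)] by simp
  have [measurable]: "h' \<in> borel_measurable (borel \<Otimes>\<^sub>M M)"
    unfolding h'_def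
  proof (rule Caratheodory_measurable[OF U])
    show "continuous_on ?U (\<lambda>p. h (chart_inv c p) \<omega>)" if "\<omega> \<in> space M" for \<omega>
      using differentiable_imp_continuous_within[OF dU[OF that]]
      by (intro continuous_at_imp_continuous_on) (auto simp: comp_def)
  qed (rule meas)
  have [measurable]: "?U \<in> sets borel" using U by simp
  show ?thesis
  proof (rule borel_measurable_LIMSEQ_real)
    show "(\<lambda>z. if fst z \<in> ?U then (h' (fst z + inverse (real (Suc n)) *\<^sub>R u, snd z) - h' z) / inverse (real (Suc n)) else 0)
      \<in> borel_measurable (borel \<Otimes>\<^sub>M M)" for n
      by measurable
    show "(\<lambda>n. if fst z \<in> ?U then (h' (fst z + inverse (real (Suc n)) *\<^sub>R u, snd z) - h' z) / inverse (real (Suc n)) else 0)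
      \<longlonglongrightarrow> (case z of (p, \<omega>) \<Rightarrow> if p \<in> ?U then frechet_derivative ((\<lambda>y. h y \<omega>) \<circ> chart_inv c) (at p) u else 0)"
      if z: "z \<in> space (borel \<Otimes>\<^sub>M M)" for z
    proof (cases "fst z \<in> ?U")
      case True
      have \<omega>: "snd z \<in> space M" using z by (auto simp: space_pair_measure)
      have eq: "((\<lambda>y. h y (snd z)) \<circ> chart_inv c) p = (\<lambda>p. h' (p, snd z)) p" if "p \<in> ?U" for p
        using that by (simp add: h'_def)
      have eq1: "((\<lambda>y. h y (snd z)) \<circ> chart_inv c) differentiable (at (fst z))
          \<longleftrightarrow> (\<lambda>p. h' (p, snd z)) differentiable (at (fst z))"
        by (rule frechet_derivative_cong_open(1)[OF U True eq])
      have eq2: "frechet_derivative ((\<lambda>y. h y (snd z)) \<circ> chart_inv c) (at (fst z))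
          = frechet_derivative (\<lambda>p. h' (p, snd z)) (at (fst z))"
        by (rule frechet_derivative_cong_open(2)[OF U True eq])
      note lim = difference_quotient_limit[OF eq1[THEN iffD1, OF dU[OF \<omega> True]], of u, folded eq2]
      show ?thesis using lim True by (cases z) (simp only: fst_conv snd_conv prod.case if_True)
    qed (cases z, simp)
  qed
qed

end

context riemannian
begin

text \<open>Three stages, each the input of the next: coordinates of the point, partial derivatives
  by their joint measurability, and the gradient components by joint continuity of
  \<open>riesz_rep\<close>.\<close>

lemma to_chart_grad_measurable:
  assumes c: "c \<in> \<A>"
    and diff: "\<And>\<omega> y. \<omega> \<in> space M \<Longrightarrow> mdifferentiable_at \<A> (\<lambda>y. h y \<omega>) y"
    and meas: "\<And>y. h y \<in> borel_measurable M"
    and Y[measurable]: "Y \<in> measurable N borel" and W[measurable]: "W \<in> measurable N M"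
    and Yc: "\<And>s. s \<in> space N \<Longrightarrow> Y s \<in> chart_dom c"
  shows "(\<lambda>s. chart_map c (Y s)) \<in> measurable N borel"
    and "(\<lambda>s. chart_covector c (\<lambda>y. h y (W s)) (chart_map c (Y s))) \<in> measurable N borel"
    and "(\<lambda>s. to_chart \<A> c (Y s) (riem_grad \<A> g (\<lambda>y. h y (W s)) (Y s))) \<in> measurable N borel"
proof -
  interpret c: continuous_inner_products "chart_img c" "chart_metric c"
    by (rule continuous_inner_products_chart_metric[OF c])
  have "Y \<in> measurable N (restrict_space borel (chart_dom c))"
    by (rule measurable_restrict_space2[OF _ Y]) (use Yc in blast)
  moreover have "chart_map c \<in> measurable (restrict_space borel (chart_dom c)) borel"
    by (intro borel_measurable_continuous_on_restrict continuous_chart_map c)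
  ultimately show p[measurable]: "(\<lambda>s. chart_map c (Y s)) \<in> measurable N borel"
    by (rule measurable_compose)
  have "(\<lambda>s. frechet_derivative ((\<lambda>y. h y (W s)) \<circ> chart_inv c) (at (chart_map c (Y s))) b) \<in> borel_measurable N" for b
  proof -
    have "(\<lambda>s. (chart_map c (Y s), W s)) \<in> measurable N (borel \<Otimes>\<^sub>M M)" by measurable
    from measurable_compose[OF this chart_derivative_measurable[OF c diff meas, of b]]
    show ?thesis by (rule measurable_cong[THEN iffD1, rotated]) (use Yc in auto)
  qed
  then show cov[measurable]: "(\<lambda>s. chart_covector c (\<lambda>y. h y (W s)) (chart_map c (Y s))) \<in> measurable N borel"
    unfolding chart_covector_def by measurable
  have "(\<lambda>s. (chart_map c (Y s), chart_covector c (\<lambda>y. h y (W s)) (chart_map c (Y s))))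
      \<in> measurable N (restrict_space borel (chart_img c \<times> UNIV))"
  proof (rule measurable_restrict_space2)
    show "(\<lambda>s. (chart_map c (Y s), chart_covector c (\<lambda>y. h y (W s)) (chart_map c (Y s)))) \<in> measurable N borel" by (rule borel_measurable_Pair) measurable
  qed (use Yc in blast)
  moreover have "(\<lambda>(p, a). c.riesz_rep p a) \<in> measurable (restrict_space borel (chart_img c \<times> UNIV)) borel"
    by (intro borel_measurable_continuous_on_restrict c.continuous_riesz_rep)
  ultimately have "(\<lambda>s. (\<lambda>(p, a). c.riesz_rep p a)
      (chart_map c (Y s), chart_covector c (\<lambda>y. h y (W s)) (chart_map c (Y s)))) \<in> measurable N borel"
    by (rule measurable_compose)
  then show "(\<lambda>s. to_chart \<A> c (Y s) (riem_grad \<A> g (\<lambda>y. h y (W s)) (Y s))) \<in> measurable N borel"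
    by (rule measurable_cong[THEN iffD1, rotated])
      (use Yc to_chart_riem_grad[OF c] diff measurable_space[OF W] in auto)
qed

lemma measurable_by_charts:
  assumes Y[measurable]: "Y \<in> measurable N borel"
    and "\<And>c. c \<in> \<A> \<Longrightarrow> f \<in> measurable (restrict_space N {s \<in> space N. Y s \<in> chart_dom c}) K"
  shows "f \<in> measurable N K"
proof -
  obtain \<C> where C: "countable \<C>" "\<C> \<subseteq> \<A>" "(\<Union>c\<in>\<C>. chart_dom c) = UNIV"
    by (rule countable_chart_cover)
  show ?thesis
  proof (rule measurable_piecewise_restrict[of "(\<lambda>c. {s \<in> space N. Y s \<in> chart_dom c}) ` \<C>"])
    fix S assume "S \<in> (\<lambda>c. {s \<in> space N. Y s \<in> chart_dom c}) ` \<C>"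
    then obtain c where c: "c \<in> \<A>" "S = {s \<in> space N. Y s \<in> chart_dom c}" using C(2) by auto
    have [measurable]: "chart_dom c \<in> sets borel" using open_chart_dom[OF c(1)] by simp
    have "S \<in> sets N" unfolding c(2) by measurable
    then show "S \<inter> space N \<in> sets N" by simp
    show "f \<in> measurable (restrict_space N S) K" unfolding c(2) by (rule assms(2)[OF c(1)])
  next
    show "space N \<subseteq> \<Union> ((\<lambda>c. {s \<in> space N. Y s \<in> chart_dom c}) ` \<C>)" using C(3) by blast
  qed (use C in simp)
qed

text \<open>In a chart, the inner product of two gradients is the differential of \<open>h1\<close>
  evaluated on the components of the gradient of \<open>h2\<close>, so the metric enters only
  through \<open>riesz_rep\<close>.\<close>

lemma grad_inner_measurable:
  assumes diff1: "\<And>\<omega> y. \<omega> \<in> space M \<Longrightarrow> mdifferentiable_at \<A> (\<lambda>y. h1 y \<omega>) y"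
    and meas1: "\<And>y. h1 y \<in> borel_measurable M"
    and diff2: "\<And>\<omega> y. \<omega> \<in> space M \<Longrightarrow> mdifferentiable_at \<A> (\<lambda>y. h2 y \<omega>) y"
    and meas2: "\<And>y. h2 y \<in> borel_measurable M"
    and Y[measurable]: "Y \<in> measurable N borel" and W[measurable]: "W \<in> measurable N M"
  shows "(\<lambda>s. g (Y s) (riem_grad \<A> g (\<lambda>y. h1 y (W s)) (Y s)) (riem_grad \<A> g (\<lambda>y. h2 y (W s)) (Y s))) \<in> borel_measurable N"
proof (rule measurable_by_charts[OF Y])
  fix c assume c: "c \<in> \<A>"
  let ?N = "restrict_space N {s \<in> space N. Y s \<in> chart_dom c}"
  have Y': "Y \<in> measurable ?N borel" and W': "W \<in> measurable ?N M"
    by (intro measurable_restrict_space1 Y W)+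
  have sp: "s \<in> space ?N \<Longrightarrow> s \<in> space N \<and> Y s \<in> chart_dom c" for s by (simp add: space_restrict_space)
  have Yc: "s \<in> space ?N \<Longrightarrow> Y s \<in> chart_dom c" for s using sp by blast
  note [measurable] = to_chart_grad_measurable(2)[OF c diff1 meas1 Y' W' Yc]
    to_chart_grad_measurable(3)[OF c diff2 meas2 Y' W' Yc]
  have "(\<lambda>s. chart_covector c (\<lambda>y. h1 y (W s)) (chart_map c (Y s)) \<bullet>
      to_chart \<A> c (Y s) (riem_grad \<A> g (\<lambda>y. h2 y (W s)) (Y s))) \<in> borel_measurable ?N"
    by measurable
  then show "(\<lambda>s. g (Y s) (riem_grad \<A> g (\<lambda>y. h1 y (W s)) (Y s)) (riem_grad \<A> g (\<lambda>y. h2 y (W s)) (Y s))) \<in> borel_measurable ?N"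
  proof (rule measurable_cong[THEN iffD1, rotated])
    fix s assume "s \<in> space ?N"
    from sp[OF this] have s: "W s \<in> space M" "Y s \<in> chart_dom c" using measurable_space[OF W] by blast+
    show "chart_covector c (\<lambda>y. h1 y (W s)) (chart_map c (Y s)) \<bullet> to_chart \<A> c (Y s) (riem_grad \<A> g (\<lambda>y. h2 y (W s)) (Y s))
      = g (Y s) (riem_grad \<A> g (\<lambda>y. h1 y (W s)) (Y s)) (riem_grad \<A> g (\<lambda>y. h2 y (W s)) (Y s))"
      unfolding chart_covector_inner[OF mdifferentiable_chart(1)[OF c s(2) diff1[OF s(1)]]]
        riem_grad_chart[OF c s(2) diff1[OF s(1)], symmetric] of_to_chart[OF c s(2)] ..
  qed
qed

end

text \<open>\<open>R\<close> in a bundle chart is jointly continuous, and the coordinates fed into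
  it are measurable. Linearity of \<open>of_chart\<close> carries the scalar factor into the
  chart.\<close>

lemma (in riemannian_retraction) step_measurable:
  assumes diff: "\<And>\<omega> y. \<omega> \<in> space M \<Longrightarrow> mdifferentiable_at \<A> (\<lambda>y. h y \<omega>) y"
    and meas: "\<And>y. h y \<in> borel_measurable M"
    and Y[measurable]: "Y \<in> measurable N borel" and W[measurable]: "W \<in> measurable N M"
    and a[measurable]: "a \<in> borel_measurable N"
  shows "(\<lambda>s. R (Y s) (a s *\<^sub>R riem_grad \<A> g (\<lambda>y. h y (W s)) (Y s))) \<in> measurable N borel"
proof (rule measurable_by_charts[OF Y])
  fix c assume c: "c \<in> \<A>"
  let ?N = "restrict_space N {s \<in> space N. Y s \<in> chart_dom c}"
  let ?G = "\<lambda>s. riem_grad \<A> g (\<lambda>y. h y (W s)) (Y s)"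
  have Y': "Y \<in> measurable ?N borel" and W': "W \<in> measurable ?N M" and [measurable]: "a \<in> borel_measurable ?N"
    by (intro measurable_restrict_space1 Y W a)+
  have Yc: "s \<in> space ?N \<Longrightarrow> Y s \<in> chart_dom c" for s by (simp add: space_restrict_space)
  note [measurable] = to_chart_grad_measurable(1,3)[OF c diff meas Y' W' Yc]
  have "(\<lambda>s. (chart_map c (Y s), a s *\<^sub>R to_chart \<A> c (Y s) (?G s))) \<in> measurable ?N (restrict_space borel (chart_img c \<times> UNIV))"
  proof (rule measurable_restrict_space2)
    show "(\<lambda>s. (chart_map c (Y s), a s *\<^sub>R to_chart \<A> c (Y s) (?G s))) \<in> measurable ?N borel" by (rule borel_measurable_Pair) measurable
  qed (use Yc in blast)
  from measurable_compose[OF this borel_measurable_continuous_on_restrict[OF continuous_R_chart[OF c]]]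
  show "(\<lambda>s. R (Y s) (a s *\<^sub>R ?G s)) \<in> measurable ?N borel"
  proof (rule measurable_cong[THEN iffD1, rotated])
    fix s assume "s \<in> space ?N"
    then have s: "Y s \<in> chart_dom c" by (rule Yc)
    show "(\<lambda>(p, w). R (chart_inv c p) (of_chart \<A> c (chart_inv c p) w)) (chart_map c (Y s), a s *\<^sub>R to_chart \<A> c (Y s) (?G s))
        = R (Y s) (a s *\<^sub>R ?G s)"
      using linear_scale[OF linear_of_chart[OF c s]] by (simp add: chart_inv_map[OF c s] of_to_chart[OF c s])
  qed
qed

section \<open>Orthogonal increments and numerical sequences\<close>

text \<open>Subtracting the partial sums of \<open>e\<close> from \<open>u\<close> leaves a
  decreasing sequence that is bounded below. The hypothesis asks for convergence of these sums
  instead of absolute summability, because this is what is available for the noise.\<close>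

lemma nonneg_descent_converges:
  fixes u p e :: "nat \<Rightarrow> real"
  assumes step: "\<And>t. u (Suc t) \<le> u t - p t + e t"
    and p: "\<And>t. p t \<ge> 0" and e: "convergent (\<lambda>n. \<Sum>t<n. e t)" and low: "\<And>t. u t \<ge> B"
  shows "convergent u" "summable p"
proof -
  define E where "E n = (\<Sum>t<n. e t)" for n
  have E: "convergent E" using e by (simp add: E_def[abs_def])
  have "Bseq E" using E convergent_imp_Bseq by blast
  then obtain C where C: "\<And>n. \<bar>E n\<bar> \<le> C" unfolding Bseq_def by auto
  have ES: "E (Suc n) = E n + e n" for n by (simp add: E_def)
  have "convergent (\<lambda>n. u n - E n)"
  proof -
    have "u (Suc n) - E (Suc n) \<le> u n - E n" for n using step[of n] p[of n] ES[of n] by linarith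
    then have "decseq (\<lambda>n. u n - E n)" by (rule decseq_SucI)
    moreover have "B - C \<le> u n - E n" for n using low[of n] C[of n] by linarith
    ultimately show ?thesis using decseq_convergent[of "\<lambda>n. u n - E n" "B - C"] by (metis convergentI)
  qed
  from convergent_add[OF this E] show "convergent u" by simp
  have "(\<Sum>t<n. p t) \<le> u 0 - u n + E n" for n
  proof (induction n)
    case (Suc n)
    then show ?case using step[of n] ES[of n] by simp
  qed (simp add: E_def)
  then have "(\<Sum>t<n. p t) \<le> u 0 - B + C" for n using low[of n] C[of n] by (smt (verit, best))
  then show "summable p" by (intro summableI_nonneg_bounded[OF p])
qed

text \<open>Since \<open>c\<close> is not summable, \<open>n\<close> falls below \<epsilon> again
  and again, and by \<open>not\<close> it also exceeds \<open>2 * \<epsilon>\<close> again and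
  again. Between the last time below \<epsilon> and such a peak,
  \<open>c t \<le> c t * (n t)\<^sup>2 / \<epsilon>\<^sup>2\<close>, so the elapsed step size is
  dominated by a piece of a convergent series.\<close>

lemma upcrossing_intervals:
  fixes c n :: "nat \<Rightarrow> real"
  assumes c: "\<And>t. c t > 0" "c \<longlonglongrightarrow> 0" and n: "\<And>t. n t \<ge> 0"
    and div: "filterlim (\<lambda>k. \<Sum>t<k. c t) at_top sequentially"
    and sum: "summable (\<lambda>t. c t * (n t)\<^sup>2)" and not: "\<not> n \<longlonglongrightarrow> 0"
  obtains \<epsilon> where "\<epsilon> > 0"
    "\<And>\<delta> k. \<delta> > 0 \<Longrightarrow> \<exists>s\<ge>k. \<exists>e\<ge>s. n s < \<epsilon> \<and> n e > 2 * \<epsilon> \<and> (\<Sum>t\<in>{s..<e}. c t) < \<delta>"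
proof -
  have "\<exists>\<epsilon>'>0. \<forall>N. \<exists>e\<ge>N. n e \<ge> \<epsilon>'"
    using not n unfolding LIMSEQ_iff by (simp add: not_less abs_of_nonneg)
  then obtain \<epsilon>' where \<epsilon>': "\<epsilon>' > 0" "\<And>N. \<exists>e\<ge>N. n e \<ge> \<epsilon>'" by blast
  \<comment> \<open>A third rather than a half, so that \<open>n e \<ge> \<epsilon>'\<close> gives
    the strict bound \<open>n e > 2 * \<epsilon>\<close>.\<close>
  define \<epsilon> where "\<epsilon> = \<epsilon>' / 3"
  have \<epsilon>: "\<epsilon> > 0" using \<epsilon>' by (simp add: \<epsilon>_def)
  have large: "c t \<le> c t * (n t)\<^sup>2 / \<epsilon>\<^sup>2" if "n t \<ge> \<epsilon>" for t
  proof -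
    have "c t * \<epsilon>\<^sup>2 \<le> c t * (n t)\<^sup>2"
      using that \<epsilon> c(1)[of t] by (intro mult_left_mono power_mono) auto
    then show ?thesis using \<epsilon> by (simp add: field_simps)
  qed
  have "\<exists>s\<ge>k. \<exists>e\<ge>s. n s < \<epsilon> \<and> n e > 2 * \<epsilon> \<and> (\<Sum>t\<in>{s..<e}. c t) < \<delta>" if \<delta>: "\<delta> > 0" for \<delta> k
  proof -
    have "\<forall>\<^sub>F t in sequentially. c t < \<delta> / 2" using order_tendstoD(2)[OF c(2), of "\<delta> / 2"] \<delta> by simp
    then obtain K1 where K1: "\<And>t. t \<ge> K1 \<Longrightarrow> c t < \<delta> / 2" unfolding eventually_sequentially by blast
    have "\<epsilon>\<^sup>2 * \<delta> / 2 > 0" using \<epsilon> \<delta> by simp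
    then obtain K2 where K2: "\<And>i j. i \<ge> K2 \<Longrightarrow> norm (\<Sum>t\<in>{i..<j}. c t * (n t)\<^sup>2) < \<epsilon>\<^sup>2 * \<delta> / 2"
      using sum[unfolded summable_Cauchy] by blast
    define K where "K = max k (max K1 K2)"
    have "\<exists>s1\<ge>K. n s1 < \<epsilon>"
    proof (rule ccontr)
      assume "\<not> ?thesis"
      then have ge: "n t \<ge> \<epsilon>" if "t \<ge> K" for t using that not_less by blast
      have "summable c"
      proof (rule summable_comparison_test'[of "\<lambda>t. c t * (n t)\<^sup>2 / \<epsilon>\<^sup>2"])
        show "summable (\<lambda>t. c t * (n t)\<^sup>2 / \<epsilon>\<^sup>2)" by (rule summable_divide[OF sum])
        show "norm (c t) \<le> c t * (n t)\<^sup>2 / \<epsilon>\<^sup>2" if "t \<ge> K" for t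
          using large[OF ge[OF that]] c(1)[of t] by simp
      qed
      then have "(\<lambda>k. \<Sum>t<k. c t) \<longlonglongrightarrow> suminf c" by (rule summable_LIMSEQ)
      moreover have "filterlim (\<lambda>k. \<Sum>t<k. c t) at_infinity sequentially"
        using div by (rule filterlim_at_top_imp_at_infinity)
      ultimately show False using not_tendsto_and_filterlim_at_infinity[OF sequentially_bot] by blast
    qed
    then obtain s1 where s1: "s1 \<ge> K" "n s1 < \<epsilon>" by blast
    obtain e where e: "e \<ge> s1" "n e \<ge> \<epsilon>'" using \<epsilon>'(2) by blast
    define S where "S = {t \<in> {s1..e}. n t < \<epsilon>}"
    define s where "s = Max S"
    have S: "finite S" "S \<noteq> {}" using s1 e by (auto simp: S_def)
    have sS: "s \<in> S" unfolding s_def by (rule Max_in[OF S])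
    have after: "n t \<ge> \<epsilon>" if "s < t" "t \<le> e" for t
    proof (rule ccontr)
      assume "\<not> n t \<ge> \<epsilon>"
      then have "t \<in> S" using that sS by (auto simp: S_def)
      then have "t \<le> s" unfolding s_def by (rule Max_ge[OF S(1)])
      then show False using that by simp
    qed
    have e2: "n e > 2 * \<epsilon>" using e(2) \<epsilon>'(1) by (simp add: \<epsilon>_def)
    have s: "s \<ge> K" "s \<le> e" "n s < \<epsilon>" using sS s1 by (auto simp: S_def)
    then have "s < e" using e2 \<epsilon> by (cases "s = e") auto
    \<comment> \<open>At \<open>s\<close> itself \<open>n\<close> is below \<epsilon>, so
      \<open>large\<close> says nothing about \<open>c s\<close>. This term is split off; it is
      small because \<open>c\<close> tends to 0.\<close>
    then have "(\<Sum>t\<in>{s..<e}. c t) = c s + (\<Sum>t\<in>{Suc s..<e}. c t)" by (rule sum.atLeast_Suc_lessThan)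
    also have "(\<Sum>t\<in>{Suc s..<e}. c t) \<le> (\<Sum>t\<in>{Suc s..<e}. c t * (n t)\<^sup>2 / \<epsilon>\<^sup>2)"
      by (intro sum_mono large after) auto
    also have "\<dots> < \<delta> / 2"
    proof -
      have "(\<Sum>t\<in>{Suc s..<e}. c t * (n t)\<^sup>2) < \<epsilon>\<^sup>2 * \<delta> / 2"
        using K2[of "Suc s" e] s(1) by (simp add: K_def abs_less_iff)
      then show ?thesis using \<epsilon> by (simp add: sum_divide_distrib[symmetric] field_simps)
    qed
    finally have "(\<Sum>t\<in>{s..<e}. c t) < \<delta>" using K1[of s] s(1) by (simp add: K_def)
    moreover have "s \<ge> k" using s(1) by (simp add: K_def)
    ultimately show ?thesis using s e2 by blast
  qed
  then show ?thesis using that \<epsilon> by blast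
qed

text \<open>Bounded martingale differences. Tested on all bounded functions of the past,
  \<open>orth\<close> says that the conditional expectation of \<open>D t\<close> given
  \<open>Fi t\<close> vanishes, in exactly the form in which the second moment computations use
  it.\<close>

locale orthogonal_increments = prob_space P for P :: "'s measure" +
  fixes Fi :: "nat \<Rightarrow> 's measure" and D :: "nat \<Rightarrow> 's \<Rightarrow> real" and k :: "nat \<Rightarrow> real"
  assumes subalg: "\<And>t. subalgebra P (Fi t)"
    and mono: "\<And>t. sets (Fi t) \<subseteq> sets (Fi (Suc t))"
    and D_meas: "\<And>t. D t \<in> borel_measurable (Fi (Suc t))"
    and D_bound: "\<And>t s. s \<in> space P \<Longrightarrow> \<bar>D t s\<bar> \<le> k t"
    and orth: "\<And>t Z B. Z \<in> borel_measurable (Fi t) \<Longrightarrow> (\<And>s. s \<in> space P \<Longrightarrow> \<bar>Z s\<bar> \<le> B) \<Longrightarrow>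
      expectation (\<lambda>s. Z s * D t s) = 0"
begin

lemma Fi_mono:
  assumes "i \<le> j" "h \<in> borel_measurable (Fi i)"
  shows "h \<in> borel_measurable (Fi j)"
proof -
  have "sets (Fi i) \<subseteq> sets (Fi j)" using lift_Suc_mono_le[of "\<lambda>t. sets (Fi t)", OF mono assms(1)] .
  moreover have "space (Fi j) = space (Fi i)" using subalg by (simp add: subalgebra_def)
  ultimately have "subalgebra (Fi j) (Fi i)" by (simp add: subalgebra_def)
  then show ?thesis using assms(2) by (rule measurable_from_subalg)
qed

lemma sum_measurable: "(\<lambda>s. \<Sum>t<n. D t s) \<in> borel_measurable (Fi n)"
proof (rule borel_measurable_sum)
  fix t assume "t \<in> {..<n}"
  then show "D t \<in> borel_measurable (Fi n)" by (intro Fi_mono[OF _ D_meas]) simp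
qed

lemma sum_bound: "s \<in> space P \<Longrightarrow> \<bar>\<Sum>t<n. D t s\<bar> \<le> (\<Sum>t<n. k t)"
  by (intro order_trans[OF sum_abs] sum_mono D_bound)

lemma bounded_integrable:
  assumes "h \<in> borel_measurable (Fi n)" "\<And>s. s \<in> space P \<Longrightarrow> \<bar>h s\<bar> \<le> (B::real)"
  shows "integrable P h"
  using measurable_from_subalg[OF subalg assms(1)] assms(2)
  by (intro integrable_const_bound[where B=B]) auto

text \<open>On squaring the next partial sum, the cross term vanishes by \<open>orth\<close> with
  the current partial sum as test function.\<close>

lemma sum_square:
  "integrable P (\<lambda>s. (\<Sum>t<n. D t s)\<^sup>2)"
  "expectation (\<lambda>s. (\<Sum>t<n. D t s)\<^sup>2) \<le> (\<Sum>t<n. (k t)\<^sup>2)"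
proof -
  have int: "integrable P (\<lambda>s. (\<Sum>t<n. D t s)\<^sup>2)" for n
  proof (rule bounded_integrable)
    show "(\<lambda>s. (\<Sum>t<n. D t s)\<^sup>2) \<in> borel_measurable (Fi n)"
      using sum_measurable by (rule borel_measurable_power)
    show "\<bar>(\<Sum>t<n. D t s)\<^sup>2\<bar> \<le> (\<Sum>t<n. k t)\<^sup>2" if "s \<in> space P" for s
      using power_mono[OF sum_bound[OF that], of n 2] by simp
  qed
  then show "integrable P (\<lambda>s. (\<Sum>t<n. D t s)\<^sup>2)" .
  show "expectation (\<lambda>s. (\<Sum>t<n. D t s)\<^sup>2) \<le> (\<Sum>t<n. (k t)\<^sup>2)"
  proof (induction n)
    case (Suc n)
    let ?S = "\<lambda>s. \<Sum>t<n. D t s"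
    have i1: "integrable P (\<lambda>s. ?S s * D n s)"
    proof (rule bounded_integrable)
      show "(\<lambda>s. ?S s * D n s) \<in> borel_measurable (Fi (Suc n))"
        by (rule borel_measurable_times[OF Fi_mono[OF le_SucI[OF order_refl] sum_measurable] D_meas])
      show "\<bar>?S s * D n s\<bar> \<le> (\<Sum>t<n. k t) * k n" if "s \<in> space P" for s
        unfolding abs_mult using order_trans[OF abs_ge_zero sum_bound[OF that]]
        by (intro mult_mono sum_bound D_bound that) auto
    qed
    have b2: "(D n s)\<^sup>2 \<le> (k n)\<^sup>2" if "s \<in> space P" for s
      using power_mono[OF D_bound[OF that, of n], of 2] by simp
    have i2: "integrable P (\<lambda>s. (D n s)\<^sup>2)"
    proof (rule bounded_integrable)
      show "(\<lambda>s. (D n s)\<^sup>2) \<in> borel_measurable (Fi (Suc n))" by (intro borel_measurable_power D_meas)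
    qed (use b2 in auto)
    have "(\<Sum>t<Suc n. D t s)\<^sup>2 = (?S s)\<^sup>2 + 2 * (?S s * D n s) + (D n s)\<^sup>2" for s
      by (simp add: power2_sum)
    then have "expectation (\<lambda>s. (\<Sum>t<Suc n. D t s)\<^sup>2)
        = expectation (\<lambda>s. (?S s)\<^sup>2 + 2 * (?S s * D n s) + (D n s)\<^sup>2)" by (simp only:)
    also have "\<dots> = expectation (\<lambda>s. (?S s)\<^sup>2) + 2 * expectation (\<lambda>s. ?S s * D n s) + expectation (\<lambda>s. (D n s)\<^sup>2)"
      using int[of n] i1 i2 by simp
    also have "expectation (\<lambda>s. ?S s * D n s) = 0"
      by (rule orth[OF sum_measurable sum_bound])
    also have "expectation (\<lambda>s. (D n s)\<^sup>2) \<le> (k n)\<^sup>2"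
    proof -
      have "expectation (\<lambda>s. (D n s)\<^sup>2) \<le> expectation (\<lambda>s. (k n)\<^sup>2)"
        using i2 b2 by (intro integral_mono) auto
      then show ?thesis by (simp add: prob_space)
    qed
    finally show ?case using Suc by simp
  qed simp
qed

end

text \<open>Kolmogorov's inequality, obtained by applying the second moment bound to the partial sums
  stopped when they first leave the \<open>\<epsilon>\<close>-band around their value at time \<open>m\<close>.\<close>

lemma (in orthogonal_increments) maximal_inequality_finite:
  assumes "\<epsilon> > 0" "m \<le> n"
  shows "prob {s \<in> space P. \<exists>j\<in>{m..n}. \<bar>(\<Sum>t<j. D t s) - (\<Sum>t<m. D t s)\<bar> > \<epsilon>}
    \<le> (\<Sum>t\<in>{m..<n}. (k t)\<^sup>2) / \<epsilon>\<^sup>2"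
proof -
  define S where "S j s = (\<Sum>t<j. D t s)" for j s
  \<comment> \<open>Indicator that \<open>m \<le> t\<close> and the band has not been left up to and
    including time \<open>t\<close>. It is measurable for \<open>Fi t\<close>, so multiplying
    \<open>D t\<close> by it keeps the increments orthogonal. As \<open>D t\<close> leads from
    \<open>S t\<close> to \<open>S (Suc t)\<close>, the stopped sum still contains the increment
    that leaves the band.\<close>
  define I where "I t s = (if m \<le> t \<and> (\<forall>j\<in>{m..t}. \<bar>S j s - S m s\<bar> \<le> \<epsilon>) then 1 else 0 :: real)" for t s
  define k' where "k' t = (if m \<le> t then k t else 0)" for t
  have S_meas: "S j \<in> borel_measurable (Fi t)" if "j \<le> t" for j t
    unfolding S_def by (rule Fi_mono[OF that sum_measurable])
  have I_meas: "I t \<in> borel_measurable (Fi t)" for t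
  proof (cases "m \<le> t")
    case True
    have 1: "{s \<in> space (Fi t). \<bar>S j s - S m s\<bar> \<le> \<epsilon>} \<in> sets (Fi t)" if "j \<in> {m..t}" for j
    proof -
      have [measurable]: "S j \<in> borel_measurable (Fi t)" "S m \<in> borel_measurable (Fi t)"
        using S_meas True that by auto
      show ?thesis by measurable
    qed
    have "{s \<in> space (Fi t). \<forall>j\<in>{m..t}. \<bar>S j s - S m s\<bar> \<le> \<epsilon>} \<in> sets (Fi t)"
      by (rule sets.sets_Collect_finite_All'[OF 1]) (use True in auto)
    then have "(\<lambda>s. if \<forall>j\<in>{m..t}. \<bar>S j s - S m s\<bar> \<le> \<epsilon> then 1 else 0 :: real) \<in> borel_measurable (Fi t)"
      by (intro measurable_If) auto
    then show ?thesis using True by (simp add: I_def[abs_def])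
  qed (simp add: I_def[abs_def])
  have I01: "I t s = 0 \<or> I t s = 1" for t s by (simp add: I_def)
  interpret Y: orthogonal_increments P Fi "\<lambda>t s. I t s * D t s" k'
  proof
    show "(\<lambda>s. I t s * D t s) \<in> borel_measurable (Fi (Suc t))" for t
      by (rule borel_measurable_times[OF Fi_mono[OF le_SucI[OF order_refl] I_meas] D_meas])
    show "\<bar>I t s * D t s\<bar> \<le> k' t" if "s \<in> space P" for t s
      using D_bound[OF that, of t] abs_ge_zero[of "D t s"] by (auto simp: I_def k'_def)
    fix t and Z :: "'s \<Rightarrow> real" and B assume Z: "Z \<in> borel_measurable (Fi t)" "\<And>s. s \<in> space P \<Longrightarrow> \<bar>Z s\<bar> \<le> B"
    have "expectation (\<lambda>s. (Z s * I t s) * D t s) = 0"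
    proof (rule orth)
      show "(\<lambda>s. Z s * I t s) \<in> borel_measurable (Fi t)" by (rule borel_measurable_times[OF Z(1) I_meas])
      show "\<bar>Z s * I t s\<bar> \<le> \<bar>B\<bar>" if "s \<in> space P" for s
        using Z(2)[OF that] I01[of t s] by auto
    qed
    then show "expectation (\<lambda>s. Z s * (I t s * D t s)) = 0" by (simp add: mult.assoc)
  qed (fact subalg mono)+
  let ?Q = "\<lambda>s. \<Sum>t<n. I t s * D t s"
  have Qm: "?Q \<in> borel_measurable P"
    by (rule measurable_from_subalg[OF subalg Y.sum_measurable])
  have "{s \<in> space P. \<exists>j\<in>{m..n}. \<bar>S j s - S m s\<bar> > \<epsilon>} \<subseteq> {s \<in> space P. \<bar>?Q s\<bar> \<ge> \<epsilon>}"
  proof safe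
    fix s j assume s: "s \<in> space P" and j: "j \<in> {m..n}" "\<epsilon> < \<bar>S j s - S m s\<bar>"
    define J where "J = (LEAST j. m \<le> j \<and> \<epsilon> < \<bar>S j s - S m s\<bar>)"
    have J: "m \<le> J" "\<epsilon> < \<bar>S J s - S m s\<bar>"
      unfolding J_def using LeastI[of "\<lambda>j. m \<le> j \<and> \<epsilon> < \<bar>S j s - S m s\<bar>" j] j by auto
    have "J \<le> j" unfolding J_def using j by (intro Least_le) auto
    then have "J \<le> n" using j by simp
    have before: "\<bar>S i s - S m s\<bar> \<le> \<epsilon>" if "m \<le> i" "i < J" for i
      using not_less_Least[of i "\<lambda>j. m \<le> j \<and> \<epsilon> < \<bar>S j s - S m s\<bar>"] that unfolding J_def by auto
    have I1: "I t s * D t s = (if t \<in> {m..<J} then D t s else 0)" for t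
    proof (cases "t \<in> {m..<J}")
      case True
      then show ?thesis using before by (auto simp: I_def)
    next
      case False
      then have "\<not> (m \<le> t \<and> (\<forall>j\<in>{m..t}. \<bar>S j s - S m s\<bar> \<le> \<epsilon>))"
        using J by (metis atLeastAtMost_iff atLeastLessThan_iff leD leI)
      then have I0: "I t s = 0" unfolding I_def by (rule if_not_P)
      show ?thesis unfolding I0 if_not_P[OF False] by simp
    qed
    have "?Q s = (\<Sum>t<n. if t \<in> {m..<J} then D t s else 0)" unfolding I1 ..
    also have "\<dots> = (\<Sum>t\<in>{..<n} \<inter> {m..<J}. D t s)" by (rule sum.inter_restrict[symmetric]) simp
    also have "{..<n} \<inter> {m..<J} = {m..<J}" using \<open>J \<le> n\<close> by auto
    also have "(\<Sum>t\<in>{m..<J}. D t s) = S J s - S m s"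
      unfolding S_def using J(1) sum_diff_nat_ivl[of 0 m J "\<lambda>t. D t s"] by (simp add: atLeast0LessThan)
    finally show "\<epsilon> \<le> \<bar>?Q s\<bar>" using J(2) by simp
  qed
  moreover have "{s \<in> space P. \<bar>?Q s\<bar> \<ge> \<epsilon>} \<in> events" using Qm by measurable
  ultimately have "prob {s \<in> space P. \<exists>j\<in>{m..n}. \<bar>S j s - S m s\<bar> > \<epsilon>} \<le> prob {s \<in> space P. \<bar>?Q s\<bar> \<ge> \<epsilon>}"
    by (rule finite_measure_mono)
  also have "\<dots> \<le> expectation (\<lambda>s. (?Q s)\<^sup>2) / \<epsilon>\<^sup>2"
    by (rule second_moment_method[OF Qm Y.sum_square(1) assms(1)])
  also have "\<dots> \<le> (\<Sum>t<n. (k' t)\<^sup>2) / \<epsilon>\<^sup>2"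
    by (intro divide_right_mono Y.sum_square) simp
  also have "(\<Sum>t<n. (k' t)\<^sup>2) = (\<Sum>t<n. if t \<in> {m..} then (k t)\<^sup>2 else 0)"
    by (intro sum.cong) (auto simp: k'_def)
  also have "\<dots> = (\<Sum>t\<in>{..<n} \<inter> {m..}. (k t)\<^sup>2)" by (rule sum.inter_restrict[symmetric]) simp
  also have "{..<n} \<inter> {m..} = {m..<n}" by auto
  finally show ?thesis unfolding S_def .
qed

text \<open>The tail \<open>r m\<close> controls the probability that the sums ever move by more
  than \<epsilon> after time \<open>m\<close>. That this happens for every \<open>m\<close> is
  therefore a null event. Excluding it for countably many \<epsilon> makes the sums Cauchy.\<close>

lemma (in orthogonal_increments) converges_AE:
  assumes sum: "summable (\<lambda>t. (k t)\<^sup>2)"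
  shows "AE s in P. convergent (\<lambda>n. \<Sum>t<n. D t s)"
proof -
  define S where "S j s = (\<Sum>t<j. D t s)" for j s
  have S_meas [measurable]: "S j \<in> borel_measurable P" for j
    unfolding S_def by (rule measurable_from_subalg[OF subalg sum_measurable])
  define r where "r m = (\<Sum>t. (k t)\<^sup>2) - (\<Sum>t<m. (k t)\<^sup>2)" for m
  have "r \<longlonglongrightarrow> (\<Sum>t. (k t)\<^sup>2) - (\<Sum>t. (k t)\<^sup>2)"
    unfolding r_def by (intro tendsto_diff tendsto_const summable_LIMSEQ sum)
  then have r: "r \<longlonglongrightarrow> 0" by simp
  have max: "prob {s \<in> space P. \<exists>j\<ge>m. \<bar>S j s - S m s\<bar> > \<epsilon>} \<le> r m / \<epsilon>\<^sup>2" if \<epsilon>: "\<epsilon> > 0" for m \<epsilon>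
  proof -
    let ?A = "\<lambda>n. {s \<in> space P. \<exists>j\<in>{m..n}. \<bar>S j s - S m s\<bar> > \<epsilon>}"
    have lim: "(\<lambda>n. prob (?A n)) \<longlonglongrightarrow> prob (\<Union>n. ?A n)"
    proof (rule finite_Lim_measure_incseq)
      have "?A n \<in> events" for n by measurable
      then show "range ?A \<subseteq> events" by blast
      show "incseq ?A" by (rule incseq_SucI) force
    qed
    have eq: "(\<Union>n. ?A n) = {s \<in> space P. \<exists>j\<ge>m. \<bar>S j s - S m s\<bar> > \<epsilon>}"
      by auto (meson atLeastAtMost_iff order_refl)
    have "prob (?A n) \<le> r m / \<epsilon>\<^sup>2" if "m \<le> n" for n
    proof -
      have "prob (?A n) \<le> (\<Sum>t\<in>{m..<n}. (k t)\<^sup>2) / \<epsilon>\<^sup>2"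
        unfolding S_def by (rule maximal_inequality_finite[OF \<epsilon> \<open>m \<le> n\<close>])
      also have "(\<Sum>t\<in>{m..<n}. (k t)\<^sup>2) = (\<Sum>t<n. (k t)\<^sup>2) - (\<Sum>t<m. (k t)\<^sup>2)"
        using \<open>m \<le> n\<close> sum_diff_nat_ivl[of 0 m n "\<lambda>t. (k t)\<^sup>2"] by (simp add: atLeast0LessThan)
      also have "\<dots> / \<epsilon>\<^sup>2 \<le> r m / \<epsilon>\<^sup>2"
        unfolding r_def using sum_le_suminf[OF sum, of "{..<n}"] by (intro divide_right_mono) auto
      finally show ?thesis .
    qed
    then show ?thesis by (intro LIMSEQ_le_const2[OF lim[unfolded eq]]) blast
  qed
  have "AE s in P. \<forall>i. \<exists>m. \<forall>j\<ge>m. \<bar>S j s - S m s\<bar> \<le> inverse (real (Suc i))"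
    unfolding AE_all_countable
  proof
    fix i
    let ?\<epsilon> = "inverse (real (Suc i))"
    let ?N = "{s \<in> space P. \<forall>m. \<exists>j\<ge>m. \<bar>S j s - S m s\<bar> > ?\<epsilon>}"
    have "prob ?N \<le> r m / ?\<epsilon>\<^sup>2" for m
    proof -
      have "{s \<in> space P. \<exists>j\<ge>m. \<bar>S j s - S m s\<bar> > ?\<epsilon>} \<in> events" by measurable
      then have "prob ?N \<le> prob {s \<in> space P. \<exists>j\<ge>m. \<bar>S j s - S m s\<bar> > ?\<epsilon>}"
        by (intro finite_measure_mono) auto
      also have "\<dots> \<le> r m / ?\<epsilon>\<^sup>2" by (rule max) simp
      finally show ?thesis .
    qed
    moreover have "(\<lambda>m. r m / ?\<epsilon>\<^sup>2) \<longlonglongrightarrow> 0 / ?\<epsilon>\<^sup>2" by (intro tendsto_divide r tendsto_const) simp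
    ultimately have "prob ?N \<le> 0 / ?\<epsilon>\<^sup>2" using LIMSEQ_le_const by blast
    then have "prob ?N \<le> 0" by simp
    then have "prob ?N = 0" by (rule antisym[OF _ measure_nonneg])
    moreover have "?N \<in> events" by measurable
    ultimately have "AE s in P. s \<notin> ?N" using prob_eq_0 by blast
    then show "AE s in P. \<exists>m. \<forall>j\<ge>m. \<bar>S j s - S m s\<bar> \<le> ?\<epsilon>"
      using AE_space by eventually_elim (simp add: not_less)
  qed
  then show ?thesis
  proof eventually_elim
    case (elim s)
    have "Cauchy (\<lambda>n. S n s)"
    proof (rule metric_CauchyI)
      fix e :: real assume "e > 0"
      then obtain i where i: "inverse (real (Suc i)) < e / 2" using reals_Archimedean[of "e / 2"] by auto
      obtain m where m: "\<And>j. j \<ge> m \<Longrightarrow> \<bar>S j s - S m s\<bar> \<le> inverse (real (Suc i))" using elim by blast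
      have "dist (S a s) (S b s) < e" if "a \<ge> m" "b \<ge> m" for a b
        using m[OF that(1)] m[OF that(2)] i unfolding dist_real_def by linarith
      then show "\<exists>M. \<forall>a\<ge>M. \<forall>b\<ge>M. dist (S a s) (S b s) < e" by blast
    qed
    then show ?case unfolding S_def by (simp add: Cauchy_convergent_iff)
  qed
qed

text \<open>Independence makes the joint law of the past and \<open>W\<close> a product measure. By
  Fubini the expectation can be computed by first averaging over \<omega> with the past frozen,
  which gives 0.\<close>

lemma (in prob_space) expectation_zero_indep:
  fixes h :: "'a \<times> 'w \<Rightarrow> real"
  assumes G: "subalgebra M G" and W[measurable]: "W \<in> measurable M N"
    and N: "prob_space N" "distr M N W = N"
    and indep: "\<And>A B. A \<in> sets G \<Longrightarrow> B \<in> sets N \<Longrightarrow>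
      prob (A \<inter> (W -` B \<inter> space M)) = prob A * prob (W -` B \<inter> space M)"
    and h[measurable]: "h \<in> borel_measurable (G \<Otimes>\<^sub>M N)"
    and int: "integrable M (\<lambda>s. h (s, W s))"
    and zero: "\<And>s. s \<in> space M \<Longrightarrow> (\<integral>\<omega>. h (s, \<omega>) \<partial>N) = 0"
  shows "expectation (\<lambda>s. h (s, W s)) = 0"
proof -
  have sp: "space G = space M" and sub: "sets G \<subseteq> sets M" using G by (auto simp: subalgebra_def)
  have id[measurable]: "(\<lambda>s. s) \<in> measurable M G" by (rule measurable_from_subalg[OF G]) simp
  \<comment> \<open>The restriction of the measure to the smaller sigma-algebra \<open>G\<close>,
    written as an image under the identity.\<close>
  define MG where "MG = distr M G (\<lambda>s. s)"
  have sMG: "sets MG = sets G" "space MG = space M" by (simp_all add: MG_def sp)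
  interpret MG: prob_space MG unfolding MG_def by (rule prob_space_distr[OF id])
  interpret N: prob_space N by (rule N(1))
  interpret MGN: pair_sigma_finite MG N ..
  have pm: "(\<lambda>s. (s, W s)) \<in> measurable M (G \<Otimes>\<^sub>M N)" by measurable
  have prod: "MG \<Otimes>\<^sub>M N = distr M (G \<Otimes>\<^sub>M N) (\<lambda>s. (s, W s))"
  proof (rule pair_measure_eqI)
    show "sigma_finite_measure MG" "sigma_finite_measure N" by unfold_locales
    show "sets (MG \<Otimes>\<^sub>M N) = sets (distr M (G \<Otimes>\<^sub>M N) (\<lambda>s. (s, W s)))"
      unfolding sets_distr by (rule sets_pair_measure_cong[OF sMG(1) refl])
    fix A B assume A: "A \<in> sets MG" and B: "B \<in> sets N"
    have A': "A \<in> sets G" "A \<subseteq> space M" using A sMG sets.sets_into_space[OF A] by auto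
    have "emeasure N B = emeasure (distr M N W) B" by (simp add: N(2))
    also have "\<dots> = emeasure M (W -` B \<inter> space M)" by (rule emeasure_distr[OF W B])
    finally have eB: "emeasure N B = prob (W -` B \<inter> space M)" by (simp add: emeasure_eq_measure)
    have "(\<lambda>s. s) -` A \<inter> space M = A" using A' by auto
    then have eA: "emeasure MG A = prob A"
      unfolding MG_def emeasure_distr[OF id A'(1)] by (simp add: emeasure_eq_measure)
    have "(\<lambda>s. (s, W s)) -` (A \<times> B) \<inter> space M = A \<inter> (W -` B \<inter> space M)" by auto
    then have "emeasure (distr M (G \<Otimes>\<^sub>M N) (\<lambda>s. (s, W s))) (A \<times> B) = prob (A \<inter> (W -` B \<inter> space M))"
      using emeasure_distr[OF pm pair_measureI[OF A'(1) B]] by (simp add: emeasure_eq_measure)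
    also have "\<dots> = emeasure MG A * emeasure N B"
      unfolding indep[OF A'(1) B] eA eB by (simp add: ennreal_mult)
    finally show "emeasure MG A * emeasure N B = emeasure (distr M (G \<Otimes>\<^sub>M N) (\<lambda>s. (s, W s))) (A \<times> B)" ..
  qed
  have "expectation (\<lambda>s. h (s, W s)) = integral\<^sup>L (distr M (G \<Otimes>\<^sub>M N) (\<lambda>s. (s, W s))) h"
    by (rule integral_distr[symmetric, OF pm h])
  also have "\<dots> = integral\<^sup>L (MG \<Otimes>\<^sub>M N) h" by (simp only: prod)
  also have "\<dots> = (\<integral>s. (\<integral>\<omega>. h (s, \<omega>) \<partial>N) \<partial>MG)"
  proof (rule MGN.integral_fst'[symmetric])
    show "integrable (MG \<Otimes>\<^sub>M N) h" unfolding prod using int by (subst integrable_distr_eq[OF pm h])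
  qed
  also have "\<dots> = (\<integral>s. 0 \<partial>MG)" by (intro Bochner_Integration.integral_cong refl zero) (simp add: sMG)
  finally show ?thesis by simp
qed

section \<open>Pathwise convergence\<close>

context random_objective
begin

abbreviation norm_grad_F :: "'a \<Rightarrow> real" where
  "norm_grad_F y \<equiv> gnorm g y (riem_grad \<A> g F y)"

lemma grad_F_square: "g y (riem_grad \<A> g F y) (riem_grad \<A> g F y) = (norm_grad_F y)\<^sup>2"
  by (simp add: gnorm_def g.nonneg)

text \<open>Testing the averaged gradient against \<open>riem_grad \<A> g F y\<close> itself bounds
  the square of its norm by \<open>G\<close> times its norm.\<close>

lemma norm_grad_F_le:
  assumes "\<And>\<omega>. \<omega> \<in> space \<mu> \<Longrightarrow> gnorm g y (grad_M \<A> g f y \<omega>) \<le> G"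
  shows "norm_grad_F y \<le> G"
proof -
  let ?n = "norm_grad_F y"
  have "\<bar>\<integral>\<omega>. g y (grad_M \<A> g f y \<omega>) (riem_grad \<A> g F y) \<partial>\<mu>\<bar> \<le> G * ?n"
  proof (rule abs_integral_le[OF integrable_grad_inner])
    show "\<bar>g y (grad_M \<A> g f y \<omega>) (riem_grad \<A> g F y)\<bar> \<le> G * ?n" if "\<omega> \<in> space \<mu>" for \<omega>
      by (rule order_trans[OF cauchy_schwarz mult_right_mono[OF assms[OF that] gnorm_nonneg]])
  qed
  then have "?n * ?n \<le> G * ?n"
    unfolding grad_F[symmetric] grad_F_square by (simp add: power2_eq_square)
  moreover obtain \<omega> where "\<omega> \<in> space \<mu>" using not_empty by blast
  then have "G \<ge> 0" using assms gnorm_nonneg order_trans by blast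
  ultimately show ?thesis using gnorm_nonneg[of y "riem_grad \<A> g F y"]
    by (metis mult_right_le_imp_le order_le_less)
qed

text \<open>If the gradient norm did not tend to \<open>0\<close>, it would climb from below \<open>\<epsilon>\<close> to above
  \<open>2 * \<epsilon>\<close> infinitely often, over time intervals of vanishing total step size. The iterates barely move
  on these intervals, so both ends accumulate at a common point, where the gradient norm is continuous.\<close>

lemma norm_grad_F_tendsto_0:
  fixes X :: "nat \<Rightarrow> 'a" and v :: "nat \<Rightarrow> 'e"
  assumes K: "compact K" "\<And>t. X t \<in> K"
    and step: "\<And>t. X (Suc t) = R (X t) (v t)" and v: "\<And>t. gnorm g (X t) (v t) \<le> B * c t"
    and c: "\<And>t. c t > 0" "c \<longlonglongrightarrow> 0"
    and div: "filterlim (\<lambda>n. \<Sum>t<n. c t) at_top sequentially"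
    and sum: "summable (\<lambda>t. c t * (norm_grad_F (X t))\<^sup>2)"
  shows "(\<lambda>t. norm_grad_F (X t)) \<longlonglongrightarrow> 0"
proof (rule ccontr)
  assume not: "\<not> ?thesis"
  obtain \<epsilon> where \<epsilon>: "\<epsilon> > 0" "\<And>\<delta> k. \<delta> > 0 \<Longrightarrow> \<exists>s\<ge>k. \<exists>e\<ge>s. norm_grad_F (X s) < \<epsilon> \<and>
      norm_grad_F (X e) > 2 * \<epsilon> \<and> (\<Sum>t\<in>{s..<e}. c t) < \<delta>"
    by (rule upcrossing_intervals[OF c gnorm_nonneg div sum not]) blast
  have "\<forall>k. \<exists>se. k \<le> fst se \<and> fst se \<le> snd se \<and> norm_grad_F (X (fst se)) < \<epsilon> \<and>
      norm_grad_F (X (snd se)) > 2 * \<epsilon> \<and> (\<Sum>t\<in>{fst se..<snd se}. c t) < inverse (real (Suc k))"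
    using \<epsilon>(2)[of "inverse (real (Suc k))" k for k] by (metis fst_conv snd_conv inverse_positive_iff_positive of_nat_0_less_iff zero_less_Suc)
  from choice[OF this] obtain se where se: "\<And>k. k \<le> fst (se k) \<and> fst (se k) \<le> snd (se k) \<and>
      norm_grad_F (X (fst (se k))) < \<epsilon> \<and> norm_grad_F (X (snd (se k))) > 2 * \<epsilon> \<and>
      (\<Sum>t\<in>{fst (se k)..<snd (se k)}. c t) < inverse (real (Suc k))"
    by blast
  have "\<forall>k. X (fst (se k)) \<in> K" using K(2) by simp
  then obtain l q where l: "l \<in> K" "strict_mono q" "((\<lambda>k. X (fst (se k))) \<circ> q) \<longlonglongrightarrow> l"
    by (rule seq_compactE[OF compact_imp_seq_compact[OF K(1)]])
  note l = l(1,2) l(3)[unfolded comp_def]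
  define \<kappa> where "\<kappa> = chart_at \<A> l"
  define p where "p = chart_map \<kappa> l"
  have \<kappa>: "\<kappa> \<in> \<A>" "l \<in> chart_dom \<kappa>" using chart_at by (simp_all add: \<kappa>_def)
  obtain r L where r: "r > 0" "L > 0" "ball p r \<subseteq> chart_img \<kappa>"
    "\<And>y v. y \<in> chart_dom \<kappa> \<Longrightarrow> chart_map \<kappa> y \<in> ball p r \<Longrightarrow> gnorm g y v < r \<Longrightarrow>
      R y v \<in> chart_dom \<kappa> \<and> norm (chart_map \<kappa> (R y v) - chart_map \<kappa> y) \<le> L * gnorm g y v"
    using local_step[of l] unfolding \<kappa>_def p_def by metis
  have p_img: "p \<in> chart_img \<kappa>" using \<kappa>(2) by (simp add: p_def)
  have inv_p: "chart_inv \<kappa> p = l" unfolding p_def by (rule chart_inv_map[OF \<kappa>])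
  have "isCont (chart_inv \<kappa>) p"
    using continuous_chart_inv[OF \<kappa>(1)] continuous_on_eq_continuous_at[OF open_chart_img[OF \<kappa>(1)]] p_img by blast
  then have "isCont (\<lambda>z. norm_grad_F (chart_inv \<kappa> z)) p"
    by (rule isCont_o2[where g = norm_grad_F]) (simp add: inv_p isCont_norm_grad_F)
  then obtain r1 where r1: "r1 > 0"
    "\<And>z. dist z p < r1 \<Longrightarrow> dist (norm_grad_F (chart_inv \<kappa> z)) (norm_grad_F l) < \<epsilon> / 2"
    unfolding continuous_at_eps_delta inv_p using \<epsilon>(1) by (metis half_gt_zero)
  define r2 where "r2 = min r r1"
  have r2: "r2 > 0" using r r1 by (simp add: r2_def)
  have near: "\<bar>norm_grad_F y - norm_grad_F l\<bar> < \<epsilon> / 2" if "y \<in> chart_dom \<kappa>" "norm (chart_map \<kappa> y - p) < r2" for y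
    using r1(2)[of "chart_map \<kappa> y"] that by (simp add: chart_inv_map[OF \<kappa>(1)] r2_def dist_norm)
  \<comment> \<open>The sign of \<open>B\<close> is left open; \<open>B'\<close> is a positive
    substitute by which one may divide.\<close>
  define B' where "B' = \<bar>B\<bar> + 1"
  have B': "B' > 0" by (simp add: B'_def)
  have v': "gnorm g (X t) (v t) \<le> B' * c t" for t
    by (rule order_trans[OF v mult_right_mono]) (use c(1)[of t] in \<open>auto simp: B'_def less_imp_le\<close>)
  have "\<forall>\<^sub>F t in sequentially. c t < r / B'" using order_tendstoD(2)[OF c(2)] r B' by simp
  then obtain T where T: "\<And>t. t \<ge> T \<Longrightarrow> c t < r / B'" unfolding eventually_sequentially by blast
  \<comment> \<open>From time \<open>T\<close> on, steps are shorter than \<open>r\<close> and move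
    the coordinates by at most \<open>L * B' * c t\<close>. While the total displacement stays
    within the budget \<open>r2\<close>, the iterate remains in the region where
    \<open>local_step\<close> applies, which carries the induction.\<close>
  have stay: "X j \<in> chart_dom \<kappa> \<and> norm (chart_map \<kappa> (X j) - p) < r2 / 2 + L * B' * (\<Sum>t\<in>{s..<j}. c t)"
    if "s \<ge> T" "X s \<in> chart_dom \<kappa>" "norm (chart_map \<kappa> (X s) - p) < r2 / 2"
      "L * B' * (\<Sum>t\<in>{s..<e}. c t) \<le> r2 / 2" "s \<le> j" "j \<le> e" for s e j
    using \<open>s \<le> j\<close> \<open>j \<le> e\<close>
  proof (induction j rule: dec_induct)
    case base
    then show ?case using that by simp
  next
    case (step j)
    then have IH: "X j \<in> chart_dom \<kappa>" "norm (chart_map \<kappa> (X j) - p) < r2 / 2 + L * B' * (\<Sum>t\<in>{s..<j}. c t)"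
      by auto
    have "(\<Sum>t\<in>{s..<j}. c t) \<le> (\<Sum>t\<in>{s..<e}. c t)"
      using step.prems c(1) by (intro sum_mono2) (auto simp: less_imp_le)
    then have "L * B' * (\<Sum>t\<in>{s..<j}. c t) \<le> r2 / 2"
      using mult_left_mono[of _ _ "L * B'"] r(2) B' that(4) by (smt (verit, best) mult_pos_pos)
    then have "norm (chart_map \<kappa> (X j) - p) < r" using IH(2) r2_def by linarith
    moreover have "gnorm g (X j) (v j) < r"
    proof -
      have "B' * c j < r" using T[of j] step.hyps that(1) B' by (simp add: field_simps)
      then show ?thesis using v'[of j] by linarith
    qed
    ultimately have *: "X (Suc j) \<in> chart_dom \<kappa>"
        "norm (chart_map \<kappa> (X (Suc j)) - chart_map \<kappa> (X j)) \<le> L * gnorm g (X j) (v j)"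
      using r(4)[OF IH(1), of "v j"] by (simp_all add: assms(3) dist_norm norm_minus_commute)
    have "L * gnorm g (X j) (v j) \<le> L * (B' * c j)" using v'[of j] r(2) by simp
    moreover have "norm (chart_map \<kappa> (X (Suc j)) - p)
        \<le> norm (chart_map \<kappa> (X (Suc j)) - chart_map \<kappa> (X j)) + norm (chart_map \<kappa> (X j) - p)"
      by norm
    moreover have "(\<Sum>t\<in>{s..<Suc j}. c t) = (\<Sum>t\<in>{s..<j}. c t) + c j" using step.hyps by simp
    ultimately have "norm (chart_map \<kappa> (X (Suc j)) - p) < r2 / 2 + L * B' * (\<Sum>t\<in>{s..<Suc j}. c t)"
      using *(2) IH(2) by (simp add: distrib_left mult.assoc)
    then show ?case using *(1) by simp
  qed
  have "isCont (chart_map \<kappa>) l"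
    using continuous_chart_map[OF \<kappa>(1)] continuous_on_eq_continuous_at[OF open_chart_dom[OF \<kappa>(1)]] \<kappa>(2) by blast
  then have "(\<lambda>k. chart_map \<kappa> (X (fst (se (q k))))) \<longlonglongrightarrow> p"
    unfolding p_def using l(3) by (rule isCont_tendsto_compose)
  then have "(\<lambda>k. norm (chart_map \<kappa> (X (fst (se (q k)))) - p)) \<longlonglongrightarrow> 0"
    by (intro tendsto_norm_zero LIM_zero)
  then have "\<forall>\<^sub>F k in sequentially. norm (chart_map \<kappa> (X (fst (se (q k)))) - p) < r2 / 2"
    using order_tendstoD(2) r2 half_gt_zero by blast
  moreover have "\<forall>\<^sub>F k in sequentially. X (fst (se (q k))) \<in> chart_dom \<kappa>"
    using topological_tendstoD[OF l(3) open_chart_dom[OF \<kappa>(1)] \<kappa>(2)] .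
  moreover have "\<forall>\<^sub>F k in sequentially. inverse (real (Suc k)) < r2 / 2 / (L * B')"
    using order_tendstoD(2)[OF LIMSEQ_inverse_real_of_nat] r2 r(2) B' by simp
  moreover have "\<forall>\<^sub>F k in sequentially. k \<ge> T" by (rule eventually_ge_at_top)
  ultimately have "\<forall>\<^sub>F k in sequentially. norm (chart_map \<kappa> (X (fst (se (q k)))) - p) < r2 / 2 \<and>
      X (fst (se (q k))) \<in> chart_dom \<kappa> \<and> inverse (real (Suc k)) < r2 / 2 / (L * B') \<and> k \<ge> T"
    by eventually_elim blast
  then obtain k where k: "norm (chart_map \<kappa> (X (fst (se (q k)))) - p) < r2 / 2"
      "X (fst (se (q k))) \<in> chart_dom \<kappa>" "inverse (real (Suc k)) < r2 / 2 / (L * B')" "k \<ge> T"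
    using eventually_happens'[OF sequentially_bot] by blast
  define s e where "s = fst (se (q k))" and "e = snd (se (q k))"
  have qk: "q k \<ge> k" using l(2) by (rule seq_suble)
  have se': "q k \<le> s" "s \<le> e" "norm_grad_F (X s) < \<epsilon>" "norm_grad_F (X e) > 2 * \<epsilon>"
    "(\<Sum>t\<in>{s..<e}. c t) < inverse (real (Suc (q k)))"
    using se[of "q k"] by (simp_all add: s_def e_def)
  have "inverse (real (Suc (q k))) \<le> inverse (real (Suc k))" using qk by (intro le_imp_inverse_le) auto
  then have "(\<Sum>t\<in>{s..<e}. c t) < r2 / 2 / (L * B')" using se'(5) k(3) by linarith
  then have small: "L * B' * (\<Sum>t\<in>{s..<e}. c t) \<le> r2 / 2"
    using r(2) B' by (simp add: field_simps)
  have "s \<ge> T" using k(4) qk se'(1) by linarith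
  note st = stay[OF this k(2,1)[folded s_def] small se'(2) order_refl]
  have "\<bar>norm_grad_F (X e) - norm_grad_F l\<bar> < \<epsilon> / 2" using st small by (intro near) auto
  moreover have "\<bar>norm_grad_F (X s) - norm_grad_F l\<bar> < \<epsilon> / 2"
    using k(1,2) r2 by (intro near) (auto simp: s_def)
  ultimately show False using se'(3,4) by linarith
qed

lemma stationary_limit:
  assumes "X \<longlonglongrightarrow> l" "(\<lambda>t. norm_grad_F (X t)) \<longlonglongrightarrow> 0"
  shows "stationary_point \<A> g F l"
proof -
  have "(\<lambda>t. norm_grad_F (X t)) \<longlonglongrightarrow> norm_grad_F l"
    by (rule isCont_tendsto_compose[OF isCont_norm_grad_F assms(1)])
  then have "norm_grad_F l = 0" using assms(2) LIMSEQ_unique by blast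
  then have "riem_grad \<A> g F l = 0" unfolding gnorm_def by (simp add: g.eq_0_iff)
  then show ?thesis by (simp add: stationary_point_def F_mdifferentiable)
qed

text \<open>The deviation of the sampled slope along \<open>riem_grad \<A> g F y\<close> from its
  mean, which by \<open>grad_F\<close> is the squared gradient norm of \<open>F\<close>.\<close>

definition noise :: "'a \<Rightarrow> 'w \<Rightarrow> real" where
  "noise y \<omega> = g y (grad_M \<A> g f y \<omega>) (riem_grad \<A> g F y) - g y (riem_grad \<A> g F y) (riem_grad \<A> g F y)"

lemma noise_mean: "(\<integral>\<omega>. noise y \<omega> \<partial>\<mu>) = 0"
  unfolding noise_def by (simp add: integrable_grad_inner grad_F[symmetric] prob_space)

lemma noise_bound:
  assumes "\<And>\<omega>. \<omega> \<in> space \<mu> \<Longrightarrow> gnorm g y (grad_M \<A> g f y \<omega>) \<le> G" "\<omega> \<in> space \<mu>"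
  shows "\<bar>noise y \<omega>\<bar> \<le> 2 * G\<^sup>2"
proof -
  note n = norm_grad_F_le[OF assms(1)] gnorm_nonneg[of y "riem_grad \<A> g F y"]
  have G: "G \<ge> 0" using n by linarith
  have "\<bar>g y (grad_M \<A> g f y \<omega>) (riem_grad \<A> g F y)\<bar> \<le> G * G"
    by (rule order_trans[OF cauchy_schwarz mult_mono[OF assms(1)[OF assms(2)] n(1) G n(2)]])
  moreover have "\<bar>g y (riem_grad \<A> g F y) (riem_grad \<A> g F y)\<bar> \<le> G * G"
    by (rule order_trans[OF cauchy_schwarz mult_mono[OF n(1) n(1) G n(2)]])
  ultimately show ?thesis unfolding noise_def power2_eq_square by linarith
qed

text \<open>The deterministic argument along one sample path. The distribution of the samples enters
  only through the assumption \<open>noise\<close>, the convergence of the weighted noise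
  series.\<close>

lemma pathwise_convergence:
  fixes X :: "nat \<Rightarrow> 'a"
  assumes K: "compact K" "\<And>t. X t \<in> K" and \<omega>: "\<And>t. \<omega> t \<in> space \<mu>"
    and c: "\<And>t. c t > 0" and div: "filterlim (\<lambda>n. \<Sum>t<n. c t) at_top sequentially"
    and sq: "summable (\<lambda>t. (c t)\<^sup>2)"
    and \<phi>: "\<Phi>min > 0" "\<And>t. \<Phi>min \<le> \<phi> t" "\<And>t. \<phi> t \<le> \<Phi>max"
    and step: "\<And>t. X (Suc t) = R (X t) (- (c t / \<phi> t) *\<^sub>R grad_M \<A> g f (X t) (\<omega> t))"
    and noise: "convergent (\<lambda>n. \<Sum>t<n. c t / \<phi> t * noise (X t) (\<omega> t))"
  shows "convergent (\<lambda>t. F (X t))" "(\<lambda>t. norm_grad_F (X t)) \<longlonglongrightarrow> 0"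
proof -
  obtain G where G: "G > 0" "\<And>x \<omega>. x \<in> K \<Longrightarrow> \<omega> \<in> space \<mu> \<Longrightarrow> gnorm g x (grad_M \<A> g f x \<omega>) \<le> G"
    using grad_bound[OF K(1)] by metis
  have c0: "c \<longlonglongrightarrow> 0"
    using tendsto_real_sqrt[OF summable_LIMSEQ_zero[OF sq]] c by (simp add: abs_of_pos)
  then have "Bseq c" by (intro convergent_imp_Bseq convergentI)
  then obtain cm where cm: "cm > 0" "\<And>t. c t \<le> cm" unfolding Bseq_def by (metis abs_le_D1 real_norm_def)
  define B where "B = G / \<Phi>min"
  have B: "B > 0" using G \<phi> by (simp add: B_def)
  define v where "v t = - (c t / \<phi> t) *\<^sub>R grad_M \<A> g f (X t) (\<omega> t)" for t
  have pos: "\<phi> t > 0" for t using \<phi>(1) \<phi>(2)[of t] by linarith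
  have v: "gnorm g (X t) (v t) \<le> B * c t" for t
  proof -
    have "gnorm g (X t) (v t) = c t / \<phi> t * gnorm g (X t) (grad_M \<A> g f (X t) (\<omega> t))"
      unfolding v_def gnorm_scaleR using c[of t] pos[of t] by simp
    also have "\<dots> \<le> c t / \<Phi>min * G"
      using c[of t] \<phi> G(2)[OF K(2)[of t] \<omega>[of t]] gnorm_nonneg pos[of t]
      by (intro mult_mono divide_left_mono) (auto simp: less_imp_le)
    finally show ?thesis by (simp add: B_def mult.commute)
  qed
  \<comment> \<open>\<open>B * cm\<close> bounds the length of all steps, so one constant
    \<open>C\<close> from \<open>F_expansion\<close> serves all times.\<close>
  have "B * cm > 0" using B cm by simp
  from F_expansion[OF K(1) this] obtain C where C: "C > 0" "\<And>x v. x \<in> K \<Longrightarrow> gnorm g x v \<le> B * cm \<Longrightarrow>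
    F (R x v) \<le> F x + g x (riem_grad \<A> g F x) v + C * (gnorm g x v)\<^sup>2" by metis
  define u where "u t = F (X t)" for t
  define p where "p t = c t / \<phi> t * (norm_grad_F (X t))\<^sup>2" for t
  \<comment> \<open>The two deviations from exact descent: the noise, and the second-order
    remainder, which is summable because the step lengths are at most
    \<open>B * c t\<close>.\<close>
  define e where "e t = - (c t / \<phi> t * noise (X t) (\<omega> t)) + C * B\<^sup>2 * (c t)\<^sup>2" for t
  have descent: "u (Suc t) \<le> u t - p t + e t" for t
  proof -
    have "gnorm g (X t) (v t) \<le> B * cm"
      by (rule order_trans[OF v mult_left_mono[OF cm(2)]]) (use B in simp)
    then have "u (Suc t) \<le> u t + g (X t) (riem_grad \<A> g F (X t)) (v t) + C * (gnorm g (X t) (v t))\<^sup>2"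
      unfolding u_def step v_def[symmetric] by (intro C(2) K)
    moreover have "C * (gnorm g (X t) (v t))\<^sup>2 \<le> C * (B * c t)\<^sup>2"
      using C(1) v[of t] gnorm_nonneg by (intro mult_left_mono power_mono) auto
    moreover have "g (X t) (riem_grad \<A> g F (X t)) (v t) = - (c t / \<phi> t) * (noise (X t) (\<omega> t) + (norm_grad_F (X t))\<^sup>2)"
      unfolding v_def noise_def grad_F_square[symmetric]
      by (simp add: g.simps g.sym[of "X t" "riem_grad \<A> g F (X t)" "grad_M \<A> g f (X t) (\<omega> t)"])
    ultimately show ?thesis by (simp add: p_def e_def power_mult_distrib algebra_simps)
  qed
  have p0: "p t \<ge> 0" for t using c[of t] pos[of t] by (simp add: p_def)
  have "convergent (\<lambda>n. \<Sum>t<n. e t)"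
  proof -
    have "convergent (\<lambda>n. - (\<Sum>t<n. c t / \<phi> t * noise (X t) (\<omega> t)))" by (rule convergent_minus_iff[THEN iffD1, OF noise])
    moreover have "convergent (\<lambda>n. \<Sum>t<n. C * B\<^sup>2 * (c t)\<^sup>2)"
      by (rule summable_iff_convergent[THEN iffD1, OF summable_mult[OF sq]])
    ultimately have "convergent (\<lambda>n. - (\<Sum>t<n. c t / \<phi> t * noise (X t) (\<omega> t)) + (\<Sum>t<n. C * B\<^sup>2 * (c t)\<^sup>2))"
      by (rule convergent_add)
    then show ?thesis by (simp only: e_def[abs_def] sum.distrib sum_negf)
  qed
  moreover obtain N where N: "\<And>x \<omega>. x \<in> K \<Longrightarrow> \<omega> \<in> space \<mu> \<Longrightarrow> \<bar>f x \<omega>\<bar> \<le> N"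
    using f_bound[OF K(1)] by metis
  have "u t \<ge> - N" for t
    using abs_integral_le[OF f_integrable N[OF K(2)], of t] unfolding u_def F_def by linarith
  ultimately have conv: "convergent u" "summable p"
    using nonneg_descent_converges[where u=u and p=p and e=e and B="- N"] descent p0 by blast+
  from conv(1) show "convergent (\<lambda>t. F (X t))" by (simp add: u_def[abs_def])
  have "summable (\<lambda>t. c t * (norm_grad_F (X t))\<^sup>2)"
  proof (rule summable_comparison_test'[OF summable_mult[OF conv(2), of \<Phi>max]])
    fix t
    have "c t * (norm_grad_F (X t))\<^sup>2 = \<phi> t * p t" using pos[of t] by (simp add: p_def)
    also have "\<dots> \<le> \<Phi>max * p t" using \<phi>(3) p0 by (rule mult_right_mono)
    finally show "norm (c t * (norm_grad_F (X t))\<^sup>2) \<le> \<Phi>max * p t" using c[of t] by (simp add: less_imp_le)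
  qed
  then show "(\<lambda>t. norm_grad_F (X t)) \<longlonglongrightarrow> 0"
    by (intro norm_grad_F_tendsto_0[OF K _ v c c0 div]) (simp_all add: step v_def)
qed

end

section \<open>The filtration generated by the samples and step sizes\<close>

locale stochastic_descent = random_objective \<A> g R \<mu> f + P: prob_space P
  for \<A> :: "('a::{t2_space, second_countable_topology}, 'e::euclidean_space) chart set"
    and g :: "'a \<Rightarrow> 'e \<Rightarrow> 'e \<Rightarrow> real" and R :: "'a \<Rightarrow> 'e \<Rightarrow> 'a"
    and \<mu> :: "'w measure" and f :: "'a \<Rightarrow> 'w \<Rightarrow> real" and P :: "'s measure" +
  fixes w :: "nat \<Rightarrow> 's \<Rightarrow> 'w" and \<phi> :: "nat \<Rightarrow> 's \<Rightarrow> real" and x :: "nat \<Rightarrow> 's \<Rightarrow> 'a"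
    and c :: "nat \<Rightarrow> real" and x0 :: 'a and K :: "'a set" and \<Phi>min \<Phi>max :: real
  assumes compact_K: "compact K" and x_in_K: "\<And>t s. s \<in> space P \<Longrightarrow> x t s \<in> K"
    and x_start: "\<And>s. s \<in> space P \<Longrightarrow> x 0 s = x0"
    and x_step: "\<And>t s. s \<in> space P \<Longrightarrow>
      x (Suc t) s = R (x t s) (- (c t / \<phi> t s) *\<^sub>R grad_M \<A> g f (x t s) (w t s))"
    and w_distr: "\<And>t. distr P \<mu> (w t) = \<mu>"
    and independence: "\<And>t. nonanticipating P \<mu> w \<phi> t"
    and \<Phi>min_pos: "\<Phi>min > 0"
    and \<phi>_bounds: "\<And>t s. s \<in> space P \<Longrightarrow> \<Phi>min \<le> \<phi> t s \<and> \<phi> t s \<le> \<Phi>max"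
    and c_pos: "\<And>t. c t > 0" and c_square_sum: "summable (\<lambda>t. (c t)\<^sup>2)"
begin

definition history_space :: "nat \<Rightarrow> ((nat \<Rightarrow> 'w) \<times> (nat \<Rightarrow> real)) measure" where
  "history_space t = PiM {..<t} (\<lambda>_. \<mu>) \<Otimes>\<^sub>M PiM {..t} (\<lambda>_. borel)"

text \<open>The index sets differ by one: \<open>\<phi> t\<close> is fixed before the sample
  \<open>w t\<close> is drawn, so the factor \<open>c t / \<phi> t\<close> of the noise at time
  \<open>t\<close> belongs to the past.\<close>

definition history :: "nat \<Rightarrow> 's \<Rightarrow> (nat \<Rightarrow> 'w) \<times> (nat \<Rightarrow> real)" where
  "history t s = (\<lambda>i\<in>{..<t}. w i s, \<lambda>i\<in>{..t}. \<phi> i s)"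

definition past :: "nat \<Rightarrow> 's measure" where
  "past t = vimage_algebra (space P) (history t) (history_space t)"

lemma history_measurable: "history t \<in> measurable P (history_space t)"
  and future_measurable: "(\<lambda>s. \<lambda>i\<in>{t..}. w i s) \<in> measurable P (PiM {t..} (\<lambda>_. \<mu>))"
  using independence[of t]
  by (simp_all add: nonanticipating_def indep_rv_def history_def[abs_def] history_space_def)

lemma space_past: "space (past t) = space P"
  by (simp add: past_def)

lemma history_past: "history t \<in> measurable (past t) (history_space t)"
  unfolding past_def using measurable_space[OF history_measurable]
  by (intro measurable_vimage_algebra1) auto

lemma subalgebra_past: "subalgebra P (past t)"
  unfolding subalgebra_def past_def
  using sets_image_in_sets[OF refl history_measurable] by simp

lemma w_past: "i < t \<Longrightarrow> w i \<in> measurable (past t) \<mu>"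
proof -
  assume i: "i < t"
  have "(\<lambda>h. fst h i) \<in> measurable (history_space t) \<mu>"
    unfolding history_space_def using i
    by (intro measurable_compose[OF measurable_fst measurable_component_singleton]) auto
  from measurable_compose[OF history_past this] i show ?thesis by (simp add: history_def)
qed

lemma \<phi>_past: "i \<le> t \<Longrightarrow> \<phi> i \<in> borel_measurable (past t)"
proof -
  assume i: "i \<le> t"
  have "(\<lambda>h. snd h i) \<in> measurable (history_space t) borel"
    unfolding history_space_def using i
    by (intro measurable_compose[OF measurable_snd measurable_component_singleton]) auto
  from measurable_compose[OF history_past this] i show ?thesis by (simp add: history_def)
qed

lemma sets_past_Suc: "sets (past t) \<subseteq> sets (past (Suc t))"
proof -
  have "history t \<in> measurable (past (Suc t)) (history_space t)"
    unfolding history_def[abs_def] history_space_def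
    by (intro measurable_Pair measurable_restrict w_past \<phi>_past) auto
  from sets_image_in_sets[OF space_past this] show ?thesis unfolding past_def[of t] .
qed

lemma past_mono: "h \<in> measurable (past t) N \<Longrightarrow> h \<in> measurable (past (Suc t)) N"
  using sets_past_Suc by (intro measurable_from_subalg[of "past (Suc t)" "past t"])
    (simp_all add: subalgebra_def space_past)

lemma f_measurable: "f y \<in> borel_measurable \<mu>"
  using f_random by (simp add: random_function_def)

text \<open>Induction along the recursion: the step to \<open>x (Suc t)\<close> involves only
  \<open>x t\<close>, \<open>w t\<close> and \<open>\<phi> t\<close>, all known at time
  \<open>Suc t\<close>.\<close>

lemma x_past: "x t \<in> measurable (past t) borel"
proof (induction t)
  case 0
  have "(\<lambda>s. x0) \<in> measurable (past 0) borel" by simp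
  then show ?case by (rule measurable_cong[THEN iffD1, rotated]) (simp add: space_past x_start)
next
  case (Suc t)
  have a: "(\<lambda>s. - (c t / \<phi> t s)) \<in> borel_measurable (past (Suc t))"
    using \<phi>_past[of t "Suc t"] by simp
  have "(\<lambda>s. R (x t s) (- (c t / \<phi> t s) *\<^sub>R riem_grad \<A> g (\<lambda>y. f y (w t s)) (x t s)))
      \<in> measurable (past (Suc t)) borel"
    by (rule step_measurable[OF f_mdifferentiable f_measurable past_mono[OF Suc] w_past a]) simp_all
  then show ?case
    by (rule measurable_cong[THEN iffD1, rotated]) (simp add: space_past x_step grad_M_def)
qed

lemma w_measurable: "w t \<in> measurable P \<mu>"
  by (rule measurable_from_subalg[OF subalgebra_past w_past[of t "Suc t"]]) simp

lemma past_indep: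
  assumes "A \<in> sets (past t)" "B \<in> sets \<mu>"
  shows "P.prob (A \<inter> (w t -` B \<inter> space P)) = P.prob A * P.prob (w t -` B \<inter> space P)"
proof -
  have "history t \<in> space P \<rightarrow> space (history_space t)" using measurable_space[OF history_measurable] by auto
  then obtain A' where A': "A' \<in> sets (history_space t)" "A = history t -` A' \<inter> space P"
    using assms(1) unfolding past_def by (auto simp: sets_vimage_algebra2)
  \<comment> \<open>The event that \<open>w t\<close> lies in \<open>B\<close>, seen as a cylinder
    over the first coordinate of the future block.\<close>
  define B' where "B' = (\<lambda>h. h t) -` B \<inter> space (PiM {t..} (\<lambda>_. \<mu>))"
  have B': "B' \<in> sets (PiM {t..} (\<lambda>_. \<mu>))"
    unfolding B'_def using assms(2) by (intro measurable_sets[OF measurable_component_singleton]) auto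
  have eq: "(\<lambda>s. \<lambda>i\<in>{t..}. w i s) -` B' \<inter> space P = w t -` B \<inter> space P"
    using measurable_space[OF future_measurable[of t]] by (auto simp: B'_def)
  have "P.indep_set {history t -` A \<inter> space P | A. A \<in> sets (history_space t)}
      {(\<lambda>s. \<lambda>i\<in>{t..}. w i s) -` A \<inter> space P | A. A \<in> sets (PiM {t..} (\<lambda>_. \<mu>))}"
    using independence[of t]
    by (simp add: nonanticipating_def indep_rv_def history_def[abs_def] history_space_def)
  from P.indep_setD[OF this, of A "w t -` B \<inter> space P"] A' B' eq show ?thesis by blast
qed

lemma noise_measurable:
  assumes "Y \<in> measurable N borel" "W \<in> measurable N \<mu>"
  shows "(\<lambda>s. noise (Y s) (W s)) \<in> borel_measurable N"
proof -
  have F1: "mdifferentiable_at \<A> (\<lambda>y. F y) y" for y using F_mdifferentiable by simp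
  have F2: "(\<lambda>\<omega>. F y) \<in> borel_measurable \<mu>" for y by simp
  have 1: "(\<lambda>s. g (Y s) (riem_grad \<A> g (\<lambda>y. f y (W s)) (Y s)) (riem_grad \<A> g (\<lambda>y. F y) (Y s))) \<in> borel_measurable N"
    by (rule grad_inner_measurable[where ?h2.0="\<lambda>y \<omega>. F y", OF f_mdifferentiable f_measurable F1 F2 assms])
  have 2: "(\<lambda>s. g (Y s) (riem_grad \<A> g (\<lambda>y. F y) (Y s)) (riem_grad \<A> g (\<lambda>y. F y) (Y s))) \<in> borel_measurable N"
    by (rule grad_inner_measurable[where ?h1.0="\<lambda>y \<omega>. F y" and ?h2.0="\<lambda>y \<omega>. F y", OF F1 F2 F1 F2 assms])
  show ?thesis unfolding noise_def grad_M_def by (rule borel_measurable_diff[OF 1 2])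
qed

lemma noise_sums_converge:
  "AE s in P. convergent (\<lambda>n. \<Sum>t<n. c t / \<phi> t s * noise (x t s) (w t s))"
proof -
  obtain G where G: "G > 0" "\<And>x \<omega>. x \<in> K \<Longrightarrow> \<omega> \<in> space \<mu> \<Longrightarrow> gnorm g x (grad_M \<A> g f x \<omega>) \<le> G"
    using grad_bound[OF compact_K] by metis
  define C where "C = 2 * G\<^sup>2 / \<Phi>min"
  have bound: "\<bar>c t / \<phi> t s * noise (x t s) (w t s)\<bar> \<le> C * c t" if s: "s \<in> space P" for t s
  proof -
    have pos: "\<phi> t s > 0" "\<Phi>min \<le> \<phi> t s" using \<phi>_bounds[OF s, of t] \<Phi>min_pos by linarith+
    have "\<bar>noise (x t s) (w t s)\<bar> \<le> 2 * G\<^sup>2"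
      using x_in_K[OF s] measurable_space[OF w_measurable s] by (intro noise_bound G(2)) auto
    moreover have "\<bar>c t / \<phi> t s\<bar> \<le> c t / \<Phi>min"
      using c_pos[of t] pos \<Phi>min_pos by (simp add: frac_le)
    ultimately have "\<bar>c t / \<phi> t s\<bar> * \<bar>noise (x t s) (w t s)\<bar> \<le> (c t / \<Phi>min) * (2 * G\<^sup>2)"
      by (intro mult_mono) (use c_pos[of t] \<Phi>min_pos in auto)
    then show ?thesis unfolding abs_mult by (simp add: C_def mult.commute)
  qed
  interpret orthogonal_increments P past "\<lambda>t s. c t / \<phi> t s * noise (x t s) (w t s)" "\<lambda>t. C * c t"
  proof
    show "(\<lambda>s. c t / \<phi> t s * noise (x t s) (w t s)) \<in> borel_measurable (past (Suc t))" for t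
      using \<phi>_past[of t "Suc t"] noise_measurable[OF past_mono[OF x_past] w_past[of t "Suc t"]]
      by (intro borel_measurable_times borel_measurable_divide) auto
    fix t and Z :: "'s \<Rightarrow> real" and B
    assume Z: "Z \<in> borel_measurable (past t)" "\<And>s. s \<in> space P \<Longrightarrow> \<bar>Z s\<bar> \<le> B"
    \<comment> \<open>The past is held in \<open>s\<close> while the sample is a separate argument.
      Its mean over \<omega> vanishes by \<open>noise_mean\<close>, and inserting
      \<open>w t s\<close> for \<omega> recovers \<open>Z\<close> times the increment.\<close>
    define h where "h = (\<lambda>(s, \<omega>). Z s * (c t / \<phi> t s) * noise (x t s) \<omega>)"
    have h1: "(\<lambda>z. noise (x t (fst z)) (snd z)) \<in> borel_measurable (past t \<Otimes>\<^sub>M \<mu>)"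
      by (rule noise_measurable[OF measurable_compose[OF measurable_fst x_past] measurable_snd])
    have h2: "(\<lambda>z. Z (fst z) * (c t / \<phi> t (fst z))) \<in> borel_measurable (past t \<Otimes>\<^sub>M \<mu>)"
      using Z(1) \<phi>_past[of t t]
      by (intro measurable_compose[OF measurable_fst, of "\<lambda>s. Z s * (c t / \<phi> t s)"]) simp
    have h: "h \<in> borel_measurable (past t \<Otimes>\<^sub>M \<mu>)"
      using borel_measurable_times[OF h2 h1] by (simp add: h_def case_prod_beta')
    have "P.expectation (\<lambda>s. h (s, w t s)) = 0"
    proof (rule P.expectation_zero_indep[OF subalgebra_past w_measurable _ w_distr past_indep h])
      show "prob_space \<mu>" by unfold_locales
      show "integrable P (\<lambda>s. h (s, w t s))"
      proof (rule P.integrable_const_bound[where B="\<bar>B\<bar> * (C * c t)"])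
        show "(\<lambda>s. h (s, w t s)) \<in> borel_measurable P"
        proof (rule measurable_compose[OF _ h])
          show "(\<lambda>s. (s, w t s)) \<in> measurable P (past t \<Otimes>\<^sub>M \<mu>)"
            by (rule measurable_Pair[OF measurable_from_subalg[OF subalgebra_past[of t]] w_measurable]) simp
        qed
        have "norm (h (s, w t s)) \<le> \<bar>B\<bar> * (C * c t)" if "s \<in> space P" for s
          using mult_mono[OF order_trans[OF Z(2)[OF that] abs_ge_self] bound[OF that, of t]]
          by (simp add: h_def abs_mult mult.assoc)
        then show "AE s in P. norm (h (s, w t s)) \<le> \<bar>B\<bar> * (C * c t)" by simp
      qed
      show "(\<integral>\<omega>. h (s, \<omega>) \<partial>\<mu>) = 0" for s by (simp add: h_def noise_mean)
    qed
    then show "P.expectation (\<lambda>s. Z s * (c t / \<phi> t s * noise (x t s) (w t s))) = 0"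
      by (simp add: h_def mult.assoc)
  qed (use subalgebra_past sets_past_Suc bound in auto)
  have "summable (\<lambda>t. C\<^sup>2 * (c t)\<^sup>2)" by (rule summable_mult[OF c_square_sum])
  then show ?thesis by (intro converges_AE) (simp add: power_mult_distrib)
qed

end

theorem theorem2p6:
  fixes \<A> :: "('a::{t2_space, second_countable_topology}, 'e::euclidean_space) chart set"
    and g :: "'a \<Rightarrow> 'e \<Rightarrow> 'e \<Rightarrow> real"
    and R :: "'a \<Rightarrow> 'e \<Rightarrow> 'a"
    and \<mu> :: "'w measure"
    and f :: "'a \<Rightarrow> 'w \<Rightarrow> real"
    and F :: "'a \<Rightarrow> real"
    and \<rho> :: "'a \<Rightarrow> real"
    and \<rho>0 \<rho>1 a b \<Theta> cmax \<sigma> :: real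
    and c :: "nat \<Rightarrow> real"
    and P :: "'s measure"
    and w :: "nat \<Rightarrow> 's \<Rightarrow> 'w"
    and x0 :: 'a
    and x :: "nat \<Rightarrow> 's \<Rightarrow> 'a"
    and \<phi> :: "nat \<Rightarrow> 's \<Rightarrow> real"
  assumes manifold: "riemannian_manifold \<A> g"
    and retraction: "retraction_on \<A> R" "Ck_tangent_bundle \<A> 2 R"
    and prob_mu: "prob_space \<mu>"
    and f_random: "random_function \<mu> f"
    and f_diff: "differentiable_in_M \<A> \<mu> f"
    and f_bounded: "locally_bounded \<mu> f"
    and grad_bounded: "locally_bounded \<mu> (\<lambda>y \<omega>. gnorm g y (grad_M \<A> g f y \<omega>))"
    and f_Lipschitz: "locally_R_Lipschitz_gradient g R \<mu> f"
    and F_def: "\<And>y. F y = (\<integral>\<omega>. f y \<omega> \<partial>\<mu>)"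
    and rho_confinement: "confinement \<A> g \<mu> f \<rho>"
    and rho_C2: "Ck_manifold \<A> 2 \<rho>"
    and rho0: "confinement_bound \<A> g \<mu> f \<rho> \<rho>0"
    and prob_P: "prob_space P"
    and w_indep: "prob_space.indep_vars P (\<lambda>_. \<mu>) w UNIV"
    and w_distr: "\<And>t. distr P \<mu> (w t) = \<mu>"
    and constants_pos: "a > 0" "b > 0" "\<Theta> > 0"
    and c_pos: "\<And>t. c t > 0"
    and c_sum: "filterlim (\<lambda>n. \<Sum>t<n. c t) at_top sequentially"
    and c_square_sum: "summable (\<lambda>t. (c t)\<^sup>2)"
    and cmax_def: "cmax = (GREATEST y. y \<in> range c)"
    and sigma_def: "\<sigma> = (\<Sum>t. (c t)\<^sup>2)"
    and rho1_def: "\<rho>1 = \<rho>0 + cmax * a + b\<^sup>2 * \<sigma> / 2"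
    and x0: "\<rho> x0 \<le> \<rho>0"
    and x_random: "\<And>t. x t \<in> measurable P borel"
    and phi_random: "\<And>t. \<phi> t \<in> borel_measurable P"
    and phi_pos: "\<And>t s. s \<in> space P \<Longrightarrow> \<phi> t s > 0"
    and x_start: "\<And>s. s \<in> space P \<Longrightarrow> x 0 s = x0"
    and x_step: "\<And>t s. s \<in> space P \<Longrightarrow>
      x (Suc t) s = R (x t s) (- (c t / \<phi> t s) *\<^sub>R grad_M \<A> g f (x t s) (w t s))"
    and phi_bound: "\<And>t s. s \<in> space P \<Longrightarrow>
      \<phi> t s \<ge> Max {A_bound \<A> g \<mu> f \<rho> a (x t s), B_bound \<A> g R \<mu> f \<rho> b \<Theta> (x t s), c t / \<Theta>}"
  shows
    "compact {y. \<rho> y \<le> \<rho>1} \<and>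
     (\<forall>s\<in>space P. (\<forall>t. x t s \<in> {y. \<rho> y \<le> \<rho>1}) \<and>
        (\<exists>r l. strict_mono r \<and> (\<lambda>k. x (r k) s) \<longlonglongrightarrow> l)) \<and>
     ((\<forall>t. nonanticipating P \<mu> w \<phi> t) \<and>
      (\<exists>\<Phi>min>0. \<exists>\<Phi>max>0. \<forall>t. \<forall>s\<in>space P. \<Phi>min \<le> \<phi> t s \<and> \<phi> t s \<le> \<Phi>max) \<longrightarrow>
        (\<forall>y. mdifferentiable_at \<A> F y) \<and>
        (AE s in P. \<exists>L. (\<lambda>t. F (x t s)) \<longlonglongrightarrow> L) \<and>
        (AE s in P. (\<lambda>t. gnorm g (x t s) (riem_grad \<A> g F (x t s))) \<longlonglongrightarrow> 0) \<and>
        (AE s in P. \<forall>r l. strict_mono r \<and> (\<lambda>k. x (r k) s) \<longlonglongrightarrow> l \<longrightarrow> stationary_point \<A> g F l))"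
proof -
  interpret riemannian \<A> g
    using manifold by unfold_locales (simp_all add: riemannian_manifold_def)
  interpret ro: random_objective \<A> g R \<mu> f
  proof (intro random_objective.intro riemannian_retraction.intro)
    show "riemannian \<A> g" by unfold_locales
    show "riemannian_retraction_axioms \<A> R" using retraction by unfold_locales
    show "random_objective_axioms \<A> g R \<mu> f"
      using f_random f_diff f_bounded grad_bounded f_Lipschitz by unfold_locales
  qed (fact prob_mu)
  interpret P: prob_space P by (fact prob_P)
  have F: "F = ro.F" using F_def by (auto simp: ro.F_def)
  have \<rho>_diff: "mdifferentiable_at \<A> \<rho> y" for y using rho_confinement by (simp add: confinement_def)
  have compact: "compact {y. \<rho> y \<le> \<rho>1}" using rho_confinement by (simp add: confinement_def)
  have w: "w t s \<in> space \<mu>" if "s \<in> space P" for t s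
  proof -
    have "w t \<in> measurable P \<mu>" using conjunct1[OF w_indep[unfolded P.indep_vars_def]] by blast
    then show ?thesis using that by (rule measurable_space)
  qed
  \<comment> \<open>\<open>GREATEST\<close> denotes the maximum only if it is attained. As
    \<open>c\<close> tends to 0, all terms from some \<open>T\<close> on are below
    \<open>c 0\<close>, so the maximum over \<open>{..T}\<close> is the maximum of all.\<close>
  have c_max: "c t \<le> cmax" for t
  proof -
    have "c \<longlonglongrightarrow> 0"
      using tendsto_real_sqrt[OF summable_LIMSEQ_zero[OF c_square_sum]] c_pos by (simp add: abs_of_pos)
    then have "\<forall>\<^sub>F t in sequentially. c t < c 0" using c_pos[of 0] by (rule order_tendstoD(2))
    then obtain T where T: "\<And>t. t \<ge> T \<Longrightarrow> c t < c 0" unfolding eventually_sequentially by blast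
    define m where "m = Max (c ` {..T})"
    have "m \<in> c ` {..T}" unfolding m_def by (intro Max_in) auto
    have m: "c t \<le> m" for t
    proof (cases "t \<le> T")
      case True then show ?thesis unfolding m_def by (intro Max_ge) auto
    next
      case False
      then have "c t < c 0" using T by simp
      also have "c 0 \<le> m" unfolding m_def by (intro Max_ge) auto
      finally show ?thesis by simp
    qed
    have "cmax = m"
      unfolding cmax_def using \<open>m \<in> c ` {..T}\<close> m by (intro Greatest_equality) auto
    then show ?thesis using m by simp
  qed
  have confined: "\<rho> (x t s) \<le> \<rho>1" if s: "s \<in> space P" for t s
  proof -
    have "\<rho> (x t s) \<le> \<rho>0 + cmax * a + b\<^sup>2 / 2 * (\<Sum>i<t. (c i)\<^sup>2)"
      using s x0
      by (intro ro.iterates_confined[where X="\<lambda>t. x t s" and \<phi>="\<lambda>t. \<phi> t s" and \<omega>="\<lambda>t. w t s" and \<Theta>=\<Theta>]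
          constants_pos c_pos phi_pos \<rho>_diff rho_C2 rho0 w x_step phi_bound c_max) (simp_all add: x_start)
    also have "\<dots> \<le> \<rho>0 + cmax * a + b\<^sup>2 / 2 * \<sigma>"
      unfolding sigma_def by (intro add_left_mono mult_left_mono sum_le_suminf c_square_sum) auto
    finally show ?thesis by (simp add: rho1_def)
  qed
  have subseq: "\<exists>r l. strict_mono r \<and> (\<lambda>k. x (r k) s) \<longlonglongrightarrow> l" if s: "s \<in> space P" for s
  proof -
    have "\<forall>t. x t s \<in> {y. \<rho> y \<le> \<rho>1}" using confined[OF s] by simp
    then obtain l r where "strict_mono r" "((\<lambda>t. x t s) \<circ> r) \<longlonglongrightarrow> l"
      by (rule seq_compactE[OF compact_imp_seq_compact[OF compact]])
    then show ?thesis unfolding comp_def by blast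
  qed
  have second: "(\<forall>y. mdifferentiable_at \<A> F y) \<and>
      (AE s in P. \<exists>L. (\<lambda>t. F (x t s)) \<longlonglongrightarrow> L) \<and>
      (AE s in P. (\<lambda>t. gnorm g (x t s) (riem_grad \<A> g F (x t s))) \<longlonglongrightarrow> 0) \<and>
      (AE s in P. \<forall>r l. strict_mono r \<and> (\<lambda>k. x (r k) s) \<longlonglongrightarrow> l \<longrightarrow> stationary_point \<A> g F l)"
    if nonant: "\<And>t. nonanticipating P \<mu> w \<phi> t" and \<Phi>min: "\<Phi>min > 0"
      and bounds: "\<And>t s. s \<in> space P \<Longrightarrow> \<Phi>min \<le> \<phi> t s \<and> \<phi> t s \<le> \<Phi>max" for \<Phi>min \<Phi>max
  proof -
    \<comment> \<open>The compact sublevel set plays the role of \<open>K\<close>, which makes the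
      local bounds uniform in time and over all paths.\<close>
    interpret stochastic_descent \<A> g R \<mu> f P w \<phi> x c x0 "{y. \<rho> y \<le> \<rho>1}" \<Phi>min \<Phi>max
      by (intro stochastic_descent.intro stochastic_descent_axioms.intro ro.random_objective_axioms prob_P
          compact x_start x_step w_distr nonant \<Phi>min bounds c_pos c_square_sum) (simp_all add: confined)
    have pathwise: "AE s in P. convergent (\<lambda>t. F (x t s)) \<and>
        (\<lambda>t. gnorm g (x t s) (riem_grad \<A> g F (x t s))) \<longlonglongrightarrow> 0"
      using noise_sums_converge AE_space
    proof eventually_elim
      case (elim s)
      note path = ro.pathwise_convergence[where X="\<lambda>t. x t s" and \<omega>="\<lambda>t. w t s" and \<phi>="\<lambda>t. \<phi> t s",
          OF compact _ w[OF elim(2)] c_pos c_sum c_square_sum \<Phi>min _ _ x_step[OF elim(2)] elim(1)]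
      show ?case unfolding F using path bounds[OF elim(2)] confined[OF elim(2)] by blast
    qed
    have "AE s in P. \<forall>r l. strict_mono r \<and> (\<lambda>k. x (r k) s) \<longlonglongrightarrow> l \<longrightarrow> stationary_point \<A> g F l"
      using pathwise
    proof eventually_elim
      case (elim s)
      show ?case
      proof (intro allI impI)
        fix r l assume r: "strict_mono r \<and> (\<lambda>k. x (r k) s) \<longlonglongrightarrow> l"
        have "(\<lambda>k. gnorm g (x (r k) s) (riem_grad \<A> g F (x (r k) s))) \<longlonglongrightarrow> 0"
          using LIMSEQ_subseq_LIMSEQ[OF conjunct2[OF elim] conjunct1[OF r]] by (simp add: comp_def)
        then show "stationary_point \<A> g F l"
          unfolding F using r by (intro ro.stationary_limit[where X="\<lambda>k. x (r k) s"]) auto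
      qed
    qed
    moreover have "AE s in P. \<exists>L. (\<lambda>t. F (x t s)) \<longlonglongrightarrow> L"
      using pathwise by eventually_elim (simp add: convergent_def)
    moreover have "AE s in P. (\<lambda>t. gnorm g (x t s) (riem_grad \<A> g F (x t s))) \<longlonglongrightarrow> 0"
      using pathwise by eventually_elim simp
    ultimately show ?thesis unfolding F using ro.F_mdifferentiable by blast
  qed
  show ?thesis
    using compact confined subseq second by blast
qed

end
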